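(* Let $A$, $\Lambda$, $E$, $m=\dim E$, $r_N$, $z_k$, $w_k$, $\mathcal{V}$, $\mathcal{V}_h$, $R_h(z)$, $S_N$, $S_N^h$, $P_h$ and $E_h=\operatorname{ran}P_h$ be as in the context, and suppose Assumptions 1, 2 and 3 stated in the context hold. Starting with a subspace $E_h^{(0)}\subseteq\mathcal{V}_h$ satisfying $\dim(E_h^{(0)})=\dim(P_hE_h^{(0)})=m$, define $E_h^{(\ell)}=S_N^hE_h^{(\ell-1)}$ for $\ell=1,2,\ldots$. Then there is an $h_0>0$ such that, for all $h<h_0$, $$\lim_{\ell\to\infty}\operatorname{gap}_{\mathcal{V}}\big(E_h^{(\ell)},E_h\big)=0.$$
   Context: Setting. $A:\operatorname{dom}(A)\subseteq\mathcal{H}\to\mathcal{H}$ is a linear, closed, selfadjoint (not necessarily bounded) operator in a complex Hilbert space $\mathcal{H}$, with spectrum $\Sigma(A)\subset\mathbb{R}$ and resolvent $R(z)=(z-A)^{-1}$. $\Lambda\subset\Sigma(A)$ is a finite collection of eigenvalues of finite multiplicity; $E$ is the span of all eigenvectors associated with elements of $\Lambda$; $m=\dim E$, assumed to satisfy $1\le m<\infty$; $\lambda_1,\ldots,\lambda_m$ are the elements of $\Lambda$ counted with multiplicity. Filter. $r_N(\xi)=w_N+\sum_{k=0}^{N-1}w_k(z_k-\xi)^{-1}$ with $w_k,z_k\in\mathbb{C}$, $W=\sum_{k=0}^N|w_k|$, and $S_N=r_N(A)=w_N+\sum_{k=0}^{N-1}w_kR(z_k)$ (the scalar $w_N$ means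 $w_N$ times the identity). For $y\in\mathbb{R}$, $\gamma,\delta>0$ let $I_\gamma^y=\{x\in\mathbb{R}:|x-y|\le\gamma\}$, $O_{\delta,\gamma}^y=\{x\in\mathbb{R}:|x-y|\ge(1+\delta)\gamma\}$, and $\hat\kappa=\sup_{x\in O_{\delta,\gamma}^y}|r_N(x)|\,/\,\inf_{x\in I_\gamma^y}|r_N(x)|$. Assumption 1. There are $y\in\mathbb{R}$, $\delta>0$, $\gamma>0$ such that $\Lambda\subset I_\gamma^y$ and $\Sigma(A)\setminus\Lambda\subset O_{\delta,\gamma}^y$; and $r_N$ is a rational function of the form $r_N(\xi)=w_N+\sum_{k=0}^{N-1}w_k(z_k-\xi)^{-1}$ with $z_k\notin\overline{\Sigma(A)}$, $W<\infty$, $\hat\kappa<1$. Assumption 2. There is a Hilbert space $\mathcal{V}\subseteq\mathcal{H}$ such that $E\subseteq\mathcal{V}$, there is $C_{\mathcal{V}}>0$ with $\|u\|_{\mathcal{H}}\le C_{\mathcal{V}}\|u\|_{\mathcal{V}}$ for all $u\in\mathcal{V}$, and $\mathcal{V}$ is an invariant subspace of $R(z)$ for $z$ in the resolvent set of $A$. Discretization. For each value of a parameter $h>0$ (tending to $0$), $\mathcal{V}_h$ is a finite-dimensional subspace of $\mathcal{V}$ and $R_h(z):\mathcal{H}\to\mathcal{V}_h$ is a finite-rank approximation of $R(z)$; $S_N^h=w_N+\sum_{k=0}^{N-1}w_kR_h(z_k)$. Assumption 3. The operators $R_h(z_k)$ and $R(z_k)$ are bounded in $\mathcal{V}$ and $\lim_{h\to0}\|R_h(z_k)-R(z_k)\|_{\mathcal{V}}=0$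 for all $k=0,\ldots,N-1$ (operator norm on $\mathcal{V}$). $S_N$ and $S_N^h$ are viewed as bounded operators on $\mathcal{V}$. Let $\mu_i=r_N(\lambda_i)$ and $\mu_*=\sup\{|\mu|:\mu\in\Sigma(S_N)\setminus\{\mu_1,\ldots,\mu_m\}\}$; Assumption 1 gives $\mu_*<|\mu_i|$ and $\mu_i\neq0$ for $i=1,\ldots,m$. Fix a simple rectifiable closed curve $\Theta$ in $\mathbb{C}$ that encloses $\{\mu_1,\ldots,\mu_m\}$, lies strictly outside the circle of radius $\mu_*$ centered at $0$, and encloses no other element of $\Sigma(S_N)$ (nor $0$). For sufficiently small $h$, $\Theta$ lies in the resolvent set of $S_N^h$ and encloses exactly $m$ eigenvalues (with multiplicity) of $S_N^h$; for such $h$ define $P_h=\frac{1}{2\pi i}\oint_\Theta(z-S_N^h)^{-1}\,dz$ and $E_h=\operatorname{ran}P_h$ (so $\dim E_h=m$). Gap. For linear subspaces $M,L$ of $\mathcal{V}$, with $U_M^{\mathcal{V}}=\{w\in M:\|w\|_{\mathcal{V}}=1\}$ and $\operatorname{dist}_{\mathcal{V}}(x,L)=\inf_{l\in L}\|x-l\|_{\mathcal{V}}$, $\operatorname{gap}_{\mathcal{V}}(M,L)=\max\big[\sup_{x\in U_M^{\mathcal{V}}}\operatorname{dist}_{\mathcal{V}}(x,L),\ \sup_{x\in U_L^{\mathcal{V}}}\operatorname{dist}_{\mathcal{V}}(x,M)\big]$. *)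

theory Defs
  imports "HOL-Complex_Analysis.Complex_Analysis"
begin

section \<open>Complex Hilbert spaces\<close>

text \<open>Inner products are linear in the first argument. The last axiom also says that
  \<open>cinner x x\<close> is real and nonnegative, and that the norm is induced by the inner product.\<close>

class chilbert_space = banach +
  fixes scaleC :: "complex \<Rightarrow> 'a \<Rightarrow> 'a" (infixr "*\<^sub>C" 75)
    and cinner :: "'a \<Rightarrow> 'a \<Rightarrow> complex"
  assumes scaleC_add_right: "a *\<^sub>C (x + y) = a *\<^sub>C x + a *\<^sub>C y"
    and scaleC_add_left: "(a + b) *\<^sub>C x = a *\<^sub>C x + b *\<^sub>C x"
    and scaleC_scaleC: "a *\<^sub>C b *\<^sub>C x = (a * b) *\<^sub>C x"
    and scaleC_one: "1 *\<^sub>C x = x"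
    and scaleR_scaleC: "r *\<^sub>R x = complex_of_real r *\<^sub>C x"
    and cinner_commute: "cinner x y = cnj (cinner y x)"
    and cinner_add_left: "cinner (x + y) z = cinner x z + cinner y z"
    and cinner_scaleC_left: "cinner (a *\<^sub>C x) y = a * cinner x y"
    and cinner_self: "cinner x x = complex_of_real ((norm x)\<^sup>2)"

global_interpretation complex_vector: vector_space "scaleC :: complex \<Rightarrow> 'a \<Rightarrow> 'a::chilbert_space"
  by unfold_locales
    (simp_all add: scaleC_add_right scaleC_add_left scaleC_scaleC scaleC_one)

abbreviation csubspace :: "'a::chilbert_space set \<Rightarrow> bool"
  where "csubspace \<equiv> module.subspace scaleC"

abbreviation cspan :: "'a::chilbert_space set \<Rightarrow> 'a set"
  where "cspan \<equiv> module.span scaleC"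

abbreviation cdim :: "'a::chilbert_space set \<Rightarrow> nat"
  where "cdim \<equiv> vector_space.dim scaleC"

abbreviation clinear :: "('a::chilbert_space \<Rightarrow> 'b::chilbert_space) \<Rightarrow> bool"
  where "clinear \<equiv> Vector_Spaces.linear scaleC scaleC"

definition cfinite_dim :: "'a::chilbert_space set \<Rightarrow> bool"
  where "cfinite_dim M \<longleftrightarrow> (\<exists>B. finite B \<and> M \<subseteq> cspan B)"


section \<open>Operators\<close>

text \<open>A possibly unbounded operator is a pair of a domain \<open>D\<close> and a function \<open>T\<close>, of which only
  the values on \<open>D\<close> matter. An everywhere defined operator has \<open>D = UNIV\<close>.\<close>

definition linear_op :: "'a::chilbert_space set \<Rightarrow> ('a \<Rightarrow> 'a) \<Rightarrow> bool"
  where "linear_op D T \<longleftrightarrow> csubspace D \<and>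
    (\<forall>x\<in>D. \<forall>y\<in>D. T (x + y) = T x + T y) \<and> (\<forall>c. \<forall>x\<in>D. T (c *\<^sub>C x) = c *\<^sub>C T x)"

definition op_graph :: "'a::chilbert_space set \<Rightarrow> ('a \<Rightarrow> 'a) \<Rightarrow> ('a \<times> 'a) set"
  where "op_graph D T = (\<lambda>x. (x, T x)) ` D"

definition closed_op :: "'a::chilbert_space set \<Rightarrow> ('a \<Rightarrow> 'a) \<Rightarrow> bool"
  where "closed_op D T \<longleftrightarrow> closed (op_graph D T)"

text \<open>This is the graph of the adjoint operator when \<open>D\<close> is dense.\<close>

definition adjoint_graph :: "'a::chilbert_space set \<Rightarrow> ('a \<Rightarrow> 'a) \<Rightarrow> ('a \<times> 'a) set"
  where "adjoint_graph D T = {(y, z). \<forall>x\<in>D. cinner (T x) y = cinner x z}"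

definition selfadjoint_op :: "'a::chilbert_space set \<Rightarrow> ('a \<Rightarrow> 'a) \<Rightarrow> bool"
  where "selfadjoint_op D T \<longleftrightarrow> closure D = UNIV \<and> adjoint_graph D T = op_graph D T"

definition resolvent :: "'a::chilbert_space set \<Rightarrow> ('a \<Rightarrow> 'a) \<Rightarrow> complex \<Rightarrow> 'a \<Rightarrow> 'a"
  where "resolvent D T z = inv_into D (\<lambda>x. z *\<^sub>C x - T x)"

definition resolvent_set :: "'a::chilbert_space set \<Rightarrow> ('a \<Rightarrow> 'a) \<Rightarrow> complex set"
  where "resolvent_set D T =
    {z. bij_betw (\<lambda>x. z *\<^sub>C x - T x) D UNIV \<and> bounded_linear (resolvent D T z)}"

definition spectrum :: "'a::chilbert_space set \<Rightarrow> ('a \<Rightarrow> 'a) \<Rightarrow> complex set"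
  where "spectrum D T = - resolvent_set D T"

definition eigenspace :: "'a::chilbert_space set \<Rightarrow> ('a \<Rightarrow> 'a) \<Rightarrow> complex \<Rightarrow> 'a set"
  where "eigenspace D T l = {x\<in>D. T x = l *\<^sub>C x}"

definition eigenvalue :: "'a::chilbert_space set \<Rightarrow> ('a \<Rightarrow> 'a) \<Rightarrow> complex \<Rightarrow> bool"
  where "eigenvalue D T l \<longleftrightarrow> (\<exists>x\<in>eigenspace D T l. x \<noteq> 0)"

text \<open>The span of all eigenvectors for the eigenvalues in \<open>\<Lambda>\<close>.\<close>

definition total_eigenspace :: "'a::chilbert_space set \<Rightarrow> ('a \<Rightarrow> 'a) \<Rightarrow> complex set \<Rightarrow> 'a set"
  where "total_eigenspace D T \<Lambda> = cspan (\<Union>l\<in>\<Lambda>. eigenspace D T l)"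


section \<open>The rational filter\<close>

definition rN :: "nat \<Rightarrow> (nat \<Rightarrow> complex) \<Rightarrow> (nat \<Rightarrow> complex) \<Rightarrow> complex \<Rightarrow> complex"
  where "rN N w zs \<xi> = w N + (\<Sum>k<N. w k / (zs k - \<xi>))"

text \<open>The operator \<open>w\<^sub>N + \<Sum>k<N. w\<^sub>k R\<^sub>k\<close>.\<close>

definition filter_op :: "nat \<Rightarrow> (nat \<Rightarrow> complex) \<Rightarrow> (nat \<Rightarrow> 'a \<Rightarrow> 'a) \<Rightarrow> 'a \<Rightarrow> 'a::chilbert_space"
  where "filter_op N w R v = w N *\<^sub>C v + (\<Sum>k<N. w k *\<^sub>C R k v)"

definition I_set :: "real \<Rightarrow> real \<Rightarrow> real set"
  where "I_set y \<gamma> = {x. \<bar>x - y\<bar> \<le> \<gamma>}"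

definition O_set :: "real \<Rightarrow> real \<Rightarrow> real \<Rightarrow> real set"
  where "O_set y \<delta> \<gamma> = {x. \<bar>x - y\<bar> \<ge> (1 + \<delta>) * \<gamma>}"

text \<open>The nodes \<open>z\<^sub>k\<close> may be real. They are left out of the supremum and the infimum, because
  division by zero gives \<open>r\<^sub>N\<close> a meaningless finite value there; since \<open>r\<^sub>N\<close> is continuous with
  values in the Riemann sphere and neither set has isolated points, this does not affect the result.
  The values are extended reals since \<open>r\<^sub>N\<close> may be unbounded.\<close>

definition sup_filter :: "nat \<Rightarrow> (nat \<Rightarrow> complex) \<Rightarrow> (nat \<Rightarrow> complex) \<Rightarrow> real set \<Rightarrow> ennreal"
  where "sup_filter N w zs X =
    (SUP x\<in>{x\<in>X. complex_of_real x \<notin> zs ` {..<N}}. ennreal (cmod (rN N w zs (complex_of_real x))))"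

definition inf_filter :: "nat \<Rightarrow> (nat \<Rightarrow> complex) \<Rightarrow> (nat \<Rightarrow> complex) \<Rightarrow> real set \<Rightarrow> ennreal"
  where "inf_filter N w zs X =
    (INF x\<in>{x\<in>X. complex_of_real x \<notin> zs ` {..<N}}. ennreal (cmod (rN N w zs (complex_of_real x))))"

definition kappa_hat ::
    "nat \<Rightarrow> (nat \<Rightarrow> complex) \<Rightarrow> (nat \<Rightarrow> complex) \<Rightarrow> real \<Rightarrow> real \<Rightarrow> real \<Rightarrow> ennreal"
  where "kappa_hat N w zs y \<delta> \<gamma> =
    sup_filter N w zs (O_set y \<delta> \<gamma>) / inf_filter N w zs (I_set y \<gamma>)"

text \<open>The condition on \<open>inf_filter\<close> makes the quotient meaningful: \<open>0 / 0 = 0\<close> in \<open>ennreal\<close>.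
  The condition \<open>\<Sum>k\<le>N. |w\<^sub>k| < \<infinity>\<close> on complex weights holds automatically.\<close>

definition assumption1 :: "'h::chilbert_space set \<Rightarrow> ('h \<Rightarrow> 'h) \<Rightarrow> complex set \<Rightarrow>
    nat \<Rightarrow> (nat \<Rightarrow> complex) \<Rightarrow> (nat \<Rightarrow> complex) \<Rightarrow> bool"
  where "assumption1 D A \<Lambda> N w zs \<longleftrightarrow>
    (\<exists>y \<delta> \<gamma>. \<delta> > 0 \<and> \<gamma> > 0 \<and>
      \<Lambda> \<subseteq> complex_of_real ` I_set y \<gamma> \<and>
      spectrum D A - \<Lambda> \<subseteq> complex_of_real ` O_set y \<delta> \<gamma> \<and>
      inf_filter N w zs (I_set y \<gamma>) > 0 \<and>
      kappa_hat N w zs y \<delta> \<gamma> < 1) \<and>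
    (\<forall>k<N. zs k \<notin> closure (spectrum D A))"


section \<open>The space \<open>\<V>\<close> and the discretization\<close>

text \<open>The Hilbert space \<open>\<V> \<subseteq> \<H>\<close>, which has its own norm, is a separate type with an injective
  linear map \<open>\<iota>\<close> into \<open>\<H>\<close> as inclusion.\<close>

definition assumption2 :: "'h::chilbert_space set \<Rightarrow> ('h \<Rightarrow> 'h) \<Rightarrow> complex set \<Rightarrow>
    ('v::chilbert_space \<Rightarrow> 'h) \<Rightarrow> bool"
  where "assumption2 D A \<Lambda> \<iota> \<longleftrightarrow>
    clinear \<iota> \<and> inj \<iota> \<and>
    total_eigenspace D A \<Lambda> \<subseteq> range \<iota> \<and>
    (\<exists>C>0. \<forall>u. norm (\<iota> u) \<le> C * norm u) \<and>
    (\<forall>z\<in>resolvent_set D A. resolvent D A z ` range \<iota> \<subseteq> range \<iota>)"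

text \<open>The restriction to \<open>\<V>\<close> of an operator on \<open>\<H>\<close> under which \<open>\<V>\<close> is invariant.\<close>

definition restrict_op :: "('v \<Rightarrow> 'h) \<Rightarrow> ('h \<Rightarrow> 'h) \<Rightarrow> 'v \<Rightarrow> 'v"
  where "restrict_op \<iota> T v = inv \<iota> (T (\<iota> v))"

definition discretization :: "nat \<Rightarrow> (nat \<Rightarrow> complex) \<Rightarrow> (real \<Rightarrow> 'v::chilbert_space set) \<Rightarrow>
    (real \<Rightarrow> complex \<Rightarrow> 'h::chilbert_space \<Rightarrow> 'v) \<Rightarrow> bool"
  where "discretization N zs Vh Rh \<longleftrightarrow>
    (\<forall>h>0. csubspace (Vh h) \<and> cfinite_dim (Vh h) \<and>
      (\<forall>k<N. clinear (Rh h (zs k)) \<and> range (Rh h (zs k)) \<subseteq> Vh h))"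

definition assumption3 :: "'h::chilbert_space set \<Rightarrow> ('h \<Rightarrow> 'h) \<Rightarrow> nat \<Rightarrow> (nat \<Rightarrow> complex) \<Rightarrow>
    ('v::chilbert_space \<Rightarrow> 'h) \<Rightarrow> (real \<Rightarrow> complex \<Rightarrow> 'h \<Rightarrow> 'v) \<Rightarrow> bool"
  where "assumption3 D A N zs \<iota> Rh \<longleftrightarrow>
    (\<forall>k<N. bounded_linear (restrict_op \<iota> (resolvent D A (zs k))) \<and>
      (\<forall>h>0. bounded_linear (Rh h (zs k) \<circ> \<iota>)) \<and>
      ((\<lambda>h. onorm (\<lambda>v. Rh h (zs k) (\<iota> v) - restrict_op \<iota> (resolvent D A (zs k)) v))
        \<longlongrightarrow> 0) (at_right 0))"

text \<open>\<open>S\<^sub>N\<close> and \<open>S\<^sub>N\<^sup>h\<close> as operators on \<open>\<V>\<close>.\<close>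

definition SN :: "'h::chilbert_space set \<Rightarrow> ('h \<Rightarrow> 'h) \<Rightarrow> nat \<Rightarrow> (nat \<Rightarrow> complex) \<Rightarrow>
    (nat \<Rightarrow> complex) \<Rightarrow> ('v::chilbert_space \<Rightarrow> 'h) \<Rightarrow> 'v \<Rightarrow> 'v"
  where "SN D A N w zs \<iota> = filter_op N w (\<lambda>k. restrict_op \<iota> (resolvent D A (zs k)))"

definition SNh :: "nat \<Rightarrow> (nat \<Rightarrow> complex) \<Rightarrow> (nat \<Rightarrow> complex) \<Rightarrow> ('v::chilbert_space \<Rightarrow> 'h) \<Rightarrow>
    (real \<Rightarrow> complex \<Rightarrow> 'h \<Rightarrow> 'v) \<Rightarrow> real \<Rightarrow> 'v \<Rightarrow> 'v"
  where "SNh N w zs \<iota> Rh h = filter_op N w (\<lambda>k. Rh h (zs k) \<circ> \<iota>)"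


section \<open>Contours and spectral projections\<close>

text \<open>Finite length: the variation over divisions of the parameter interval is bounded.\<close>

definition rectifiable_path :: "(real \<Rightarrow> complex) \<Rightarrow> bool"
  where "rectifiable_path g \<longleftrightarrow> path g \<and>
    (\<exists>L. \<forall>d. d division_of {0..1} \<longrightarrow> (\<Sum>K\<in>d. cmod (g (Sup K) - g (Inf K))) \<le> L)"

text \<open>Contour integral along a rectifiable path, in the sense of Riemann-Stieltjes sums
  \<open>\<Sum> (g t\<^sub>j\<^sub>+\<^sub>1 - g t\<^sub>j) f (g s\<^sub>j)\<close>. The library's \<open>contour_integral\<close> handles neither
  vector-valued integrands nor paths that are not piecewise differentiable.\<close>

definition has_path_integral ::
    "(complex \<Rightarrow> 'a::chilbert_space) \<Rightarrow> 'a \<Rightarrow> (real \<Rightarrow> complex) \<Rightarrow> bool"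
  where "has_path_integral f i g \<longleftrightarrow>
    (\<forall>e>0. \<exists>d>0. \<forall>p. p tagged_division_of {0..1} \<and> (\<lambda>x. ball x d) fine p \<longrightarrow>
      norm ((\<Sum>(s, K)\<in>p. (g (Sup K) - g (Inf K)) *\<^sub>C f (g s)) - i) < e)"

definition path_integral :: "(real \<Rightarrow> complex) \<Rightarrow> (complex \<Rightarrow> 'a::chilbert_space) \<Rightarrow> 'a"
  where "path_integral g f = (THE i. has_path_integral f i g)"

text \<open>\<open>1/(2\<pi>\<i>) \<ointegral> (z - S)\<^sup>-\<^sup>1 dz\<close>, evaluated pointwise.\<close>

definition spectral_proj :: "(real \<Rightarrow> complex) \<Rightarrow> ('a \<Rightarrow> 'a) \<Rightarrow> 'a \<Rightarrow> 'a::chilbert_space"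
  where "spectral_proj g S v =
    (1 / (2 * complex_of_real pi * \<i>)) *\<^sub>C path_integral g (\<lambda>z. resolvent UNIV S z v)"

text \<open>Here the supremum of the empty set is \<open>0\<close>.\<close>

definition mu_star :: "('v::chilbert_space \<Rightarrow> 'v) \<Rightarrow> complex set \<Rightarrow> real"
  where "mu_star S M = Sup (insert 0 (cmod ` (spectrum UNIV S - M)))"

text \<open>The contour \<open>\<Theta>\<close>, parametrized counterclockwise by \<open>g\<close>; \<open>M\<close> is the set of the
  \<open>\<mu>\<^sub>i = r\<^sub>N \<lambda>\<^sub>i\<close>.\<close>

definition admissible_contour ::
    "(real \<Rightarrow> complex) \<Rightarrow> ('v::chilbert_space \<Rightarrow> 'v) \<Rightarrow> complex set \<Rightarrow> bool"
  where "admissible_contour g S M \<longleftrightarrow>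
    simple_path g \<and> pathfinish g = pathstart g \<and> rectifiable_path g \<and>
    (\<forall>z\<in>inside (path_image g). winding_number g z = 1) \<and>
    M \<subseteq> inside (path_image g) \<and>
    (\<forall>z\<in>path_image g. cmod z > mu_star S M) \<and>
    inside (path_image g) \<inter> spectrum UNIV S \<subseteq> M \<and>
    0 \<notin> inside (path_image g)"


section \<open>Gap between subspaces\<close>

text \<open>The distances are nonnegative; inserting \<open>0\<close> only fixes the supremum over the empty unit
  sphere of the zero subspace.\<close>

definition one_sided_gap :: "'v::chilbert_space set \<Rightarrow> 'v set \<Rightarrow> real"
  where "one_sided_gap M L = Sup (insert 0 ((\<lambda>x. infdist x L) ` {x\<in>M. norm x = 1}))"

definition gap :: "'v::chilbert_space set \<Rightarrow> 'v set \<Rightarrow> real"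
  where "gap M L = max (one_sided_gap M L) (one_sided_gap L M)"

end

theory Submission
  imports Defs "HOL-Computational_Algebra.Fundamental_Theorem_Algebra"
begin

text \<open>
  Write \<open>T\<close> for the discretized filter, \<open>S\<close> for the exact one, both on \<open>\<V>\<close>, and \<open>P\<close> for the
  spectral projection of \<open>T\<close> along the contour. Let \<open>r\<close> be the least modulus on the contour. As the
  contour avoids the disc of radius \<open>r\<close> around \<open>0\<close> and does not enclose \<open>0\<close>, it encloses only points
  of modulus at least \<open>r\<close>. The closed set \<open>K\<close> of all points of modulus at least \<open>r\<close> that are not
  enclosed lies in the resolvent set of \<open>S\<close>, with a uniform bound for the resolvent. Hence it also
  lies in the resolvent set of every operator \<open>T\<close> close to \<open>S\<close>, so that the spectrum of \<open>T\<close> consists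
  of points inside the contour and of points of modulus less than \<open>r\<close>.

  For such a \<open>T\<close>, the integral of \<open>z\<^sup>-\<^sup>n (z - T)\<^sup>-\<^sup>1 T\<^sup>n x\<close> along the contour does not depend on \<open>n\<close>,
  since the difference of two consecutive integrands is a negative power of \<open>z\<close>. Therefore
  \<open>\<parallel>P x\<parallel> \<le> C r\<^sup>-\<^sup>n \<parallel>T\<^sup>n x\<parallel>\<close>: powers of \<open>T\<close> grow at least like \<open>r\<^sup>n\<close> on the range of \<open>P\<close>. As \<open>T\<close> is a
  finite rank perturbation of a scalar, its spectrum is finite, and the residue theorem turns the
  difference of a large circle and the contour into a circle of some radius \<open>\<rho> < r\<close>. This gives
  \<open>\<parallel>T\<^sup>n (x - P x)\<parallel> \<le> C \<rho>\<^sup>n \<parallel>x\<parallel>\<close>. Together the two estimates show that \<open>P\<close> is idempotent. If \<open>P\<close> maps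
  the initial space injectively onto the range of \<open>P\<close>, then \<open>T\<^sup>n x\<close> and \<open>T\<^sup>n (P x)\<close> differ by at most
  a multiple of \<open>(\<rho> / r)\<^sup>n \<parallel>T\<^sup>n (P x)\<parallel>\<close>, and the gap tends to \<open>0\<close>.

  It remains to see that the range of \<open>P\<close> has dimension at most \<open>m\<close>; then the hypothesis on the initial
  space makes \<open>P\<close> bijective there. Let \<open>v\<close> be in the range of \<open>P\<close> and orthogonal (in \<open>\<H>\<close>) to all
  eigenvectors for \<open>\<Lambda>\<close>. The spectral projection of \<open>S\<close> annihilates \<open>v\<close>, and it is close to \<open>P\<close>,
  whence \<open>v = P v = 0\<close>. So the \<open>m\<close> coefficients with respect to a basis of the eigenspace determine the
  elements of the range.

  That the spectral projection of \<open>S\<close> annihilates such a \<open>v\<close> is where selfadjointness enters. Since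
  \<open>\<V>\<close> carries its own norm, spectral theory in \<open>\<H>\<close> says little about the spectrum of \<open>S\<close> on \<open>\<V>\<close>.
  But \<open>\<mu> - r\<^sub>N(A)\<close> is bounded below on the orthogonal complement of the eigenvectors for each of the
  values \<open>\<mu>\<close> in question, so that the \<open>\<H>\<close>-norm of \<open>(z - S)\<^sup>-\<^sup>1 v\<close> stays bounded as \<open>z\<close> tends to
  \<open>\<mu>\<close>. All singularities inside the contour are then removable for the functionals that come from
  \<open>\<H>\<close>; by Cauchy's theorem the contour integral vanishes in \<open>\<H>\<close>, and hence in \<open>\<V>\<close>.
  The lower bound for \<open>\<mu> - r\<^sub>N(A)\<close> follows by factorizing the numerator polynomial: a root outside
  the spectrum of \<open>A\<close> is harmless, and the remaining roots are isolated eigenvalues in \<open>\<Lambda>\<close>.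
\<close>

section \<open>Complex inner products and test vectors\<close>

lemma clinear_iff:
  "clinear f \<longleftrightarrow> (\<forall>x y. f (x + y) = f x + f y) \<and> (\<forall>c x. f (c *\<^sub>C x) = c *\<^sub>C f x)"
  by (auto simp: Vector_Spaces.linear_def module_hom_def module_hom_axioms_def
      complex_vector.vector_space_axioms complex_vector.module_axioms)

lemma clinear_add: "clinear f \<Longrightarrow> f (x + y) = f x + f y"
  and clinear_scaleC: "clinear f \<Longrightarrow> f (c *\<^sub>C x) = c *\<^sub>C f x"
  by (auto simp: clinear_iff)

lemma clinear_zero: "clinear f \<Longrightarrow> f 0 = 0"
  using clinear_add[of f 0 0] by simp

lemma clinear_diff: "clinear f \<Longrightarrow> f (x - y) = f x - f y"
  using clinear_add[of f "x - y" y] by (simp add: algebra_simps)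

lemma clinear_sum: "clinear f \<Longrightarrow> f (\<Sum>i\<in>I. x i) = (\<Sum>i\<in>I. f (x i))"
  by (induction I rule: infinite_finite_induct) (simp_all add: clinear_zero clinear_add)

lemma clinear_compose: "clinear f \<Longrightarrow> clinear g \<Longrightarrow> clinear (\<lambda>x. f (g x))"
  by (simp add: clinear_iff)

lemma clinear_funpow: "clinear T \<Longrightarrow> clinear (T ^^ n)" for T :: "'a \<Rightarrow> 'a::chilbert_space"
  by (induction n) (auto simp: clinear_iff)

lemma csubspace_iff:
  "csubspace M \<longleftrightarrow> 0 \<in> M \<and> (\<forall>x\<in>M. \<forall>y\<in>M. x + y \<in> M) \<and> (\<forall>c. \<forall>x\<in>M. c *\<^sub>C x \<in> M)"
  by (auto simp: complex_vector.subspace_def)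

lemmas scaleC_simps = complex_vector.scale_left_distrib complex_vector.scale_right_distrib
  complex_vector.scale_left_diff_distrib complex_vector.scale_right_diff_distrib
  complex_vector.scale_scale

lemma cinner_add_right: "cinner x (y + z) = cinner x y + cinner x z"
  by (metis cinner_add_left cinner_commute complex_cnj_add)

lemma cinner_scaleC_right: "cinner x (a *\<^sub>C y) = cnj a * cinner x y"
  by (metis cinner_scaleC_left cinner_commute complex_cnj_mult)

lemma cinner_zero_left [simp]: "cinner 0 y = 0"
  using cinner_scaleC_left[of 0 0 y] by simp

lemma cinner_zero_right [simp]: "cinner x 0 = 0"
  using cinner_scaleC_right[of x 0 0] by simp

lemma cinner_diff_left: "cinner (x - y) z = cinner x z - cinner y z"
  using cinner_add_left[of "x - y" y z] by simp

lemma cinner_diff_right: "cinner x (y - z) = cinner x y - cinner x z"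
  using cinner_add_right[of x "y - z" z] by simp

lemma cinner_sum_left: "cinner (\<Sum>i\<in>I. f i) y = (\<Sum>i\<in>I. cinner (f i) y)"
  by (induction I rule: infinite_finite_induct) (simp_all add: cinner_add_left)

lemma norm_scaleC: "norm (a *\<^sub>C x) = cmod a * norm (x :: 'a::chilbert_space)"
proof -
  have "cinner (a *\<^sub>C x) (a *\<^sub>C x) = (a * cnj a) * cinner x x"
    by (simp only: cinner_scaleC_left cinner_scaleC_right mult_ac)
  also have "\<dots> = complex_of_real ((cmod a)\<^sup>2 * (norm x)\<^sup>2)"
    by (simp only: complex_norm_square[symmetric] cinner_self of_real_mult)
  finally have "(norm (a *\<^sub>C x))\<^sup>2 = (cmod a * norm x)\<^sup>2"
    by (simp only: cinner_self of_real_eq_iff power_mult_distrib)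
  then show ?thesis by simp
qed

lemma norm_cinner_le: "cmod (cinner x y) \<le> norm x * norm (y :: 'a::chilbert_space)"
proof (cases "y = 0")
  case False
  let ?c = "cinner x y" and ?r = "norm y"
  define t where "t = ?c / complex_of_real (?r\<^sup>2)"
  have r: "?r\<^sup>2 > 0" using False by simp
  have "cinner (x - t *\<^sub>C y) (x - t *\<^sub>C y) = cinner x x - cnj t * ?c - t * cinner y (x - t *\<^sub>C y)"
    by (simp add: cinner_diff_left cinner_diff_right cinner_scaleC_left cinner_scaleC_right
        algebra_simps)
  also have "cinner y (x - t *\<^sub>C y) = cnj ?c - cnj t * complex_of_real (?r\<^sup>2)"
    by (simp only: cinner_diff_right cinner_scaleC_right cinner_self cinner_commute[of y x])
  also have "\<dots> = 0"
    using r by (simp add: t_def)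
  also have "cnj t * ?c = complex_of_real ((cmod ?c)\<^sup>2 / ?r\<^sup>2)"
    by (simp only: t_def complex_cnj_divide complex_cnj_complex_of_real of_real_divide
        complex_norm_square) (simp add: mult.commute)
  finally have "cinner (x - t *\<^sub>C y) (x - t *\<^sub>C y)
      = complex_of_real ((norm x)\<^sup>2 - (cmod ?c)\<^sup>2 / ?r\<^sup>2)"
    by (simp only: cinner_self mult_zero_right diff_0_right of_real_diff)
  then have "(norm (x - t *\<^sub>C y))\<^sup>2 = (norm x)\<^sup>2 - (cmod ?c)\<^sup>2 / ?r\<^sup>2"
    by (simp only: cinner_self of_real_eq_iff)
  then have "(cmod ?c)\<^sup>2 / ?r\<^sup>2 \<le> (norm x)\<^sup>2"
    by (metis diff_ge_0_iff_ge zero_le_power2)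
  then have "(cmod ?c)\<^sup>2 \<le> (norm x * ?r)\<^sup>2"
    using r by (simp only: pos_divide_le_eq power_mult_distrib)
  then show ?thesis by (rule power2_le_imp_le) simp
qed simp

text \<open>Vector-valued estimates and identities are reduced to scalar ones, and thus to complex analysis,
  by testing with the inner product.\<close>

lemma norm_le_by_test:
  fixes x :: "'a::chilbert_space"
  assumes "\<And>y. cmod (cinner x y) \<le> c * norm y" "0 \<le> c"
  shows "norm x \<le> c"
proof (cases "x = 0")
  case False
  have "norm x * norm x \<le> c * norm x"
    using assms(1)[of x] by (simp add: cinner_self power2_eq_square norm_mult)
  then show ?thesis using False by simp
qed (use assms in simp)

lemma cinner_eqI: "(\<And>y. cinner x y = cinner x' y) \<Longrightarrow> x = (x' :: 'a::chilbert_space)"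
  using norm_le_by_test[of "x - x'" 0] by (simp add: cinner_diff_left)

lemma tendsto_cinner_left:
  assumes "(f \<longlongrightarrow> l) F"
  shows "((\<lambda>t. cinner (f t) y) \<longlongrightarrow> cinner l (y :: 'a::chilbert_space)) F"
proof (rule Lim_null_comparison[where g = "\<lambda>t. norm (f t - l) * norm y", THEN LIM_zero_cancel])
  show "\<forall>\<^sub>F t in F. norm (cinner (f t) y - cinner l y) \<le> norm (f t - l) * norm y"
    by (intro always_eventually allI) (metis norm_cinner_le cinner_diff_left)
  show "((\<lambda>t. norm (f t - l) * norm y) \<longlongrightarrow> 0) F"
    using assms by (intro tendsto_mult_left_zero) (simp add: tendsto_norm_zero LIM_zero)
qed

section \<open>Finite dimensional subspaces\<close>

abbreviation cindependent :: "'a::chilbert_space set \<Rightarrow> bool"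
  where "cindependent C \<equiv> \<not> module.dependent scaleC C"

lemma csubspace_orthogonal: "csubspace {x. cinner x u = 0}"
  by (simp add: csubspace_iff cinner_add_left cinner_scaleC_left)

text \<open>A substitute for the orthogonal projection onto a finite dimensional subspace: the test vector
  for \<open>insert a C\<close> is corrected by a multiple of the one that separates \<open>a\<close> from \<open>C\<close>.\<close>

lemma separating_vector:
  assumes "finite C" "c \<notin> cspan C"
  shows "\<exists>u. (\<forall>x\<in>C. cinner x u = 0) \<and> cinner c u = 1"
  using assms
proof (induction C arbitrary: c rule: finite_induct)
  case empty
  then have "cinner c c \<noteq> 0" by (simp add: cinner_self)
  then have "cinner c ((1 / cnj (cinner c c)) *\<^sub>C c) = 1"
    by (simp add: cinner_scaleC_right)
  then show ?case by auto
next
  case (insert a C)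
  show ?case
  proof (cases "a \<in> cspan C")
    case True
    then have "c \<notin> cspan C"
      using insert.prems complex_vector.span_redundant by blast
    then obtain u where u: "\<forall>x\<in>C. cinner x u = 0" "cinner c u = 1"
      using insert.IH by blast
    have "cspan C \<subseteq> {x. cinner x u = 0}"
      using u(1) by (intro complex_vector.span_minimal csubspace_orthogonal) auto
    then show ?thesis using u True by auto
  next
    case False
    then obtain v where v: "\<forall>x\<in>C. cinner x v = 0" "cinner a v = 1"
      using insert.IH by blast
    define t where "t = cinner c v"
    have "c - t *\<^sub>C a \<notin> cspan C"
      using insert.prems complex_vector.span_breakdown_eq by blast
    then obtain w where w: "\<forall>x\<in>C. cinner x w = 0" "cinner (c - t *\<^sub>C a) w = 1"
      using insert.IH by blast
    let ?u = "w - cnj (cinner a w) *\<^sub>C v"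
    have "cinner c ?u = 1"
      using w(2) by (simp add: cinner_diff_right cinner_diff_left cinner_scaleC_left
          cinner_scaleC_right t_def algebra_simps)
    moreover have "\<forall>x\<in>insert a C. cinner x ?u = 0"
      using v w(1) by (simp add: cinner_diff_right cinner_scaleC_right)
    ultimately show ?thesis by blast
  qed
qed

lemma clinear_span_image: "clinear f \<Longrightarrow> cspan (f ` C) = f ` cspan C"
  for f :: "'a::chilbert_space \<Rightarrow> 'b::chilbert_space"
  by (metis Vector_Spaces.linear_def module_hom.span_image)

lemma injective_image_independent:
  fixes f :: "'a::chilbert_space \<Rightarrow> 'b::chilbert_space"
  assumes f: "clinear f" and C: "cindependent C" "\<And>x. x \<in> cspan C \<Longrightarrow> f x = 0 \<Longrightarrow> x = 0"
    and c: "c \<in> C"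
  shows "f c \<notin> cspan (f ` (C - {c}))"
proof
  assume "f c \<in> cspan (f ` (C - {c}))"
  then obtain y where y: "y \<in> cspan (C - {c})" "f c = f y"
    using clinear_span_image[OF f] by auto
  then have "y \<in> cspan C"
    by (meson Diff_subset complex_vector.span_mono subsetD)
  then have "c - y \<in> cspan C"
    using c by (simp add: complex_vector.span_diff complex_vector.span_base)
  then have "c = y"
    using C(2)[of "c - y"] y(2) f by (simp add: clinear_diff)
  then show False
    using y(1) C(1) c complex_vector.dependent_def by blast
qed

text \<open>The coordinates of \<open>x\<close> in a basis are inner products of \<open>f x\<close> with fixed vectors, which separate
  the images of the basis vectors from each other.\<close>

lemma injective_bounded_below:
  fixes f :: "'a::chilbert_space \<Rightarrow> 'b::chilbert_space"
  assumes f: "clinear f" and C: "finite C" "\<And>x. x \<in> cspan C \<Longrightarrow> f x = 0 \<Longrightarrow> x = 0"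
  shows "\<exists>k\<ge>0. \<forall>x\<in>cspan C. norm x \<le> k * norm (f x)"
proof -
  obtain B where B: "B \<subseteq> C" "cindependent B" "cspan B = cspan C"
  proof -
    obtain B where B: "B \<subseteq> C" "cindependent B" "C \<subseteq> cspan B"
      using complex_vector.maximal_independent_subset by blast
    then have "cspan B = cspan C"
      by (simp add: complex_vector.span_minimal complex_vector.span_mono subset_antisym)
    then show ?thesis using that B by blast
  qed
  have fB: "finite B" using B(1) C(1) finite_subset by blast
  have "\<exists>u. (\<forall>x\<in>f ` (B - {b}). cinner x u = 0) \<and> cinner (f b) u = 1" if "b \<in> B" for b
    by (rule separating_vector)
      (use fB B C(2) injective_image_independent[OF f B(2) _ that] in auto)
  then obtain u where u: "\<And>b. b \<in> B \<Longrightarrow> (\<forall>x\<in>f ` (B - {b}). cinner x (u b) = 0) \<and> cinner (f b) (u b) = 1"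
    by metis
  define k where "k = (\<Sum>b\<in>B. norm (u b) * norm b)"
  have "norm x \<le> k * norm (f x)" if x: "x \<in> cspan C" for x
  proof -
    obtain a where a: "x = (\<Sum>b\<in>B. a b *\<^sub>C b)"
      using x B(3) complex_vector.span_finite[OF fB] by auto
    have "cinner (f x) (u b) = a b" if b: "b \<in> B" for b
    proof -
      have "cinner (f x) (u b) = (\<Sum>c\<in>B. a c * cinner (f c) (u b))"
        by (simp add: a clinear_sum[OF f] clinear_scaleC[OF f] cinner_sum_left cinner_scaleC_left)
      also have "\<dots> = (\<Sum>c\<in>B. if c = b then a b else 0)"
        by (rule sum.cong) (use u[OF b] in auto)
      finally show ?thesis using fB b by simp
    qed
    then have ab: "cmod (a b) \<le> norm (f x) * norm (u b)" if "b \<in> B" for b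
      using norm_cinner_le that by metis
    have "norm x \<le> (\<Sum>b\<in>B. cmod (a b) * norm b)"
      unfolding a by (rule order_trans[OF norm_sum]) (simp add: norm_scaleC)
    also have "\<dots> \<le> (\<Sum>b\<in>B. norm (f x) * norm (u b) * norm b)"
      by (intro sum_mono mult_right_mono ab) auto
    finally show ?thesis
      by (simp add: k_def sum_distrib_left mult_ac)
  qed
  moreover have "k \<ge> 0" by (simp add: k_def sum_nonneg)
  ultimately show ?thesis by blast
qed

lemma cdim_basis:
  assumes "csubspace W" "cdim W = m" "1 \<le> m"
  obtains C where "C \<subseteq> W" "finite C" "cindependent C" "cspan C = W" "card C = m"
proof -
  obtain C where C: "C \<subseteq> W" "cindependent C" "W \<subseteq> cspan C" "card C = cdim W"
    using complex_vector.basis_exists by blast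
  moreover have "cspan C \<subseteq> W" using C assms by (simp add: complex_vector.span_minimal)
  ultimately have "cspan C = W" "card C = m" "finite C"
    using assms(2,3) by (blast, simp, intro card_ge_0_finite, simp)
  then show thesis using that C by blast
qed

lemma injective_independent_image:
  assumes f: "clinear f" and C: "cindependent C" "\<And>x. x \<in> cspan C \<Longrightarrow> f x = 0 \<Longrightarrow> x = 0"
  shows "cindependent (f ` C)" "inj_on f C"
proof -
  show inj: "inj_on f C"
  proof (rule inj_onI)
    fix x y assume "x \<in> C" "y \<in> C" "f x = f y"
    then show "x = y"
      using C(2)[of "x - y"] f
      by (simp add: clinear_diff complex_vector.span_base complex_vector.span_diff)
  qed
  have "f ` C - {f c} = f ` (C - {c})" if "c \<in> C" for c
    using that inj by (auto simp: inj_on_def)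
  then show "cindependent (f ` C)"
    unfolding complex_vector.dependent_def
    using injective_image_independent[OF f C] by auto
qed

lemma independent_card_le:
  assumes f: "clinear f" and C: "cindependent C" "\<And>x. x \<in> cspan C \<Longrightarrow> f x = 0 \<Longrightarrow> x = 0"
    and B: "finite B" "f ` C \<subseteq> cspan B"
  shows "finite C \<and> card C \<le> card B"
proof -
  note im = injective_independent_image[OF f C]
  have "finite (f ` C) \<and> card (f ` C) \<le> card B"
    using complex_vector.independent_span_bound[OF B(1) im(1) B(2)] .
  then show ?thesis using im(2) by (simp add: card_image finite_image_iff)
qed

text \<open>The map \<open>f\<close> serves only to bound the dimension of \<open>F\<close>, which is not known to be finite.\<close>

lemma subspace_eq_by_dim:
  assumes f: "clinear f" and F: "csubspace F" "\<And>x. x \<in> F \<Longrightarrow> f x = 0 \<Longrightarrow> x = 0"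
    and B: "finite B" "f ` F \<subseteq> cspan B" "card B \<le> m"
    and W: "csubspace W" "W \<subseteq> F" "cdim W = m" "1 \<le> m"
  shows "W = F"
proof (rule ccontr)
  assume "W \<noteq> F"
  then obtain x where x: "x \<in> F" "x \<notin> W" using W by blast
  obtain C where C: "C \<subseteq> W" "finite C" "cindependent C" "cspan C = W" "card C = m"
    using cdim_basis W by metis
  have ind: "cindependent (insert x C)"
    using complex_vector.independent_insertI x C by auto
  have sub: "insert x C \<subseteq> F" using C x W by auto
  then have "cspan (insert x C) \<subseteq> F"
    using complex_vector.span_minimal F(1) by blast
  then have "\<And>x'. x' \<in> cspan (insert x C) \<Longrightarrow> f x' = 0 \<Longrightarrow> x' = 0"
    using F(2) by blast
  moreover have "f ` insert x C \<subseteq> cspan B"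
    using sub B(2) by blast
  ultimately have "card (insert x C) \<le> card B"
    using independent_card_le[OF f ind _ B(1)] by blast
  moreover have "x \<notin> C" using C x by blast
  ultimately show False using C B by simp
qed

text \<open>A kernel vector could be extended to a basis of \<open>W\<close>, and the image would be spanned by fewer
  than \<open>m\<close> vectors.\<close>

lemma injective_by_dim:
  assumes f: "clinear f" and W: "csubspace W" "cdim W = m" "cdim (f ` W) = m" "1 \<le> m"
    and x: "x \<in> W" "f x = 0"
  shows "x = 0"
proof (rule ccontr)
  assume "x \<noteq> 0"
  then have ix: "cindependent {x}" using complex_vector.independent_insertI[of x "{}"] by simp
  obtain C where C: "C \<subseteq> W" "finite C" "cindependent C" "cspan C = W" "card C = m"
    using cdim_basis W by metis
  obtain B where B: "{x} \<subseteq> B" "B \<subseteq> W" "cindependent B" "W \<subseteq> cspan B"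
    using complex_vector.maximal_independent_subset_extend[of "{x}" W] x ix by auto
  have fB: "finite B" "card B \<le> m"
    using complex_vector.independent_span_bound[of C B] C B by auto
  have "cspan (f ` B) = cspan (f ` (B - {x}))"
  proof -
    have "f ` B = insert 0 (f ` (B - {x}))" using B(1) x(2) by auto
    then show ?thesis by (simp add: complex_vector.span_insert_0)
  qed
  moreover have "f ` W \<subseteq> cspan (f ` B)"
    using B(4) clinear_span_image[OF f] by blast
  ultimately have "cdim (f ` W) \<le> card (f ` (B - {x}))"
    by (intro complex_vector.dim_le_card) (use fB in auto)
  also have "\<dots> \<le> card (B - {x})" using fB by (simp add: card_image_le)
  also have "\<dots> < card B"
    using fB B(1) by (intro psubset_card_mono) auto
  finally show False using fB(2) W(3) by linarith
qed

section \<open>Resolvents\<close>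

lemma linear_op_UNIV: "linear_op UNIV T \<longleftrightarrow> clinear T"
  by (auto simp: linear_op_def clinear_iff csubspace_iff)

lemma linear_op_add: "linear_op D T \<Longrightarrow> x \<in> D \<Longrightarrow> y \<in> D \<Longrightarrow> T (x + y) = T x + T y"
  and linear_op_scaleC: "linear_op D T \<Longrightarrow> x \<in> D \<Longrightarrow> T (c *\<^sub>C x) = c *\<^sub>C T x"
  and linear_op_domain: "linear_op D T \<Longrightarrow> csubspace D"
  by (auto simp: linear_op_def)

lemma linear_op_diff:
  assumes "linear_op D T" "x \<in> D" "y \<in> D"
  shows "T (x - y) = T x - T y"
proof -
  have "x - y \<in> D"
    using assms complex_vector.subspace_diff linear_op_domain by blast
  then have "T (x - y + y) = T (x - y) + T y"
    using assms linear_op_add by blast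
  then show ?thesis by simp
qed

lemma linear_op_plus:
  assumes "linear_op D T" "clinear B"
  shows "linear_op D (\<lambda>x. T x + B x)"
  using assms by (simp add: linear_op_def clinear_iff scaleC_simps)

lemma clinear_bounded_linear:
  assumes "clinear f" "\<And>x. norm (f x) \<le> c * norm x"
  shows "bounded_linear f"
  by (rule bounded_linear_intro[where K = c])
    (use assms in \<open>simp_all add: clinear_iff scaleR_scaleC mult.commute\<close>)

lemma
  assumes T: "linear_op D T" and z: "z \<in> resolvent_set D T"
  shows resolvent_in_domain: "resolvent D T z y \<in> D"
    and resolvent_right: "z *\<^sub>C resolvent D T z y - T (resolvent D T z y) = y"
    and resolvent_left: "x \<in> D \<Longrightarrow> resolvent D T z (z *\<^sub>C x - T x) = x"
proof -
  have b: "bij_betw (\<lambda>x. z *\<^sub>C x - T x) D UNIV"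
    using z by (simp add: resolvent_set_def)
  then have im: "y \<in> (\<lambda>x. z *\<^sub>C x - T x) ` D" for y
    by (simp add: bij_betw_def)
  show "resolvent D T z y \<in> D" "z *\<^sub>C resolvent D T z y - T (resolvent D T z y) = y"
    unfolding resolvent_def using inv_into_into[OF im] f_inv_into_f[OF im] by auto
  show "x \<in> D \<Longrightarrow> resolvent D T z (z *\<^sub>C x - T x) = x"
    unfolding resolvent_def
    using b inv_into_f_f[of "\<lambda>x. z *\<^sub>C x - T x" D x] by (simp add: bij_betw_def)
qed

lemma resolvent_eqI:
  assumes "linear_op D T" "z \<in> resolvent_set D T" "x \<in> D" "z *\<^sub>C x - T x = y"
  shows "resolvent D T z y = x"
  using assms resolvent_left by blast

lemma clinear_resolvent:
  assumes T: "linear_op D T" and z: "z \<in> resolvent_set D T"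
  shows "clinear (resolvent D T z)"
  unfolding clinear_iff
proof (intro conjI allI)
  note D = linear_op_domain[OF T, unfolded csubspace_iff] resolvent_in_domain[OF T z]
    resolvent_right[OF T z]
  show "resolvent D T z (x + y) = resolvent D T z x + resolvent D T z y" for x y
    by (rule resolvent_eqI[OF T z])
      (use D in \<open>simp_all add: linear_op_add[OF T] scaleC_simps add_diff_add\<close>)
  show "resolvent D T z (c *\<^sub>C x) = c *\<^sub>C resolvent D T z x" for c x
  proof (rule resolvent_eqI[OF T z])
    have "z *\<^sub>C c *\<^sub>C resolvent D T z x - T (c *\<^sub>C resolvent D T z x)
      = c *\<^sub>C (z *\<^sub>C resolvent D T z x - T (resolvent D T z x))"
      using resolvent_in_domain[OF T z]
      by (simp add: linear_op_scaleC[OF T] scaleC_simps mult.commute)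
    then show "z *\<^sub>C c *\<^sub>C resolvent D T z x - T (c *\<^sub>C resolvent D T z x) = c *\<^sub>C x"
      by (simp only: resolvent_right[OF T z])
  qed (use D in simp)
qed

lemma resolvent_bound:
  assumes "z \<in> resolvent_set D T"
  obtains c where "c > 0" "\<And>y. norm (resolvent D T z y) \<le> c * norm y"
proof -
  have "bounded_linear (resolvent D T z)" using assms by (simp add: resolvent_set_def)
  then obtain c where "c > 0" "\<And>y. norm (resolvent D T z y) \<le> norm y * c"
    using bounded_linear.pos_bounded by blast
  then show thesis using that by (simp add: mult.commute)
qed

lemma resolvent_setI:
  assumes T: "linear_op D T"
    and surj: "\<And>y. \<exists>x\<in>D. z *\<^sub>C x - T x = y"
    and bound: "\<And>x. x \<in> D \<Longrightarrow> norm x \<le> c * norm (z *\<^sub>C x - T x)"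
  shows "z \<in> resolvent_set D T" "norm (resolvent D T z y) \<le> c * norm y"
proof -
  let ?f = "\<lambda>x. z *\<^sub>C x - T x"
  have D: "csubspace D" using T linear_op_domain by blast
  have "inj_on ?f D"
  proof (rule inj_onI)
    fix x y assume xy: "x \<in> D" "y \<in> D" "?f x = ?f y"
    then have "x - y \<in> D" using D complex_vector.subspace_diff by blast
    moreover have "?f (x - y) = 0"
      using xy by (simp add: linear_op_diff[OF T] scaleC_simps algebra_simps)
    ultimately show "x = y" using bound[of "x - y"] by simp
  qed
  moreover have im: "?f ` D = UNIV" using surj by (auto simp: image_iff) metis
  ultimately have bij: "bij_betw ?f D UNIV" by (simp add: bij_betw_def)
  have R: "resolvent D T z y \<in> D" "?f (resolvent D T z y) = y" for y
    unfolding resolvent_def using inv_into_into[of y ?f D] f_inv_into_f[of y ?f D] im by auto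
  then have le: "norm (resolvent D T z y) \<le> c * norm y" for y
    using bound by metis
  have uniq: "resolvent D T z (?f x) = x" if "x \<in> D" for x
    unfolding resolvent_def using bij that inv_into_f_f[of ?f D x] by (simp add: bij_betw_def)
  have "clinear (resolvent D T z)"
    unfolding clinear_iff
  proof (intro conjI allI)
    fix x y c
    let ?R = "resolvent D T z"
    have "?R x + ?R y \<in> D" using R D by (simp add: csubspace_iff)
    moreover have "?f (?R x + ?R y) = ?f (?R x) + ?f (?R y)"
      using R(1) by (simp add: linear_op_add[OF T] scaleC_simps)
    ultimately show "?R (x + y) = ?R x + ?R y" using uniq R by metis
    have "c *\<^sub>C ?R x \<in> D" using R D by (simp add: csubspace_iff)
    moreover have "?f (c *\<^sub>C ?R x) = c *\<^sub>C ?f (?R x)"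
      using R(1) by (simp add: linear_op_scaleC[OF T] scaleC_simps mult.commute)
    ultimately show "?R (c *\<^sub>C x) = c *\<^sub>C ?R x" using uniq R by metis
  qed
  then have "bounded_linear (resolvent D T z)"
    using le clinear_bounded_linear by blast
  then show "z \<in> resolvent_set D T" using bij by (simp add: resolvent_set_def)
  show "norm (resolvent D T z y) \<le> c * norm y" by (rule le)
qed

text \<open>The equation \<open>(z - T - B) x = y\<close> says that \<open>x\<close> is a fixed point of the contraction
  \<open>x \<mapsto> (z - T)\<^sup>-\<^sup>1 (y + B x)\<close>.\<close>

lemma resolvent_perturb:
  assumes T: "linear_op D T" and z: "z \<in> resolvent_set D T"
    and c: "\<And>y. norm (resolvent D T z y) \<le> c * norm y" "0 \<le> c"
    and B: "clinear B" "\<And>x. norm (B x) \<le> b * norm x" "0 \<le> b" "b * c < 1"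
  shows "z \<in> resolvent_set D (\<lambda>x. T x + B x)"
    "norm (resolvent D (\<lambda>x. T x + B x) z y) \<le> c / (1 - b * c) * norm y"
proof -
  let ?R = "resolvent D T z"
  have surj: "\<exists>x\<in>D. z *\<^sub>C x - (T x + B x) = y" for y
  proof -
    have "dist (?R (y + B x)) (?R (y + B x')) \<le> (b * c) * dist x x'" for x x'
    proof -
      have "?R (y + B x) - ?R (y + B x') = ?R (B (x - x'))"
        by (simp add: clinear_diff[OF clinear_resolvent[OF T z], symmetric]
            clinear_diff[OF B(1)])
      then have "dist (?R (y + B x)) (?R (y + B x')) \<le> c * norm (B (x - x'))"
        using c(1) by (simp add: dist_norm)
      also have "\<dots> \<le> c * (b * norm (x - x'))" using B c(2) by (intro mult_left_mono)
      finally show ?thesis by (simp add: dist_norm mult_ac)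
    qed
    then obtain x where x: "?R (y + B x) = x"
      using banach_fix_type[of "b * c" "\<lambda>x. ?R (y + B x)"] B c by auto
    then have "x \<in> D" "z *\<^sub>C x - T x = y + B x"
      using resolvent_in_domain[OF T z] resolvent_right[OF T z] by metis+
    then show ?thesis by (intro bexI[of _ x]) (simp_all add: algebra_simps)
  qed
  have bound: "norm x \<le> c / (1 - b * c) * norm (z *\<^sub>C x - (T x + B x))" if x: "x \<in> D" for x
  proof -
    let ?y = "z *\<^sub>C x - (T x + B x)"
    have "x = ?R (?y + B x)"
      using resolvent_left[OF T z x] by (simp add: algebra_simps)
    then have "norm x \<le> c * norm (?y + B x)" using c(1) by metis
    also have "\<dots> \<le> c * (norm ?y + b * norm x)"
      using c(2) B(2)[of x] norm_triangle_ineq[of ?y "B x"] by (intro mult_left_mono) linarith+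
    finally have "(1 - b * c) * norm x \<le> c * norm ?y" by (simp add: algebra_simps)
    then show ?thesis using B(4) by (simp add: field_simps)
  qed
  note * = resolvent_setI[OF linear_op_plus[OF T B(1)] surj bound]
  show "z \<in> resolvent_set D (\<lambda>x. T x + B x)"
    "norm (resolvent D (\<lambda>x. T x + B x) z y) \<le> c / (1 - b * c) * norm y"
    using * by blast+
qed

text \<open>Moving the spectral parameter is a perturbation by a multiple of the identity.\<close>

lemma resolvent_shift:
  assumes T: "linear_op D T" and z: "z \<in> resolvent_set D T"
    and c: "\<And>y. norm (resolvent D T z y) \<le> c * norm y" "0 \<le> c"
    and z': "cmod (z - z') * c < 1"
  shows "z' \<in> resolvent_set D T"
    "norm (resolvent D T z' y) \<le> c / (1 - cmod (z - z') * c) * norm y"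
proof -
  have eq: "(\<lambda>x. z *\<^sub>C x - (T x + (z - z') *\<^sub>C x)) = (\<lambda>x. z' *\<^sub>C x - T x)"
    by (simp add: scaleC_simps)
  have "clinear (\<lambda>x. (z - z') *\<^sub>C x)"
    by (simp add: clinear_iff scaleC_simps mult.commute)
  note * = resolvent_perturb[OF T z c this _ _ z']
  have r: "resolvent D (\<lambda>x. T x + (z - z') *\<^sub>C x) z = resolvent D T z'"
    unfolding resolvent_def eq ..
  have s: "z \<in> resolvent_set D (\<lambda>x. T x + (z - z') *\<^sub>C x) \<longleftrightarrow> z' \<in> resolvent_set D T"
    unfolding resolvent_set_def r mem_Collect_eq eq ..
  show "z' \<in> resolvent_set D T" using *(1) s by (simp add: norm_scaleC)
  show "norm (resolvent D T z' y) \<le> c / (1 - cmod (z - z') * c) * norm y"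
    using *(2) r by (simp add: norm_scaleC)
qed

lemma resolvent_locally_bounded:
  assumes T: "linear_op D T" and w: "w \<in> resolvent_set D T"
  obtains e c where "e > 0" "c > 0" "ball w e \<subseteq> resolvent_set D T"
    "\<And>z y. z \<in> ball w e \<Longrightarrow> norm (resolvent D T z y) \<le> c * norm y"
proof -
  obtain c where c: "c > 0" "\<And>y. norm (resolvent D T w y) \<le> c * norm y"
    using resolvent_bound[OF w] by blast
  have *: "z \<in> resolvent_set D T \<and> norm (resolvent D T z y) \<le> 2 * c * norm y"
    if "z \<in> ball w (1 / (2 * c))" for z y
  proof -
    have d: "cmod (w - z) * c < 1 / 2"
      using that c(1) by (simp add: dist_norm field_simps)
    then have "c / (1 - cmod (w - z) * c) \<le> c / (1 / 2)"
      using c(1) by (intro divide_left_mono) auto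
    then have "c / (1 - cmod (w - z) * c) * norm y \<le> 2 * c * norm y"
      by (intro mult_right_mono) auto
    moreover have "cmod (w - z) * c < 1" "0 \<le> c" using d c(1) by auto
    ultimately show ?thesis
      using resolvent_shift[OF T w c(2)] order_trans by blast
  qed
  show thesis by (rule that[of "1 / (2 * c)" "2 * c"]) (use * c(1) in auto)
qed

lemma open_resolvent_set: "linear_op D T \<Longrightarrow> open (resolvent_set D T)"
  by (metis open_contains_ball resolvent_locally_bounded)

lemma resolvent_identity:
  assumes T: "linear_op D T" and z: "z \<in> resolvent_set D T" and w: "w \<in> resolvent_set D T"
  shows "resolvent D T z x - resolvent D T w x
    = (w - z) *\<^sub>C resolvent D T z (resolvent D T w x)"
proof -
  let ?R = "resolvent D T"
  let ?u = "?R z x - ?R w x"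
  note R = resolvent_in_domain[OF T z] resolvent_in_domain[OF T w]
    resolvent_right[OF T z] resolvent_right[OF T w]
  have u: "?u \<in> D"
    using R complex_vector.subspace_diff linear_op_domain[OF T] by blast
  have Tu: "T (?R z x) = z *\<^sub>C ?R z x - x" "T (?R w x) = w *\<^sub>C ?R w x - x"
    using R(3)[of x] R(4)[of x] by (simp_all add: diff_eq_eq eq_diff_eq add.commute)
  have "z *\<^sub>C (a - b) - ((z *\<^sub>C a - x) - (w *\<^sub>C b - x)) = (w - z) *\<^sub>C b" for a b
    by (simp add: complex_vector.scale_left_diff_distrib complex_vector.scale_right_diff_distrib)
  then have "z *\<^sub>C ?u - T ?u = (w - z) *\<^sub>C ?R w x"
    by (simp only: linear_op_diff[OF T R(1,2)] Tu)
  then have "?R z ((w - z) *\<^sub>C ?R w x) = ?u" by (rule resolvent_eqI[OF T z u])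
  then show ?thesis by (simp only: clinear_scaleC[OF clinear_resolvent[OF T z]])
qed

lemma continuous_on_resolvent:
  assumes T: "linear_op D T"
  shows "continuous_on (resolvent_set D T) (\<lambda>z. resolvent D T z x)"
proof -
  have "isCont (\<lambda>z. resolvent D T z x) w" if w: "w \<in> resolvent_set D T" for w
  proof -
    obtain e c where e: "e > 0" "c > 0" "ball w e \<subseteq> resolvent_set D T"
      "\<And>z y. z \<in> ball w e \<Longrightarrow> norm (resolvent D T z y) \<le> c * norm y"
      using resolvent_locally_bounded[OF T w] by blast
    have "\<forall>\<^sub>F z in at w. norm (resolvent D T z x - resolvent D T w x)
        \<le> cmod (w - z) * (c * norm (resolvent D T w x))"
      unfolding eventually_at
    proof (intro exI[of _ e] conjI ballI impI)
      fix z assume "z \<noteq> w \<and> dist z w < e"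
      then have z: "z \<in> ball w e" by (simp add: dist_commute)
      then have "resolvent D T z x - resolvent D T w x
          = (w - z) *\<^sub>C resolvent D T z (resolvent D T w x)"
        using resolvent_identity[OF T _ w] e(3) by blast
      then show "norm (resolvent D T z x - resolvent D T w x)
          \<le> cmod (w - z) * (c * norm (resolvent D T w x))"
        using e(4)[OF z] by (simp add: norm_scaleC mult_left_mono)
    qed (fact e(1))
    moreover have "((\<lambda>z. cmod (w - z) * (c * norm (resolvent D T w x))) \<longlongrightarrow> 0) (at w)"
      by (auto intro!: tendsto_eq_intros)
    ultimately have "((\<lambda>z. resolvent D T z x - resolvent D T w x) \<longlongrightarrow> 0) (at w)"
      by (rule Lim_null_comparison)
    then show ?thesis by (simp add: isCont_def LIM_zero_iff)
  qed
  then show ?thesis by (simp add: continuous_at_imp_continuous_on)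
qed

text \<open>The map \<open>J\<close> will be the inclusion into a larger Hilbert space. Then \<open>y\<close> tests only with those
  functionals that extend to the larger space.\<close>

lemma holomorphic_on_resolvent_functional:
  fixes J :: "'a::chilbert_space \<Rightarrow> 'b::chilbert_space"
  assumes T: "linear_op D T" and J: "clinear J" "\<And>x. norm (J x) \<le> c * norm x"
  shows "(\<lambda>z. cinner (J (resolvent D T z x)) y) holomorphic_on resolvent_set D T"
proof (rule holomorphic_onI)
  fix w assume w: "w \<in> resolvent_set D T"
  let ?R = "resolvent D T" and ?U = "resolvent_set D T"
  have U: "open ?U" by (rule open_resolvent_set[OF T])
  have "isCont (\<lambda>z. ?R z (?R w x)) w"
    using continuous_on_resolvent[OF T] U w continuous_on_eq_continuous_at by blast
  then have "((\<lambda>z. J (?R z (?R w x))) \<longlongrightarrow> J (?R w (?R w x))) (at w)"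
    by (intro bounded_linear.tendsto[OF clinear_bounded_linear[OF J]]) (simp add: isCont_def)
  then have "((\<lambda>z. - cinner (J (?R z (?R w x))) y) \<longlongrightarrow> - cinner (J (?R w (?R w x))) y) (at w)"
    by (intro tendsto_minus tendsto_cinner_left)
  moreover have "\<forall>\<^sub>F z in at w. - cinner (J (?R z (?R w x))) y
      = (cinner (J (?R z x)) y - cinner (J (?R w x)) y) / (z - w)"
  proof -
    have "\<forall>\<^sub>F z in at w. z \<in> ?U \<and> z \<noteq> w"
      using U w by (simp add: eventually_at_topological) blast
    then show ?thesis
    proof eventually_elim
      case (elim z)
      have "cinner (J (?R z x)) y - cinner (J (?R w x)) y = (w - z) * cinner (J (?R z (?R w x))) y"
        using resolvent_identity[OF T _ w] elim
        by (simp add: cinner_diff_left[symmetric] clinear_diff[OF J(1), symmetric]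
            clinear_scaleC[OF J(1)] cinner_scaleC_left)
      then show ?case using elim by (simp add: field_simps)
    qed
  qed
  ultimately have "((\<lambda>z. (cinner (J (?R z x)) y - cinner (J (?R w x)) y) / (z - w))
      \<longlongrightarrow> - cinner (J (?R w (?R w x))) y) (at w)"
    by (rule Lim_transform_eventually)
  then have "((\<lambda>z. cinner (J (?R z x)) y) has_field_derivative - cinner (J (?R w (?R w x))) y) (at w)"
    unfolding has_field_derivative_iff .
  then have "((\<lambda>z. cinner (J (?R z x)) y) has_field_derivative - cinner (J (?R w (?R w x))) y) (at w within ?U)"
    by (rule has_field_derivative_at_within)
  then show "(\<lambda>z. cinner (J (?R z x)) y) field_differentiable (at w within ?U)"
    using field_differentiable_def by blast
qed

lemma holomorphic_on_resolvent:
  assumes "linear_op D T"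
  shows "(\<lambda>z. cinner (resolvent D T z x) y) holomorphic_on resolvent_set D T"
  using holomorphic_on_resolvent_functional[of D T "\<lambda>x. x" 1 x y] assms by (simp add: clinear_iff)

lemma resolvent_bounded_on_compact:
  assumes T: "linear_op D T" and K: "compact K" "K \<subseteq> resolvent_set D T"
  obtains c where "c > 0" "\<And>z y. z \<in> K \<Longrightarrow> norm (resolvent D T z y) \<le> c * norm y"
proof -
  have "\<exists>e c. e > 0 \<and> c > 0 \<and> (\<forall>z\<in>ball w e. \<forall>y. norm (resolvent D T z y) \<le> c * norm y)"
    if "w \<in> K" for w
    using resolvent_locally_bounded[OF T, of w] that K(2) by (metis subsetD)
  then obtain e c where ec: "\<And>w. w \<in> K \<Longrightarrow> e w > 0 \<and> c w > 0 \<and>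
      (\<forall>z\<in>ball w (e w). \<forall>y. norm (resolvent D T z y) \<le> c w * norm y)"
    by metis
  have pos: "e w > 0" "c w > 0" if "w \<in> K" for w using ec[OF that] by auto
  obtain F where F: "F \<subseteq> K" "finite F" "K \<subseteq> (\<Union>w\<in>F. ball w (e w))"
  proof -
    have cover: "K \<subseteq> (\<Union>w\<in>K. ball w (e w))"
    proof
      fix w assume "w \<in> K"
      then have "w \<in> ball w (e w)" using pos by simp
      then show "w \<in> (\<Union>w\<in>K. ball w (e w))" using \<open>w \<in> K\<close> by blast
    qed
    show ?thesis
    proof (rule compactE_image[OF K(1) _ cover])
      fix F assume "F \<subseteq> K" "finite F" "K \<subseteq> (\<Union>w\<in>F. ball w (e w))"
      then show ?thesis by (rule that)
    qed (rule open_ball)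
  qed
  define C where "C = 1 + (\<Sum>w\<in>F. c w)"
  have C: "c w \<le> C" if "w \<in> F" for w
  proof -
    have "c w \<le> sum c F"
      using that F pos(2) by (intro member_le_sum) (auto simp: less_imp_le subset_iff)
    then show ?thesis by (simp add: C_def)
  qed
  have "C > 0"
  proof -
    have "0 \<le> sum c F" using F(1) pos(2) by (intro sum_nonneg) (auto simp: less_imp_le subset_iff)
    then show ?thesis by (simp add: C_def)
  qed
  moreover have "norm (resolvent D T z y) \<le> C * norm y" if z: "z \<in> K" for z y
  proof -
    obtain w where w: "w \<in> F" "z \<in> ball w (e w)" using F(3) z by blast
    then have "norm (resolvent D T z y) \<le> c w * norm y" using ec F(1) by blast
    also have "\<dots> \<le> C * norm y" using C w by (simp add: mult_right_mono)
    finally show ?thesis .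
  qed
  ultimately show thesis using that by blast
qed

text \<open>Perturbation of the zero operator.\<close>

lemma resolvent_outside_norm_ball:
  assumes T: "clinear T" "\<And>x. norm (T x) \<le> b * norm x" "0 \<le> b" and z: "cmod z > b"
  shows "z \<in> resolvent_set UNIV T" "norm (resolvent UNIV T z y) \<le> 1 / (cmod z - b) * norm y"
proof -
  let ?O = "\<lambda>x :: 'a. 0 :: 'a"
  have O: "linear_op UNIV ?O" by (simp add: linear_op_UNIV clinear_iff)
  have z0: "z \<noteq> 0" using z T(3) by auto
  have s: "\<exists>x\<in>UNIV. z *\<^sub>C x - ?O x = y" for y
    using z0 by (intro bexI[of _ "(1 / z) *\<^sub>C y"]) (simp_all add: scaleC_simps)
  have n: "norm x \<le> 1 / cmod z * norm (z *\<^sub>C x - ?O x)" if "x \<in> UNIV" for x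
    using z0 by (simp add: norm_scaleC)
  have "1 / cmod z / (1 - b * (1 / cmod z)) = 1 / (cmod z - b)"
    using z z0 T(3) by (simp add: field_simps)
  moreover have "b * (1 / cmod z) < 1" using z T(3) z0 by (simp add: field_simps)
  ultimately show "z \<in> resolvent_set UNIV T"
    "norm (resolvent UNIV T z y) \<le> 1 / (cmod z - b) * norm y"
    using resolvent_perturb[OF O resolvent_setI[OF O s n] _ T(1,2,3)] by auto
qed

lemma resolvent_bounded_on_closed:
  assumes T: "clinear T" "\<And>x. norm (T x) \<le> b * norm x" "0 \<le> b"
    and K: "closed K" "K \<subseteq> resolvent_set UNIV T"
  obtains c where "c > 0" "\<And>z y. z \<in> K \<Longrightarrow> norm (resolvent UNIV T z y) \<le> c * norm y"
proof -
  have "compact (K \<inter> cball 0 (b + 1))" using K(1) by (simp add: closed_Int_compact)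
  then obtain c where c: "c > 0"
    "\<And>z y. z \<in> K \<inter> cball 0 (b + 1) \<Longrightarrow> norm (resolvent UNIV T z y) \<le> c * norm y"
    using resolvent_bounded_on_compact[of UNIV T "K \<inter> cball 0 (b + 1)"] K(2) T(1)
    by (auto simp: linear_op_UNIV)
  have "norm (resolvent UNIV T z y) \<le> (c + 1) * norm y" if z: "z \<in> K" for z y
  proof (cases "cmod z \<le> b + 1")
    case True
    then have "norm (resolvent UNIV T z y) \<le> c * norm y" using z c by auto
    also have "\<dots> \<le> (c + 1) * norm y" by (simp add: mult_right_mono)
    finally show ?thesis .
  next
    case False
    then have "norm (resolvent UNIV T z y) \<le> 1 / (cmod z - b) * norm y"
      using resolvent_outside_norm_ball(2)[OF T] by simp
    also have "\<dots> \<le> (c + 1) * norm y"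
    proof (rule mult_right_mono)
      have "1 / (cmod z - b) \<le> 1" using False by simp
      then show "1 / (cmod z - b) \<le> c + 1" using c(1) by linarith
    qed simp
    finally show ?thesis .
  qed
  then show thesis using that[of "c + 1"] c(1) by auto
qed

lemma resolvent_commute:
  assumes T: "clinear T" and z: "z \<in> resolvent_set UNIV T"
  shows "resolvent UNIV T z (T x) = T (resolvent UNIV T z x)"
proof -
  have T': "linear_op UNIV T" using T by (simp add: linear_op_UNIV)
  have "z *\<^sub>C resolvent UNIV T z x - resolvent UNIV T z (T x) = resolvent UNIV T z (z *\<^sub>C x - T x)"
    using clinear_resolvent[OF T' z] by (simp add: clinear_diff clinear_scaleC)
  also have "\<dots> = z *\<^sub>C resolvent UNIV T z x - T (resolvent UNIV T z x)"
    using resolvent_left[OF T' z] resolvent_right[OF T' z] by simp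
  finally show ?thesis by simp
qed

section \<open>Integrals along rectifiable paths\<close>

text \<open>The path is replaced by the polygon through its values at the division points. The polygon is
  piecewise smooth and close to the path, so that it can take over in all contour integrals of
  holomorphic functions, and its contour integral differs from the Riemann-Stieltjes sum only by
  the oscillation of the integrand. Degenerate intervals of the division are discarded first, because
  the interpolation is defined by choosing an interval that contains the parameter.\<close>

lemma interpolating_polygon:
  fixes g :: "real \<Rightarrow> complex"
  assumes p: "p tagged_division_of {0..1}"
    and osc: "\<And>s K t. (s, K) \<in> p \<Longrightarrow> t \<in> K \<Longrightarrow> cmod (g t - g s) < e"
  shows "\<exists>h. valid_path h \<and> pathstart h = pathstart g \<and> pathfinish h = pathfinish g \<and>
    (\<forall>t\<in>{0..1}. cmod (h t - g t) < 2 * e) \<and>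
    (\<forall>f \<eta>. (\<forall>(s, K)\<in>p. \<forall>w\<in>ball (g s) e. cmod (f w - f (g s)) \<le> \<eta>) \<and>
      continuous_on (\<Union>s\<in>{0..1}. ball (g s) e) f \<longrightarrow>
      cmod ((\<Sum>(s, K)\<in>p. (g (Sup K) - g (Inf K)) * f (g s)) - contour_integral h f)
        \<le> (\<Sum>(s, K)\<in>p. cmod (g (Sup K) - g (Inf K)) * \<eta>))"
proof -
  define slope where "slope K = (g (Sup K) - g (Inf K)) / complex_of_real (Sup K - Inf K)" for K
  define lin where "lin K t = g (Inf K) + complex_of_real (t - Inf K) * slope K" for K t
  define d where "d = {K \<in> snd ` p. measure lborel K \<noteq> 0}"
  have pf: "finite p" and p01: "\<And>s K. (s, K) \<in> p \<Longrightarrow> s \<in> K \<and> K \<subseteq> {0..1}"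
    using p by auto
  have d: "d division_of {0..1}"
    using division_of_nontrivial[of "snd ` p" 0 "1::real"] division_of_tagged_division[OF p]
    by (simp add: d_def)
  have fd: "finite d" using d by auto
  have Kab: "\<exists>a b. a < b \<and> K = {a..b} \<and> Inf K = a \<and> Sup K = b" if Kd: "K \<in> d" for K
  proof -
    obtain a b where ab: "K = {a..b}"
      using division_ofD(4)[OF d Kd] by auto
    have "measure lborel K \<noteq> 0" using Kd by (simp add: d_def)
    then have "a < b" using ab by (simp split: if_splits)
    then show ?thesis using ab by (intro exI[of _ a] exI[of _ b]) simp
  qed
  have memK: "t \<in> K \<longleftrightarrow> Inf K \<le> t \<and> t \<le> Sup K" if "K \<in> d" for K t
    using Kab[OF that] by (metis atLeastAtMost_iff)
  have ends: "lin K (Inf K) = g (Inf K)" "lin K (Sup K) = g (Sup K)" if "K \<in> d" for K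
    using Kab[OF that] by (auto simp: lin_def slope_def)
  have lin_eq: "lin K t = lin K' t" if K: "K \<in> d" "K' \<in> d" "t \<in> K" "t \<in> K'" for K K' t
  proof (cases "K = K'")
    case False
    obtain a b where K1: "a < b" "K = {a..b}" "Inf K = a" "Sup K = b" using Kab[OF K(1)] by auto
    obtain a' b' where K2: "a' < b'" "K' = {a'..b'}" "Inf K' = a'" "Sup K' = b'"
      using Kab[OF K(2)] by auto
    have disj: "interior K \<inter> interior K' = {}"
      by (rule division_ofD(5)[OF d K(1,2) False])
    have "b \<le> a' \<or> b' \<le> a"
    proof (rule ccontr)
      define m where "m = (max a a' + min b b') / 2"
      assume "\<not> (b \<le> a' \<or> b' \<le> a)"
      then have "max a a' < min b b'" using K1(1) K2(1) by simp
      then have "a < m" "m < b" "a' < m" "m < b'" 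
        unfolding m_def by (simp_all add: max_def min_def split: if_splits)
      then have "m \<in> interior K \<inter> interior K'"
        unfolding K1(2) K2(2) interior_atLeastAtMost_real by simp
      then show False using disj by blast
    qed
    then have "(t = Sup K \<or> t = Inf K) \<and> (t = Sup K' \<or> t = Inf K')"
      using K(3,4) unfolding K1(3,4) K2(3,4) unfolding K1(2) K2(2) by auto
    then have "lin K t = g t" "lin K' t = g t"
      using ends[OF K(1)] ends[OF K(2)] by auto
    then show ?thesis by simp
  qed simp
  define h where "h t = lin (SOME K. K \<in> d \<and> t \<in> K) t" for t
  have h: "h t = lin K t" if "K \<in> d" "t \<in> K" for K t
  proof -
    have "(SOME K. K \<in> d \<and> t \<in> K) \<in> d \<and> t \<in> (SOME K. K \<in> d \<and> t \<in> K)"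
      by (rule someI[of "\<lambda>K. K \<in> d \<and> t \<in> K" K]) (use that in blast)
    then show ?thesis unfolding h_def using lin_eq that by blast
  qed
  have cover: "\<exists>K\<in>d. t \<in> K" if "t \<in> {0..1}" for t
    using division_ofD(6)[OF d] that by blast
  have lin_ball: "lin K t \<in> ball (g s) e" if K: "K \<in> d" "t \<in> K" "(s, K) \<in> p" for K t s
  proof -
    obtain a b where K1: "a < b" "K = {a..b}" "Inf K = a" "Sup K = b" using Kab[OF K(1)] by auto
    define u where "u = (t - a) / (b - a)"
    have u: "0 \<le> u" "u \<le> 1" using K(2) K1 by (auto simp: u_def)
    have "lin K t = g a + complex_of_real u * (g b - g a)"
      using K1 by (simp add: lin_def slope_def u_def)
    then have "lin K t = (1 - u) *\<^sub>R g a + u *\<^sub>R g b"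
      by (simp add: scaleR_conv_of_real algebra_simps)
    moreover have "g a \<in> ball (g s) e" "g b \<in> ball (g s) e"
      using osc[OF K(3)] K1 by (auto simp: dist_norm norm_minus_commute)
    ultimately show ?thesis
      using convexD_alt[OF convex_ball, of "g a" "g s" e "g b" u] u by simp
  qed
  have tag: "\<exists>s. (s, K) \<in> p" if "K \<in> d" for K using that by (auto simp: d_def)
  have near: "cmod (h t - g t) < 2 * e" if t01: "t \<in> {0..1}" for t
  proof -
    obtain K s where K: "K \<in> d" "t \<in> K" "(s, K) \<in> p" using cover[OF t01] tag by blast
    have "cmod (h t - g s) < e"
      using lin_ball[OF K] h[OF K(1,2)] by (simp add: dist_norm norm_minus_commute)
    moreover have "cmod (g t - g s) < e" using osc K by blast
    ultimately show ?thesis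
      using norm_triangle_ineq4[of "h t - g s" "g t - g s"] by simp
  qed
  have deriv: "(h has_vector_derivative slope K) (at t)" if Kt: "K \<in> d" "t \<in> {Inf K<..<Sup K}" for K t
  proof -
    obtain a b where K1: "a < b" "K = {a..b}" "Inf K = a" "Sup K = b" using Kab[OF Kt(1)] by auto
    have "(lin K has_vector_derivative slope K) (at t)"
      unfolding lin_def by (auto intro!: derivative_eq_intros simp: has_vector_derivative_def scaleR_conv_of_real)
    then show ?thesis
      by (rule has_vector_derivative_transform_within_open[where S = "{a<..<b}"])
        (use Kt K1 h[OF Kt(1)] in auto)
  qed
  have cont: "continuous_on {0..1} h"
  proof -
    have "continuous_on (\<Union>K\<in>d. K) h"
    proof (rule continuous_on_closed_Union[OF fd])
      fix K assume K: "K \<in> d"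
      show "closed K" using Kab[OF K] closed_atLeastAtMost by blast
      have "continuous_on K (lin K)" unfolding lin_def by (intro continuous_intros)
      then show "continuous_on K h" using h[OF K] by (simp cong: continuous_on_cong)
    qed
    then show ?thesis using division_ofD(6)[OF d] by simp
  qed
  define T where "T = Inf ` d \<union> Sup ` d"
  have off: "\<exists>K\<in>d. t \<in> {Inf K<..<Sup K}" if tT: "t \<in> {0..1} - T" for t
  proof -
    obtain K where K: "K \<in> d" "t \<in> K" using tT cover by blast
    moreover have "t \<noteq> Inf K" "t \<noteq> Sup K" using K tT by (auto simp: T_def)
    ultimately show ?thesis using memK[OF K(1), of t] by (intro bexI[of _ K]) simp_all
  qed
  have valid: "valid_path h"
    unfolding valid_path_def piecewise_C1_differentiable_on_def
  proof (intro conjI exI[of _ T])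
    show "finite T" using fd by (simp add: T_def)
    have "isCont (\<lambda>t. vector_derivative h (at t)) t" if tT: "t \<in> {0..1} - T" for t
    proof -
      obtain K where K: "K \<in> d" "t \<in> {Inf K<..<Sup K}" using off[OF tT] by blast
      have "\<forall>\<^sub>F u in nhds t. vector_derivative h (at u) = slope K"
        using eventually_nhds_in_open[OF open_greaterThanLessThan K(2)]
        by eventually_elim (use deriv[OF K(1)] in \<open>auto intro: vector_derivative_at\<close>)
      then show ?thesis using isCont_cong by fastforce
    qed
    then have "continuous_on ({0..1} - T) (\<lambda>t. vector_derivative h (at t))"
      by (simp add: continuous_at_imp_continuous_on)
    moreover have "h differentiable at t" if "t \<in> {0..1} - T" for t
      using off[OF that] deriv differentiableI_vector by blast
    ultimately show "h C1_differentiable_on {0..1} - T"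
      by (simp add: C1_differentiable_on_eq)
  qed (rule cont)
  have at_ends: "h t = g t" if t: "t \<in> {0, 1}" for t
  proof -
    obtain K where K: "K \<in> d" "t \<in> K" using cover[of t] t by auto
    then have "K \<subseteq> {0..1}" using division_ofD(2)[OF d] by blast
    moreover obtain a b where "a < b" "K = {a..b}" "Inf K = a" "Sup K = b"
      using Kab[OF K(1)] by blast
    ultimately have "t = Inf K \<or> t = Sup K" using K t by auto
    then show ?thesis using h[OF K] ends[OF K(1)] by metis
  qed
  have main: "cmod ((\<Sum>(s, K)\<in>p. (g (Sup K) - g (Inf K)) * f (g s)) - contour_integral h f)
        \<le> (\<Sum>(s, K)\<in>p. cmod (g (Sup K) - g (Inf K)) * \<eta>)"
    if \<eta>: "\<And>s K w. (s, K) \<in> p \<Longrightarrow> w \<in> ball (g s) e \<Longrightarrow> cmod (f w - f (g s)) \<le> \<eta>"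
      and f: "continuous_on (\<Union>s\<in>{0..1}. ball (g s) e) f" for f \<eta>
  proof -
    define i where "i K = integral K (\<lambda>t. f (h t) * vector_derivative h (at t))" for K
    have piece: "((\<lambda>t. f (h t) * vector_derivative h (at t)) has_integral i K) K \<and>
        cmod ((g (Sup K) - g (Inf K)) * f (g s) - i K) \<le> cmod (g (Sup K) - g (Inf K)) * \<eta>"
      if sK: "(s, K) \<in> p" for s K
    proof (cases "K \<in> d")
      case False
      obtain a b where "K = {a..b}" using p sK by (metis interval_cbox tagged_division_ofD(4))
      moreover have "measure lborel K = 0" using False sK by (force simp: d_def)
      moreover have "s \<in> K" using p01 sK by blast
      ultimately have "K = {a}" by (auto simp: content_real_eq_0)
      then show ?thesis by (auto simp: i_def intro: has_integral_refl)
    next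
      case True
      obtain a b where K1: "a < b" "K = {a..b}" "Inf K = a" "Sup K = b" using Kab[OF True] by auto
      have "continuous_on K (\<lambda>t. f (lin K t))"
      proof (rule continuous_on_compose2[OF f])
        show "continuous_on K (lin K)" unfolding lin_def by (intro continuous_intros)
        show "lin K ` K \<subseteq> (\<Union>s\<in>{0..1}. ball (g s) e)"
          using lin_ball[OF True _ sK] p01[OF sK] by blast
      qed
      then have "(\<lambda>t. f (lin K t) * slope K) integrable_on K"
        using K1 by (auto intro!: integrable_continuous_interval continuous_intros)
      then obtain j where j: "((\<lambda>t. f (lin K t) * slope K) has_integral j) K"
        by (auto simp: integrable_on_def)
      have hi: "((\<lambda>t. f (h t) * vector_derivative h (at t)) has_integral j) K"
      proof -
        have "f (h t) * vector_derivative h (at t) = f (lin K t) * slope K" if "t \<in> box a b" for t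
        proof -
          have "t \<in> {Inf K<..<Sup K}" "t \<in> K" using that K1 by (simp_all add: box_real(1))
          then show ?thesis using vector_derivative_at[OF deriv[OF True]] h[OF True] by simp
        qed
        then show ?thesis
          using has_integral_spike_interior[of "\<lambda>t. f (lin K t) * slope K" j a b] j K1 by simp
      qed
      then have ij: "i K = j" by (simp add: i_def integral_unique)
      have c: "((\<lambda>t. f (g s) * slope K) has_integral (g (Sup K) - g (Inf K)) * f (g s)) K"
      proof -
        have "((\<lambda>t. f (g s) * slope K) has_integral (b - a) *\<^sub>R (f (g s) * slope K)) {a..b}"
          using has_integral_const_real[of "f (g s) * slope K" a b] K1 by simp
        moreover have "(b - a) *\<^sub>R (f (g s) * slope K) = (g (Sup K) - g (Inf K)) * f (g s)"
          using K1 by (simp add: slope_def scaleR_conv_of_real)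
        ultimately show ?thesis using K1 by simp
      qed
      have "((\<lambda>t. f (g s) * slope K - f (lin K t) * slope K) has_integral
          (g (Sup K) - g (Inf K)) * f (g s) - j) {a..b}"
        using has_integral_diff[OF c j] K1 by simp
      moreover have "cmod (f (g s) * slope K - f (lin K t) * slope K) \<le> \<eta> * cmod (slope K)"
        if "t \<in> {a..b}" for t
        using \<eta>[OF sK lin_ball[OF True _ sK], of t] that K1
        by (simp add: left_diff_distrib[symmetric] norm_mult norm_minus_commute mult_right_mono)
      moreover have "0 \<le> \<eta>"
        by (rule order_trans[OF norm_ge_zero \<eta>[OF sK lin_ball[OF True _ sK], of a]])
          (use K1 in simp)
      ultimately have "cmod ((g (Sup K) - g (Inf K)) * f (g s) - j) \<le> \<eta> * cmod (slope K) * measure lborel {a..b}"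
        by (intro has_integral_bound_real) auto
      also have "\<dots> = cmod (g (Sup K) - g (Inf K)) * \<eta>"
        using K1 by (simp add: slope_def norm_divide flip: of_real_diff)
      finally show ?thesis using hi ij by simp
    qed
    have "(f has_contour_integral (\<Sum>(s, K)\<in>p. i K)) h"
      unfolding has_contour_integral
      using has_integral_combine_tagged_division[OF p] piece by blast
    then have "contour_integral h f = (\<Sum>(s, K)\<in>p. i K)" by (rule contour_integral_unique)
    then have "(\<Sum>(s, K)\<in>p. (g (Sup K) - g (Inf K)) * f (g s)) - contour_integral h f
        = (\<Sum>(s, K)\<in>p. (g (Sup K) - g (Inf K)) * f (g s) - i K)"
      by (simp add: case_prod_unfold sum_subtractf)
    also have "cmod \<dots> \<le> (\<Sum>(s, K)\<in>p. cmod (g (Sup K) - g (Inf K)) * \<eta>)"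
      by (rule sum_norm_le) (use piece in auto)
    finally show ?thesis .
  qed
  show ?thesis
  proof (intro exI[of _ h] conjI allI impI ballI)
    show "pathstart h = pathstart g" "pathfinish h = pathfinish g"
      using at_ends by (simp_all add: pathstart_def pathfinish_def)
    show "cmod (h t - g t) < 2 * e" if "t \<in> {0..1}" for t
      by (rule near[OF that])
    show "cmod ((\<Sum>(s, K)\<in>p. (g (Sup K) - g (Inf K)) * f (g s)) - contour_integral h f)
        \<le> (\<Sum>(s, K)\<in>p. cmod (g (Sup K) - g (Inf K)) * \<eta>)"
      if "(\<forall>(s, K)\<in>p. \<forall>w\<in>ball (g s) e. cmod (f w - f (g s)) \<le> \<eta>) \<and>
        continuous_on (\<Union>s\<in>{0..1}. ball (g s) e) f" for f \<eta>
      by (rule main) (use that in blast)+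
  qed (rule valid)
qed

definition riemann_sum :: "(real \<Rightarrow> complex) \<Rightarrow> (complex \<Rightarrow> 'a::chilbert_space) \<Rightarrow> (real \<times> real set) set \<Rightarrow> 'a"
  where "riemann_sum g F p = (\<Sum>(s, K)\<in>p. (g (Sup K) - g (Inf K)) *\<^sub>C F (g s))"

definition path_variation :: "(real \<Rightarrow> complex) \<Rightarrow> (real \<times> real set) set \<Rightarrow> real"
  where "path_variation g p = (\<Sum>(s, K)\<in>p. cmod (g (Sup K) - g (Inf K)))"

definition fine_division :: "real \<Rightarrow> (real \<times> real set) set \<Rightarrow> bool"
  where "fine_division d p \<longleftrightarrow> p tagged_division_of {0..1} \<and> (\<lambda>x. ball x d) fine p"

lemma has_path_integral_iff:
  "has_path_integral F i g \<longleftrightarrow>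
    (\<forall>e>0. \<exists>d>0. \<forall>p. fine_division d p \<longrightarrow>
      norm (riemann_sum g F p - i) < e)"
  by (simp add: has_path_integral_def riemann_sum_def fine_division_def)

lemma has_path_integralE:
  assumes "has_path_integral F i g" "e > 0"
  obtains d where "d > 0" "\<And>p. fine_division d p \<Longrightarrow> norm (riemann_sum g F p - i) < e"
  using assms unfolding has_path_integral_iff by blast

lemma path_variation_bounded:
  assumes "rectifiable_path g"
  obtains L where "L > 0" "\<And>p. p tagged_division_of {0..1} \<Longrightarrow> path_variation g p \<le> L"
proof -
  obtain L where L: "\<And>d. d division_of {0..1} \<Longrightarrow> (\<Sum>K\<in>d. cmod (g (Sup K) - g (Inf K))) \<le> L"
    using assms by (auto simp: rectifiable_path_def)
  have "path_variation g p \<le> \<bar>L\<bar> + 1" if p: "p tagged_division_of {0..1}" for p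
  proof -
    \<comment> \<open>the infimum and the supremum of the empty set are unspecified\<close>
    let ?v = "\<lambda>K. if K = {} then 0 else cmod (g (Sup K) - g (Inf K))"
    have "path_variation g p = (\<Sum>(s, K)\<in>p. ?v K)"
      unfolding path_variation_def
      by (rule sum.cong) (auto dest: tagged_division_ofD(2)[OF p])
    also have "\<dots> = (\<Sum>K\<in>snd ` p. ?v K)"
    proof (rule sum.over_tagged_division_lemma[OF p])
      fix u v :: real assume "box u v = {}"
      then have "\<not> u < v" by (simp add: box_real(1))
      then consider "u = v" | "v < u" by linarith
      then show "?v (cbox u v) = 0"
      proof cases
        case 1
        then have "cbox u v = {u}" by (simp only: box_real(2) atLeastAtMost_singleton)
        then show ?thesis by (simp only: cSup_singleton cInf_singleton diff_self norm_zero if_cancel)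
      next
        case 2
        then have "cbox u v = {}" by (simp only: box_real(2) atLeastatMost_empty)
        then show ?thesis by simp
      qed
    qed
    also have "\<dots> = (\<Sum>K\<in>snd ` p. cmod (g (Sup K) - g (Inf K)))"
      by (rule sum.cong) (auto dest: tagged_division_ofD(2)[OF p])
    finally have "path_variation g p = (\<Sum>K\<in>snd ` p. cmod (g (Sup K) - g (Inf K)))" .
    then show ?thesis using L[OF division_of_tagged_division[OF p]] by linarith
  qed
  then show thesis using that[of "\<bar>L\<bar> + 1"] by auto
qed

lemma fine_division_exists: "d > 0 \<Longrightarrow> \<exists>p. fine_division d p"
  using fine_division_exists_real[OF gauge_ball] unfolding fine_division_def by metis

lemma fine_division_mono:
  assumes "fine_division d p" "d \<le> d'"
  shows "fine_division d' p"
proof -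
  have "ball x d \<subseteq> ball x d'" for x :: real using assms(2) by (rule subset_ball)
  then show ?thesis using assms(1) unfolding fine_division_def fine_def by blast
qed

lemma riemann_sum_diff_le:
  fixes F1 F2 :: "complex \<Rightarrow> 'a::chilbert_space"
  assumes p: "p tagged_division_of {0..1}"
    and b: "\<And>s. s \<in> {0..1} \<Longrightarrow> norm (F1 (g s) - F2 (g s)) \<le> b"
  shows "norm (riemann_sum g F1 p - riemann_sum g F2 p) \<le> path_variation g p * b"
proof -
  have s: "s \<in> {0..1}" if "(s, K) \<in> p" for s K
    using tagged_division_ofD(2,3)[OF p that] by blast
  have "riemann_sum g F1 p - riemann_sum g F2 p
      = (\<Sum>(s, K)\<in>p. (g (Sup K) - g (Inf K)) *\<^sub>C (F1 (g s) - F2 (g s)))"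
    by (simp add: riemann_sum_def sum_subtractf case_prod_unfold
        complex_vector.scale_right_diff_distrib)
  also have "norm \<dots> \<le> (\<Sum>(s, K)\<in>p. cmod (g (Sup K) - g (Inf K)) * b)"
    by (rule sum_norm_le) (use b s in \<open>auto simp: norm_scaleC intro!: mult_left_mono\<close>)
  also have "\<dots> = path_variation g p * b"
    by (simp add: path_variation_def sum_distrib_right case_prod_unfold)
  finally show ?thesis .
qed

text \<open>Since only the values on the path enter, this bounds an integral by the length of the path,
  compares integrals of nearby integrands and gives uniqueness.\<close>

lemma has_path_integral_diff_le:
  fixes F1 F2 :: "complex \<Rightarrow> 'a::chilbert_space"
  assumes L: "\<And>p. p tagged_division_of {0..1} \<Longrightarrow> path_variation g p \<le> L"
    and F: "has_path_integral F1 i1 g" "has_path_integral F2 i2 g"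
    and b: "\<And>s. s \<in> {0..1} \<Longrightarrow> norm (F1 (g s) - F2 (g s)) \<le> b"
  shows "norm (i1 - i2) \<le> L * b"
proof (rule field_le_epsilon)
  fix e :: real assume "e > 0"
  then have e: "e / 2 > 0" by simp
  obtain d1 where d1: "d1 > 0" "\<And>p. fine_division d1 p \<Longrightarrow>
      norm (riemann_sum g F1 p - i1) < e / 2"
    using has_path_integralE[OF F(1) e] by blast
  obtain d2 where d2: "d2 > 0" "\<And>p. fine_division d2 p \<Longrightarrow>
      norm (riemann_sum g F2 p - i2) < e / 2"
    using has_path_integralE[OF F(2) e] by blast
  obtain p where p': "fine_division (min d1 d2) p"
    using fine_division_exists[of "min d1 d2"] d1(1) d2(1) by auto
  then have p: "p tagged_division_of {0..1}" by (simp add: fine_division_def)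
  have b0: "0 \<le> b" using b[of 0] norm_ge_zero order_trans by (metis atLeastAtMost_iff order_refl zero_le_one)
  have "norm (riemann_sum g F1 p - riemann_sum g F2 p) \<le> path_variation g p * b"
    by (rule riemann_sum_diff_le[OF p]) (rule b)
  then have "norm (riemann_sum g F1 p - riemann_sum g F2 p) \<le> L * b"
    using mult_right_mono[OF L[OF p] b0] by linarith
  moreover have "norm (riemann_sum g F1 p - i1) < e / 2" "norm (riemann_sum g F2 p - i2) < e / 2"
    by (rule d1(2)[OF fine_division_mono[OF p']], simp)
      (rule d2(2)[OF fine_division_mono[OF p']], simp)
  moreover have "i1 - i2 = (riemann_sum g F1 p - riemann_sum g F2 p)
      - (riemann_sum g F1 p - i1) + (riemann_sum g F2 p - i2)" by simp
  ultimately show "norm (i1 - i2) \<le> L * b + e"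
    by (smt (verit) norm_triangle_ineq norm_triangle_ineq4 field_sum_of_halves)
qed

lemma has_path_integral_unique:
  assumes g: "rectifiable_path g" and i: "has_path_integral F i g" "has_path_integral F j g"
  shows "i = j"
proof -
  obtain L where L: "\<And>p. p tagged_division_of {0..1} \<Longrightarrow> path_variation g p \<le> L"
    using path_variation_bounded[OF g] by blast
  have "norm (i - j) \<le> L * 0"
  proof (rule has_path_integral_diff_le[OF L i])
    show "norm (F (g s) - F (g s)) \<le> 0" for s by simp
  qed
  then show ?thesis by simp
qed

lemma path_integral_eq:
  "rectifiable_path g \<Longrightarrow> has_path_integral F i g \<Longrightarrow> path_integral g F = i"
  unfolding path_integral_def using has_path_integral_unique by blast

lemma has_path_integral_linear:
  fixes T :: "'a::chilbert_space \<Rightarrow> 'b::chilbert_space"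
  assumes T: "clinear T" "\<And>x. norm (T x) \<le> b * norm x" and F: "has_path_integral F i g"
  shows "has_path_integral (\<lambda>z. T (F z)) (T i) g"
  unfolding has_path_integral_iff
proof (intro allI impI)
  fix e :: real assume "e > 0"
  then have e: "e / (\<bar>b\<bar> + 1) > 0" by simp
  obtain d where d: "d > 0" "\<And>p. fine_division d p \<Longrightarrow>
      norm (riemann_sum g F p - i) < e / (\<bar>b\<bar> + 1)"
    using has_path_integralE[OF F e] by blast
  have "norm (riemann_sum g (\<lambda>z. T (F z)) p - T i) < e"
    if p: "fine_division d p" for p
  proof -
    have "riemann_sum g (\<lambda>z. T (F z)) p - T i = T (riemann_sum g F p - i)"
      by (simp add: riemann_sum_def clinear_sum[OF T(1)] clinear_diff[OF T(1)]
          clinear_scaleC[OF T(1)] case_prod_unfold)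
    then have "norm (riemann_sum g (\<lambda>z. T (F z)) p - T i) \<le> b * norm (riemann_sum g F p - i)"
      using T(2) by simp
    also have "\<dots> \<le> (\<bar>b\<bar> + 1) * norm (riemann_sum g F p - i)"
      by (intro mult_right_mono) auto
    also have "\<dots> < (\<bar>b\<bar> + 1) * (e / (\<bar>b\<bar> + 1))"
      using d(2)[OF p] by (intro mult_strict_left_mono) auto
    finally show ?thesis by simp
  qed
  then show "\<exists>d>0. \<forall>p. fine_division d p \<longrightarrow>
      norm (riemann_sum g (\<lambda>z. T (F z)) p - T i) < e"
    using d(1) by blast
qed

text \<open>The link to the scalar theory: one piecewise smooth path \<open>\<gamma>\<close> represents the path \<open>g\<close> in all
  weakly holomorphic integrals on \<open>U\<close>. A Riemann-Stieltjes sum tested with \<open>y\<close> is close to the contour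
  integral along a polygon, hence along \<open>\<gamma>\<close>, with an error of at most a small multiple of the norm of \<open>y\<close>.
  As the error is uniform in \<open>y\<close>, the sums themselves are Cauchy, and the vector integral exists.\<close>

lemma rectifiable_path_contour:
  assumes U: "open U" and g: "rectifiable_path g" "path_image g \<subseteq> U"
  obtains \<gamma> where "valid_path \<gamma>" "pathstart \<gamma> = pathstart g" "pathfinish \<gamma> = pathfinish g"
    "path_image \<gamma> \<subseteq> U" "\<And>z. z \<notin> U \<Longrightarrow> winding_number \<gamma> z = winding_number g z"
    "\<And>F :: complex \<Rightarrow> 'a::chilbert_space. continuous_on U F \<Longrightarrow>
      (\<And>y. (\<lambda>z. cinner (F z) y) holomorphic_on U) \<Longrightarrow>
      has_path_integral F (path_integral g F) g \<and>
      (\<forall>y. cinner (path_integral g F) y = contour_integral \<gamma> (\<lambda>z. cinner (F z) y))"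
proof -
  have pg: "path g" using g(1) by (simp add: rectifiable_path_def)
  obtain r where r: "r > 0" and near: "\<And>h k. valid_path h \<Longrightarrow> valid_path k \<Longrightarrow>
      (\<And>t. t \<in> {0..1} \<Longrightarrow> cmod (h t - g t) < r) \<Longrightarrow> (\<And>t. t \<in> {0..1} \<Longrightarrow> cmod (k t - g t) < r) \<Longrightarrow>
      pathstart k = pathstart h \<Longrightarrow> pathfinish k = pathfinish h \<Longrightarrow>
      path_image h \<subseteq> U \<and> (\<forall>f. f holomorphic_on U \<longrightarrow> contour_integral k f = contour_integral h f)"
    using contour_integral_nearby_ends[OF U pg g(2)] by metis
  obtain \<gamma> where \<gamma>: "valid_path \<gamma>" "pathstart \<gamma> = pathstart g" "pathfinish \<gamma> = pathfinish g"
    "\<And>t. t \<in> {0..1} \<Longrightarrow> cmod (\<gamma> t - g t) < r"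
    using path_approx_polynomial_function[OF pg r] valid_path_polynomial_function by metis
  have \<gamma>U: "path_image \<gamma> \<subseteq> U" using near[OF \<gamma>(1,1,4,4)] by blast
  have close: "contour_integral k f = contour_integral \<gamma> f"
    if "valid_path k" "pathstart k = pathstart g" "pathfinish k = pathfinish g"
      "\<And>t. t \<in> {0..1} \<Longrightarrow> cmod (k t - g t) < r" "f holomorphic_on U" for k f
    using near[OF \<gamma>(1) that(1) \<gamma>(4) that(4)] that \<gamma>(2,3) by auto
  have winding: "winding_number \<gamma> z = winding_number g z" if z: "z \<notin> U" for z
  proof -
    have "z \<notin> path_image g" using z g(2) by blast
    then obtain k where k: "winding_number_prop g z r k (winding_number g z)"
      using winding_number[OF pg _ r] by blast
    have hol: "(\<lambda>w. 1 / (w - z)) holomorphic_on U"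
      using z by (intro holomorphic_intros) auto
    have "contour_integral \<gamma> (\<lambda>w. 1 / (w - z)) = contour_integral k (\<lambda>w. 1 / (w - z))"
      by (rule close[symmetric])
        (use k hol in \<open>auto simp: winding_number_prop_def norm_minus_commute\<close>)
    moreover have "contour_integral k (\<lambda>w. 1 / (w - z)) = 2 * pi * \<i> * winding_number g z"
      using k by (simp add: winding_number_prop_def)
    moreover have "z \<notin> path_image \<gamma>" using z \<gamma>U by blast
    ultimately show ?thesis by (simp add: winding_number_valid_path[OF \<gamma>(1)])
  qed
  have main: "has_path_integral F (path_integral g F) g \<and>
      (\<forall>y. cinner (path_integral g F) y = contour_integral \<gamma> (\<lambda>z. cinner (F z) y))"
    if F: "continuous_on U F" "\<And>y. (\<lambda>z. cinner (F z) y) holomorphic_on U"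
    for F :: "complex \<Rightarrow> 'a"
  proof -
    obtain L where L: "L > 0" "\<And>p. p tagged_division_of {0..1} \<Longrightarrow> path_variation g p \<le> L"
      using path_variation_bounded[OF g(1)] by blast
    obtain \<rho> where \<rho>: "\<rho> > 0" "(\<Union>x\<in>path_image g. cball x \<rho>) \<subseteq> U"
      using compact_subset_open_imp_cball_epsilon_subset[OF compact_path_image[OF pg] U g(2)]
      by blast
    \<comment> \<open>a compact neighbourhood of the path, on which \<open>F\<close> is uniformly continuous\<close>
    define C where "C = (\<Union>x\<in>path_image g. cball x \<rho>)"
    have "compact C" unfolding C_def by (rule compact_minkowski_sum_cball[OF compact_path_image[OF pg]])
    moreover have "continuous_on C F" using F(1) \<rho>(2) continuous_on_subset C_def by blast
    ultimately have unifF: "uniformly_continuous_on C F" by (simp add: compact_uniformly_continuous)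
    have unifg: "uniformly_continuous_on {0..1} g"
      using pg by (simp add: path_def compact_uniformly_continuous)
    have approx: "\<exists>d>0. \<forall>p. fine_division d p \<longrightarrow>
        (\<forall>y. cmod (cinner (riemann_sum g F p) y - contour_integral \<gamma> (\<lambda>z. cinner (F z) y))
          \<le> L * \<eta> * norm y)" if \<eta>: "\<eta> > 0" for \<eta>
    proof -
      obtain e0 where e0: "e0 > 0"
        "\<And>w w'. w \<in> C \<Longrightarrow> w' \<in> C \<Longrightarrow> dist w' w < e0 \<Longrightarrow> dist (F w') (F w) < \<eta>"
        using unifF \<eta> unfolding uniformly_continuous_on_def by metis
      define e where "e = min e0 (min \<rho> (r / 2))"
      have e: "e > 0" "e \<le> e0" "e \<le> \<rho>" "2 * e \<le> r" using e0(1) \<rho>(1) r by (auto simp: e_def)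
      obtain d where d: "d > 0"
        "\<And>s t. s \<in> {0..1} \<Longrightarrow> t \<in> {0..1} \<Longrightarrow> dist t s < d \<Longrightarrow> dist (g t) (g s) < e"
        using unifg e(1) unfolding uniformly_continuous_on_def by metis
      have "cmod (cinner (riemann_sum g F p) y - contour_integral \<gamma> (\<lambda>z. cinner (F z) y))
          \<le> L * \<eta> * norm y"
        if fp: "fine_division d p" for p y
      proof -
        have p: "p tagged_division_of {0..1}" "(\<lambda>x. ball x d) fine p"
          using fp by (simp_all add: fine_division_def)
        have sK: "s \<in> K" "K \<subseteq> {0..1}" "K \<subseteq> ball s d" "s \<in> {0..1}" if "(s, K) \<in> p" for s K
          using tagged_division_ofD(2,3)[OF p(1) that] p(2) that by (auto simp: fine_def)
        have osc: "cmod (g t - g s) < e" if "(s, K) \<in> p" "t \<in> K" for s K t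
        proof -
          have "t \<in> {0..1}" "t \<in> ball s d" using sK(2,3)[OF that(1)] that(2) by blast+
          then show ?thesis
            using d(2)[of s t] sK(4)[OF that(1)] by (simp add: dist_norm abs_minus_commute)
        qed
        let ?f = "\<lambda>z. cinner (F z) y"
        obtain h where h: "valid_path h" "pathstart h = pathstart g" "pathfinish h = pathfinish g"
          "\<forall>t\<in>{0..1}. cmod (h t - g t) < 2 * e"
          "\<forall>f \<eta>. (\<forall>(s, K)\<in>p. \<forall>w\<in>ball (g s) e. cmod (f w - f (g s)) \<le> \<eta>) \<and>
            continuous_on (\<Union>s\<in>{0..1}. ball (g s) e) f \<longrightarrow>
            cmod ((\<Sum>(s, K)\<in>p. (g (Sup K) - g (Inf K)) * f (g s)) - contour_integral h f)
              \<le> (\<Sum>(s, K)\<in>p. cmod (g (Sup K) - g (Inf K)) * \<eta>)"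
          using interpolating_polygon[OF p(1), of g e] osc by blast
        have sub: "(\<Union>s\<in>{0..1}. ball (g s) e) \<subseteq> C"
          using e(3) by (force simp: C_def path_image_def)
        have small: "cmod (?f w - ?f (g s)) \<le> \<eta> * norm y"
          if "(s, K) \<in> p" "w \<in> ball (g s) e" for s K w
        proof -
          have s01: "s \<in> {0..1}" by (rule sK(4)[OF that(1)])
          have "g s \<in> ball (g s) e" using e(1) by simp
          then have "g s \<in> C" "w \<in> C" using sub s01 that(2) by blast+
          then have "norm (F w - F (g s)) \<le> \<eta>"
            using e0(2)[of "g s" w] that(2) e(2) by (simp add: dist_norm norm_minus_commute)
          then have "cmod (cinner (F w - F (g s)) y) \<le> \<eta> * norm y"
            by (rule order_trans[OF norm_cinner_le mult_right_mono[OF _ norm_ge_zero]])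
          then show ?thesis by (simp add: cinner_diff_left)
        qed
        have "(\<Union>s\<in>{0..1}. ball (g s) e) \<subseteq> U"
          by (rule order_trans[OF sub]) (unfold C_def, rule \<rho>(2))
        then have "continuous_on (\<Union>s\<in>{0..1}. ball (g s) e) ?f"
          by (rule continuous_on_subset[OF holomorphic_on_imp_continuous_on[OF F(2)]])
        then have "cmod ((\<Sum>(s, K)\<in>p. (g (Sup K) - g (Inf K)) * ?f (g s)) - contour_integral h ?f)
            \<le> (\<Sum>(s, K)\<in>p. cmod (g (Sup K) - g (Inf K)) * (\<eta> * norm y))"
          by (rule h(5)[rule_format, OF conjI, rotated]) (use small in blast)
        also have "\<dots> = path_variation g p * (\<eta> * norm y)"
          by (simp add: path_variation_def sum_distrib_right case_prod_unfold)
        also have "\<dots> \<le> L * (\<eta> * norm y)"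
          using L(2)[OF p(1)] \<eta> by (intro mult_right_mono) auto
        also have "(\<Sum>(s, K)\<in>p. (g (Sup K) - g (Inf K)) * ?f (g s)) = cinner (riemann_sum g F p) y"
          by (simp add: riemann_sum_def cinner_sum_left cinner_scaleC_left case_prod_unfold)
        also have "contour_integral h ?f = contour_integral \<gamma> ?f"
          by (rule close[OF h(1-3) _ F(2)]) (use h(4) e(4) in force)
        finally show ?thesis by (simp add: mult.assoc)
      qed
      then show ?thesis using d(1) by blast
    qed
    have ex: "\<exists>p. p tagged_division_of {0..1} \<and>
        (\<forall>y. cmod (cinner (riemann_sum g F p) y - contour_integral \<gamma> (\<lambda>z. cinner (F z) y))
          \<le> L * inverse (real (Suc n)) * norm y)" for n
    proof -
      have "inverse (real (Suc n)) > 0" by simp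
      then obtain d where d: "d > 0" "\<forall>p. fine_division d p \<longrightarrow>
        (\<forall>y. cmod (cinner (riemann_sum g F p) y - contour_integral \<gamma> (\<lambda>z. cinner (F z) y))
          \<le> L * inverse (real (Suc n)) * norm y)"
        using approx by blast
      obtain p where "fine_division d p"
        using fine_division_exists[OF d(1)] by blast
      then show ?thesis using d(2) unfolding fine_division_def by blast
    qed
    then obtain p where p: "\<And>n. p n tagged_division_of {0..1}"
      "\<And>n y. cmod (cinner (riemann_sum g F (p n)) y - contour_integral \<gamma> (\<lambda>z. cinner (F z) y))
          \<le> L * inverse (real (Suc n)) * norm y"
      by metis
    define X where "X n = riemann_sum g F (p n)" for n
    have lim0: "(\<lambda>n. L * inverse (real (Suc n))) \<longlonglongrightarrow> 0"
      using tendsto_mult_right_zero[OF LIMSEQ_inverse_real_of_nat] .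
    have XX: "norm (X m - X n) \<le> L * inverse (real (Suc m)) + L * inverse (real (Suc n))" for m n
    proof (rule norm_le_by_test)
      fix y
      let ?I = "contour_integral \<gamma> (\<lambda>z. cinner (F z) y)"
      have "cinner (X m - X n) y = (cinner (X m) y - ?I) - (cinner (X n) y - ?I)"
        by (simp add: cinner_diff_left)
      then have "cmod (cinner (X m - X n) y) \<le> cmod (cinner (X m) y - ?I) + cmod (cinner (X n) y - ?I)"
        by (simp only: norm_triangle_ineq4)
      then show "cmod (cinner (X m - X n) y)
          \<le> (L * inverse (real (Suc m)) + L * inverse (real (Suc n))) * norm y"
        using p(2)[of m y] p(2)[of n y] unfolding X_def distrib_right by linarith
    qed (use L(1) in simp)
    have "Cauchy X"
    proof (rule metric_CauchyI)
      fix e :: real assume "e > 0"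
      then have "\<forall>\<^sub>F n in sequentially. L * inverse (real (Suc n)) < e / 2"
        using lim0 by (intro order_tendstoD) auto
      then obtain M where M: "\<And>n. n \<ge> M \<Longrightarrow> L * inverse (real (Suc n)) < e / 2"
        unfolding eventually_sequentially by blast
      have "dist (X m) (X n) < e" if "m \<ge> M" "n \<ge> M" for m n
        unfolding dist_norm using XX[of m n] M[OF that(1)] M[OF that(2)] by linarith
      then show "\<exists>M. \<forall>m\<ge>M. \<forall>n\<ge>M. dist (X m) (X n) < e" by blast
    qed
    then obtain i where i: "X \<longlonglongrightarrow> i" using Cauchy_convergent convergent_def by blast
    have ci: "cinner i y = contour_integral \<gamma> (\<lambda>z. cinner (F z) y)" for y
    proof (rule LIMSEQ_unique)
      show "(\<lambda>n. cinner (X n) y) \<longlonglongrightarrow> cinner i y" by (rule tendsto_cinner_left[OF i])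
      have "(\<lambda>n. L * inverse (real (Suc n)) * norm y) \<longlonglongrightarrow> 0"
        by (rule tendsto_mult_left_zero[OF lim0])
      then have "(\<lambda>n. cinner (X n) y - contour_integral \<gamma> (\<lambda>z. cinner (F z) y)) \<longlonglongrightarrow> 0"
        by (rule Lim_null_comparison[rotated]) (use p(2) in \<open>simp add: X_def\<close>)
      then show "(\<lambda>n. cinner (X n) y) \<longlonglongrightarrow> contour_integral \<gamma> (\<lambda>z. cinner (F z) y)"
        by (simp add: LIM_zero_iff)
    qed
    have "has_path_integral F i g"
      unfolding has_path_integral_iff
    proof (intro allI impI)
      fix e :: real assume e: "e > 0"
      then have "e / (2 * L) > 0" using L(1) by simp
      then obtain d where d: "d > 0" "\<And>p. fine_division d p \<Longrightarrow>
        (\<forall>y. cmod (cinner (riemann_sum g F p) y - contour_integral \<gamma> (\<lambda>z. cinner (F z) y))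
          \<le> L * (e / (2 * L)) * norm y)"
        using approx by blast
      have "norm (riemann_sum g F p - i) < e"
        if "fine_division d p" for p
      proof -
        have "norm (riemann_sum g F p - i) \<le> L * (e / (2 * L))"
        proof (rule norm_le_by_test)
          show "cmod (cinner (riemann_sum g F p - i) y) \<le> L * (e / (2 * L)) * norm y" for y
            unfolding cinner_diff_left ci using d(2)[OF that] by blast
          show "0 \<le> L * (e / (2 * L))" using e L(1) by simp
        qed
        also have "L * (e / (2 * L)) < e" using e L(1) by simp
        finally show ?thesis .
      qed
      then show "\<exists>d>0. \<forall>p. fine_division d p \<longrightarrow>
          norm (riemann_sum g F p - i) < e"
        using d(1) by blast
    qed
    then show ?thesis using ci path_integral_eq[OF g(1)] by metis
  qed
  show thesis by (rule that[OF \<gamma>(1-3) \<gamma>U winding main])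
qed

section \<open>Isolated eigenvalues of selfadjoint operators\<close>

text \<open>On the circle of radius \<open>s\<close>, the factor \<open>w\<^sup>2 - s\<^sup>2\<close> compensates a singularity of the size of
  \<open>1 / Im w\<close>.\<close>

lemma square_minus_radius_square:
  assumes "cmod w = s"
  shows "cmod (w\<^sup>2 - (complex_of_real s)\<^sup>2) = 2 * s * \<bar>Im w\<bar>"
proof -
  have "(complex_of_real s)\<^sup>2 = w * cnj w"
    using assms complex_norm_square[of w] by simp
  then have "w\<^sup>2 - (complex_of_real s)\<^sup>2 = w * (w - cnj w)"
    by (simp add: power2_eq_square right_diff_distrib)
  also have "w - cnj w = complex_of_real (2 * Im w) * \<i>"
    by (simp add: complex_eq_iff)
  finally show ?thesis using assms by (simp add: norm_mult abs_mult)
qed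

text \<open>A singularity on the real axis that is bounded by \<open>C / \<bar>Im z\<bar>\<close> has at most a simple pole. The
  maximum principle is applied to \<open>(w\<^sup>2 - s\<^sup>2) (w\<^sup>2 - S\<^sup>2) f / w\<close> with \<open>w = z - a\<close> on the annulus
  \<open>s < \<bar>w\<bar> < S\<close>: the two quadratic factors tame \<open>f\<close> on the two boundary circles. Then \<open>s\<close> tends to \<open>0\<close>.\<close>

lemma singularity_bounded_by_imaginary_part:
  fixes f :: "complex \<Rightarrow> complex"
  assumes f: "f holomorphic_on ball a r - {a}" and a: "Im a = 0"
    and C: "\<And>z. z \<in> ball a r - {a} \<Longrightarrow> \<bar>Im z\<bar> * cmod (f z) \<le> C"
    and S: "0 < S" "S < r" and z: "z \<noteq> a" "cmod (z - a) \<le> S / 2"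
  shows "cmod (z - a) * cmod (f z) \<le> 6 * C"
proof -
  let ?w = "cmod (z - a)"
  define F where "F s x = ((x - a)\<^sup>2 - (complex_of_real s)\<^sup>2) * ((x - a)\<^sup>2 - (complex_of_real S)\<^sup>2)
      * f x / (x - a)" for s x
  have w: "0 < ?w" "?w < S" using z S by auto
  have zin: "z \<in> ball a r - {a}" using z S w by (simp add: dist_norm norm_minus_commute)
  have C0: "0 \<le> C" using C[OF zin] by (meson abs_ge_zero mult_nonneg_nonneg norm_ge_zero order_trans)
  have le: "cmod (F s z) \<le> 4 * C * S\<^sup>2" if s: "0 < s" "s < ?w" for s
  proof -
    define R where "R = ball a S - cball a s"
    have Rsub: "x \<in> ball a r - {a}" if "s \<le> dist a x" "dist a x \<le> S" for x
      using that s S by auto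
    have clR: "closure R \<subseteq> {x. s \<le> dist a x \<and> dist a x \<le> S}"
    proof (rule closure_minimal)
      show "R \<subseteq> {x. s \<le> dist a x \<and> dist a x \<le> S}" by (auto simp: R_def)
      show "closed {x. s \<le> dist a x \<and> dist a x \<le> S}"
        by (intro closed_Collect_conj closed_Collect_le continuous_intros)
    qed
    have openR: "open R" by (simp add: R_def open_Diff)
    have hol: "F s holomorphic_on {x. s \<le> dist a x \<and> dist a x \<le> S}"
    proof -
      have sub: "{x. s \<le> dist a x \<and> dist a x \<le> S} \<subseteq> ball a r - {a}"
        by (rule subsetI, rule Rsub) simp_all
      have ne: "x - a \<noteq> 0" if "x \<in> {x. s \<le> dist a x \<and> dist a x \<le> S}" for x
        using subsetD[OF sub that] by simp
      show ?thesis
        unfolding F_def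
        by (intro holomorphic_on_divide holomorphic_on_mult holomorphic_on_diff holomorphic_on_power
            holomorphic_on_ident holomorphic_on_const holomorphic_on_subset[OF f sub] ne)
    qed
    have "cmod (F s z) \<le> 4 * C * S\<^sup>2"
    proof (rule maximum_modulus_frontier[of "F s" R])
      show "F s holomorphic_on interior R"
        using hol holomorphic_on_subset clR closure_subset interior_subset by blast
      show "continuous_on (closure R) (F s)"
        using holomorphic_on_imp_continuous_on[OF hol] clR continuous_on_subset by blast
      show "bounded R" by (simp add: R_def bounded_diff)
      show "z \<in> R" using s w by (simp add: R_def dist_norm norm_minus_commute)
      fix x assume "x \<in> frontier R"
      then have x: "s \<le> dist a x" "dist a x \<le> S" "x \<notin> R"
        using clR openR by (auto simp: frontier_def interior_open)
      then have xin: "x \<in> ball a r - {a}" using Rsub by blast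
      define u where "u = x - a"
      have u: "cmod u = dist a x" by (simp add: u_def dist_norm norm_minus_commute)
      have Im: "\<bar>Im u\<bar> * cmod (f x) \<le> C" using C[OF xin] a by (simp add: u_def)
      have tri: "cmod (u\<^sup>2 - (complex_of_real t)\<^sup>2) \<le> 2 * S\<^sup>2" if "\<bar>t\<bar> \<le> S" for t
      proof -
        have "cmod (u\<^sup>2 - (complex_of_real t)\<^sup>2) \<le> (cmod u)\<^sup>2 + t\<^sup>2"
          using norm_triangle_ineq4[of "u\<^sup>2" "(complex_of_real t)\<^sup>2"] by (simp add: norm_power)
        also have "\<dots> \<le> S\<^sup>2 + S\<^sup>2"
          using that x(2) u by (intro add_mono) (simp_all add: abs_le_square_iff[symmetric] power_mono)
        finally show ?thesis by simp
      qed
      have Fx: "cmod (F s x) = cmod (u\<^sup>2 - (complex_of_real s)\<^sup>2) * cmod (u\<^sup>2 - (complex_of_real S)\<^sup>2)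
          * cmod (f x) / cmod u"
        by (simp add: F_def u_def norm_mult norm_divide)
      have "dist a x = s \<or> dist a x = S" using x by (auto simp: R_def)
      then show "cmod (F s x) \<le> 4 * C * S\<^sup>2"
      proof
        assume d: "dist a x = s"
        have "cmod (F s x) = 2 * (\<bar>Im u\<bar> * cmod (f x)) * cmod (u\<^sup>2 - (complex_of_real S)\<^sup>2)"
          using s(1) d u by (simp add: Fx square_minus_radius_square)
        also have "\<dots> \<le> 2 * C * (2 * S\<^sup>2)"
          using Im C0 S(1) by (intro mult_mono tri) auto
        finally show ?thesis by simp
      next
        assume d: "dist a x = S"
        have "cmod (F s x) = 2 * (\<bar>Im u\<bar> * cmod (f x)) * cmod (u\<^sup>2 - (complex_of_real s)\<^sup>2)"
          using S(1) d u by (simp add: Fx square_minus_radius_square)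
        also have "\<dots> \<le> 2 * C * (2 * S\<^sup>2)"
          using Im C0 s w by (intro mult_mono tri) auto
        finally show ?thesis by simp
      qed
    qed
    then show ?thesis .
  qed
  have "((\<lambda>s. cmod (F s z)) \<longlongrightarrow> cmod (F 0 z)) (at_right 0)"
    unfolding F_def using z(1) by (intro tendsto_intros) auto
  moreover have "\<forall>\<^sub>F s in at_right 0. cmod (F s z) \<le> 4 * C * S\<^sup>2"
    using eventually_at_right_less[of 0] eventually_at_right_real[OF w(1)]
    by eventually_elim (use le in auto)
  ultimately have "cmod (F 0 z) \<le> 4 * C * S\<^sup>2"
    by (rule tendsto_upperbound) simp
  moreover have "cmod (F 0 z) = ?w * cmod (f z) * cmod ((z - a)\<^sup>2 - (complex_of_real S)\<^sup>2)"
    using z(1) by (simp add: F_def norm_mult norm_divide power2_eq_square)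
  moreover have "3 / 4 * S\<^sup>2 \<le> cmod ((z - a)\<^sup>2 - (complex_of_real S)\<^sup>2)"
  proof -
    have "?w\<^sup>2 \<le> (S / 2)\<^sup>2" using z(2) by (intro power_mono) auto
    moreover have "S\<^sup>2 - ?w\<^sup>2 \<le> cmod ((z - a)\<^sup>2 - (complex_of_real S)\<^sup>2)"
      using norm_triangle_ineq2[of "(complex_of_real S)\<^sup>2" "(z - a)\<^sup>2"]
      by (simp add: norm_power norm_minus_commute)
    ultimately show ?thesis by (simp add: power_divide)
  qed
  ultimately have "?w * cmod (f z) * (3 / 4 * S\<^sup>2) \<le> 4 * C * S\<^sup>2"
    using mult_left_mono[of "3 / 4 * S\<^sup>2" "cmod ((z - a)\<^sup>2 - (complex_of_real S)\<^sup>2)" "?w * cmod (f z)"]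
    by simp
  then have "?w * cmod (f z) * (3 / 4) * S\<^sup>2 \<le> 4 * C * S\<^sup>2" by (simp add: mult.assoc)
  then have "?w * cmod (f z) * (3 / 4) \<le> 4 * C" using S(1) by (simp add: mult_le_cancel_right)
  then show ?thesis using C0 by linarith
qed

text \<open>The singularity is removable, and Cauchy's inequality bounds the derivative of the extension.\<close>

lemma bounded_on_punctured_disc_Lipschitz:
  fixes f :: "complex \<Rightarrow> complex"
  assumes f: "f holomorphic_on ball a r - {a}" and r: "0 < r"
    and B: "\<And>z. z \<in> ball a r - {a} \<Longrightarrow> cmod (f z) \<le> B"
    and zw: "z \<in> ball a (r / 2) - {a}" "w \<in> ball a (r / 2) - {a}"
  shows "cmod (f z - f w) \<le> 4 * B / r * cmod (z - w)"
proof -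
  have ev: "\<forall>\<^sub>F z in at a. z \<in> ball a r - {a}"
    using r by (auto simp: eventually_at dist_commute intro!: exI[of _ r])
  then have "\<exists>B. \<forall>\<^sub>F z in at a. cmod (f z) \<le> B"
    by (intro exI[of _ B]) (auto elim!: eventually_mono intro: B)
  then obtain g where g: "g holomorphic_on ball a r" "\<And>z. z \<in> ball a r - {a} \<Longrightarrow> g z = f z"
    using holomorphic_on_extend_bounded[of f "ball a r" a] f r by auto
  have "(g \<longlongrightarrow> g a) (at a)"
    using holomorphic_on_imp_continuous_on[OF g(1)] r
    by (simp add: continuous_on_eq_continuous_at isCont_def)
  then have "((\<lambda>z. cmod (g z)) \<longlongrightarrow> cmod (g a)) (at a)" by (rule tendsto_norm)
  moreover have "\<forall>\<^sub>F z in at a. cmod (g z) \<le> B"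
    using ev by eventually_elim (use B g(2) in metis)
  ultimately have "cmod (g a) \<le> B" by (rule tendsto_upperbound) simp
  then have gB: "cmod (g z) \<le> B" if "z \<in> ball a r" for z
    using B[of z] g(2)[of z] that by (cases "z = a") auto
  have "cmod (g z - g w) \<le> 4 * B / r * cmod (z - w)"
  proof (rule field_differentiable_bound[of "ball a (r / 2)"])
    fix x assume x: "x \<in> ball a (r / 2)"
    have sub: "cball x (r / 4) \<subseteq> ball a r"
    proof
      fix y assume "y \<in> cball x (r / 4)"
      then show "y \<in> ball a r" using x dist_triangle[of a y x] r by (simp add: dist_commute)
    qed
    have "g field_differentiable at x"
      using g(1) x r sub by (meson centre_in_cball holomorphic_on_imp_differentiable_at open_ball
          less_imp_le divide_pos_pos subsetD zero_less_numeral)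
    then show "(g has_field_derivative deriv g x) (at x within ball a (r / 2))"
      using field_differentiable_derivI has_field_derivative_at_within by blast
    have "cmod ((deriv ^^ 1) g x) \<le> fact 1 * B / (r / 4) ^ 1"
    proof (rule Cauchy_inequality)
      show "g holomorphic_on ball x (r / 4)"
        using g(1) sub ball_subset_cball holomorphic_on_subset by blast
      show "continuous_on (cball x (r / 4)) g"
        using holomorphic_on_imp_continuous_on[OF g(1)] sub continuous_on_subset by blast
      fix y assume "cmod (x - y) = r / 4"
      then have "y \<in> cball x (r / 4)" by (simp add: dist_norm)
      then show "cmod (g y) \<le> B" using gB sub by blast
    qed (use r in simp)
    then show "cmod (deriv g x) \<le> 4 * B / r" by (simp add: mult.commute)
  qed (use zw in auto)
  moreover have "ball a (r / 2) \<subseteq> ball a r" using r by (intro subset_ball) simp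
  ultimately show ?thesis using g(2) zw by (metis Diff_iff subsetD)
qed

lemma selfadjoint_symmetric:
  assumes "selfadjoint_op D A" "x \<in> D" "y \<in> D"
  shows "cinner (A x) y = cinner x (A y)"
proof -
  have "(y, A y) \<in> adjoint_graph D A"
    using assms(1,3) by (auto simp: selfadjoint_op_def op_graph_def)
  then show ?thesis using assms(2) by (simp add: adjoint_graph_def)
qed

text \<open>The imaginary part of \<open>\<langle>(z - A) x, x\<rangle>\<close> is \<open>Im z\<close> times the squared norm of \<open>x\<close>.\<close>

lemma selfadjoint_resolvent_imaginary_bound:
  assumes A: "linear_op D A" "selfadjoint_op D A" and z: "z \<in> resolvent_set D A"
  shows "\<bar>Im z\<bar> * norm (resolvent D A z u) \<le> norm u"
proof -
  let ?x = "resolvent D A z u"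
  have x: "?x \<in> D" "z *\<^sub>C ?x - A ?x = u"
    using resolvent_in_domain[OF A(1) z] resolvent_right[OF A(1) z] by auto
  have "cinner (A ?x) ?x = cnj (cinner (A ?x) ?x)"
    using selfadjoint_symmetric[OF A(2) x(1) x(1)] cinner_commute by metis
  then have "Im (cinner (A ?x) ?x) = 0" by (metis Im_complex_of_real Reals_cnj_iff of_real_Re)
  moreover have "cinner u ?x = z * complex_of_real ((norm ?x)\<^sup>2) - cinner (A ?x) ?x"
    using x(2) by (metis cinner_diff_left cinner_scaleC_left cinner_self)
  ultimately have "Im (cinner u ?x) = Im z * (norm ?x)\<^sup>2" by simp
  then have "\<bar>Im z\<bar> * (norm ?x)\<^sup>2 \<le> norm u * norm ?x"
    using abs_Im_le_cmod[of "cinner u ?x"] norm_cinner_le[of u ?x] by (simp add: abs_mult)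
  then show ?thesis
    by (cases "norm ?x = 0") (auto simp: power2_eq_square mult.assoc[symmetric])
qed

text \<open>An isolated spectral point of a selfadjoint operator is harmless on an invariant subspace
  \<open>M\<close> without eigenvectors for it. By the pole estimate, \<open>v z = (z - l) (z - A)\<^sup>-\<^sup>1 u\<close> is bounded and hence
  Lipschitz near \<open>l\<close>, uniformly in \<open>u\<close>. Its limit at \<open>l\<close> is an eigenvector, as the operator is closed,
  so it is \<open>0\<close>; the Lipschitz bound then makes the resolvent itself bounded near \<open>l\<close>.\<close>

lemma isolated_point_bounded_below:
  fixes A :: "'a::chilbert_space \<Rightarrow> 'a"
  assumes A: "linear_op D A" "closed_op D A" "selfadjoint_op D A"
    and l: "Im l = 0" "0 < r" "ball l r - {l} \<subseteq> resolvent_set D A"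
    and M: "csubspace M" "closed M" "\<And>z u. z \<in> resolvent_set D A \<Longrightarrow> u \<in> M \<Longrightarrow> resolvent D A z u \<in> M"
      "\<And>u. u \<in> D \<Longrightarrow> u \<in> M \<Longrightarrow> A u \<in> M"
    and inj: "\<And>u. u \<in> D \<Longrightarrow> u \<in> M \<Longrightarrow> A u = l *\<^sub>C u \<Longrightarrow> u = 0"
  shows "\<exists>c. \<forall>u\<in>D \<inter> M. norm u \<le> c * norm (l *\<^sub>C u - A u)"
proof -
  let ?R = "resolvent D A"
  \<comment> \<open>the pole estimate on radius \<open>2 * q < r\<close> gives bounds on the disc of radius \<open>q\<close>\<close>
  define q where "q = r / 5"
  have q: "q > 0" using l(2) by (simp add: q_def)
  have ball_sub: "z \<in> ball l r - {l}" if "z \<in> ball l q - {l}" for z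
    using that l(2) by (auto simp: q_def)
  have res: "z \<in> resolvent_set D A" if "z \<in> ball l q - {l}" for z
    using ball_sub[OF that] l(3) by blast
  have near_l: "l + complex_of_real t \<in> ball l (q / 2) - {l}" if "0 < t" "t < q / 2" for t
    using that by (simp add: dist_norm)
  define v where "v u z = (z - l) *\<^sub>C ?R z u" for u z
  have hol: "(\<lambda>z. cinner (?R z u) y) holomorphic_on ball l r - {l}" for u y
    using holomorphic_on_resolvent[OF A(1)] holomorphic_on_subset l(3) by blast
  have vbound: "cmod (cinner (v u z) y) \<le> 6 * (norm u * norm y)" if z: "z \<in> ball l q - {l}" for u y z
  proof -
    have "cmod (z - l) * cmod (cinner (?R z u) y) \<le> 6 * (norm u * norm y)"
    proof (rule singularity_bounded_by_imaginary_part[OF hol l(1), of _ _ _ "2 * q"])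
      fix x assume "x \<in> ball l r - {l}"
      then have x: "x \<in> resolvent_set D A" using l(3) by blast
      have "\<bar>Im x\<bar> * cmod (cinner (?R x u) y) \<le> \<bar>Im x\<bar> * (norm (?R x u) * norm y)"
        using norm_cinner_le by (intro mult_left_mono) auto
      also have "\<dots> \<le> norm u * norm y"
        using mult_right_mono[OF selfadjoint_resolvent_imaginary_bound[OF A(1,3) x, of u], of "norm y"]
        by (simp add: mult.assoc)
      finally show "\<bar>Im x\<bar> * cmod (cinner (?R x u) y) \<le> norm u * norm y" .
    qed (use z q l(2) in \<open>auto simp: q_def dist_norm norm_minus_commute\<close>)
    then show ?thesis by (simp add: v_def cinner_scaleC_left norm_mult)
  qed
  define k where "k = 24 / q"
  have Lip: "norm (v u z - v u w) \<le> k * cmod (z - w) * norm u"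
    if zw: "z \<in> ball l (q / 2) - {l}" "w \<in> ball l (q / 2) - {l}" for u z w
  proof (rule norm_le_by_test)
    fix y
    have "(\<lambda>z. cinner (v u z) y) holomorphic_on ball l q - {l}"
    proof -
      have "(\<lambda>z. cinner (?R z u) y) holomorphic_on ball l q - {l}"
        by (rule holomorphic_on_subset[OF hol]) (use ball_sub in blast)
      then show ?thesis
        unfolding v_def cinner_scaleC_left by (intro holomorphic_intros)
    qed
    from bounded_on_punctured_disc_Lipschitz[OF this q vbound zw]
    have "cmod (cinner (v u z) y - cinner (v u w) y) \<le> 4 * (6 * (norm u * norm y)) / q * cmod (z - w)" .
    then show "cmod (cinner (v u z - v u w) y) \<le> k * cmod (z - w) * norm u * norm y"
      by (simp add: k_def cinner_diff_left mult_ac)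
  qed (use q in \<open>simp add: k_def\<close>)
  have resolvent_le: "norm (?R z u) \<le> k * norm u" if u: "u \<in> M" and z: "z \<in> ball l (q / 2) - {l}" for u z
  proof -
    define s where "s n = l + complex_of_real (q / 2 / real (n + 2))" for n
    have s: "s n \<in> ball l (q / 2) - {l}" for n
      unfolding s_def
    proof (rule near_l)
      have "q / 2 / real (n + 2) \<le> q / 2 / 2" using q by (intro divide_left_mono) auto
      then show "q / 2 / real (n + 2) < q / 2" using q by linarith
    qed (use q in simp)
    have sl: "s \<longlonglongrightarrow> l"
    proof -
      have "(\<lambda>n. q / 2 / real (n + 2)) \<longlonglongrightarrow> 0"
        using LIMSEQ_ignore_initial_segment[OF lim_const_over_n[of "q / 2"], of 2] by simp
      then have "(\<lambda>n. l + complex_of_real (q / 2 / real (n + 2))) \<longlonglongrightarrow> l + complex_of_real 0"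
        by (intro tendsto_intros)
      then show ?thesis by (simp add: s_def[abs_def])
    qed
    have "Cauchy (\<lambda>n. v u (s n))"
    proof (rule metric_CauchyI)
      fix e :: real assume e: "e > 0"
      have "k * norm u \<ge> 0" using q by (simp add: k_def)
      then have e': "e / (k * norm u + 1) > 0" using e by simp
      have "Cauchy s" using sl by (rule LIMSEQ_imp_Cauchy)
      then obtain N where N: "\<And>m n. m \<ge> N \<Longrightarrow> n \<ge> N \<Longrightarrow> dist (s m) (s n) < e / (k * norm u + 1)"
        using metric_CauchyD e' by metis
      have "dist (v u (s m)) (v u (s n)) < e" if "m \<ge> N" "n \<ge> N" for m n
      proof -
        have "dist (v u (s m)) (v u (s n)) \<le> (k * norm u) * dist (s m) (s n)"
          using Lip[OF s s, of u m n] by (simp add: dist_norm mult_ac)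
        also have "\<dots> \<le> (k * norm u + 1) * dist (s m) (s n)"
          by (intro mult_right_mono) auto
        also have "\<dots> < (k * norm u + 1) * (e / (k * norm u + 1))"
          using N[OF that] \<open>k * norm u \<ge> 0\<close> by (intro mult_strict_left_mono) auto
        finally show ?thesis using \<open>k * norm u \<ge> 0\<close> by simp
      qed
      then show "\<exists>N. \<forall>m\<ge>N. \<forall>n\<ge>N. dist (v u (s m)) (v u (s n)) < e" by blast
    qed
    then obtain v0 where v0: "(\<lambda>n. v u (s n)) \<longlonglongrightarrow> v0"
      using Cauchy_convergent convergent_def by blast
    have half: "x \<in> ball l q - {l}" if "x \<in> ball l (q / 2) - {l}" for x using that q by auto
    have D: "csubspace D" by (rule linear_op_domain[OF A(1)])
    have vn: "v u (s n) \<in> D" "v u (s n) \<in> M" "A (v u (s n)) = s n *\<^sub>C v u (s n) - (s n - l) *\<^sub>C u" for n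
    proof -
      have sn: "s n \<in> resolvent_set D A" using res[OF half[OF s]] .
      have R: "?R (s n) u \<in> D" "?R (s n) u \<in> M" "A (?R (s n) u) = s n *\<^sub>C ?R (s n) u - u"
        using resolvent_in_domain[OF A(1) sn] M(3)[OF sn u] resolvent_right[OF A(1) sn, of u]
        by (auto simp: algebra_simps)
      show "v u (s n) \<in> D" "v u (s n) \<in> M"
        using R D M(1) by (simp_all add: v_def csubspace_iff)
      show "A (v u (s n)) = s n *\<^sub>C v u (s n) - (s n - l) *\<^sub>C u"
        by (simp only: v_def linear_op_scaleC[OF A(1) R(1)] R(3)
            complex_vector.scale_right_diff_distrib complex_vector.scale_scale mult.commute)
    qed
    have "v0 \<in> M" using closed_sequentially[OF M(2) _ v0] vn(2) by blast
    have scale: "(\<lambda>n. a n *\<^sub>C x n) \<longlonglongrightarrow> a0 *\<^sub>C x0" if ax: "a \<longlonglongrightarrow> a0" "x \<longlonglongrightarrow> x0"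
      for a :: "nat \<Rightarrow> complex" and a0 and x :: "nat \<Rightarrow> 'a" and x0
    proof -
      have b: "norm (a n *\<^sub>C x n - a0 *\<^sub>C x0) \<le> cmod (a n) * norm (x n - x0) + cmod (a n - a0) * norm x0" for n
      proof -
        have "a n *\<^sub>C x n - a0 *\<^sub>C x0 = a n *\<^sub>C (x n - x0) + (a n - a0) *\<^sub>C x0"
          by (simp add: scaleC_simps)
        then show ?thesis using norm_triangle_ineq[of "a n *\<^sub>C (x n - x0)" "(a n - a0) *\<^sub>C x0"]
          by (simp only: norm_scaleC)
      qed
      have "(\<lambda>n. cmod (a n) * norm (x n - x0) + cmod (a n - a0) * norm x0)
          \<longlonglongrightarrow> cmod a0 * norm (x0 - x0) + cmod (a0 - a0) * norm x0"
        by (intro tendsto_intros ax)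
      then have "(\<lambda>n. cmod (a n) * norm (x n - x0) + cmod (a n - a0) * norm x0) \<longlonglongrightarrow> 0" by simp
      then have "(\<lambda>n. a n *\<^sub>C x n - a0 *\<^sub>C x0) \<longlonglongrightarrow> 0"
        by (rule Lim_null_comparison[rotated]) (use b in simp)
      then show ?thesis by (simp add: LIM_zero_iff)
    qed
    have "(\<lambda>n. A (v u (s n))) \<longlonglongrightarrow> l *\<^sub>C v0"
    proof -
      have "(\<lambda>n. s n - l) \<longlonglongrightarrow> 0" using sl by (simp add: LIM_zero)
      then have "(\<lambda>n. s n *\<^sub>C v u (s n) - (s n - l) *\<^sub>C u) \<longlonglongrightarrow> l *\<^sub>C v0 - 0 *\<^sub>C u"
        by (intro tendsto_diff scale sl v0 tendsto_const)
      then show ?thesis by (simp add: vn(3))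
    qed
    then have lim: "(\<lambda>n. (v u (s n), A (v u (s n)))) \<longlonglongrightarrow> (v0, l *\<^sub>C v0)"
      by (intro tendsto_Pair v0)
    have mem: "(v u (s n), A (v u (s n))) \<in> op_graph D A" for n
      using vn(1) by (auto simp: op_graph_def)
    have "(v0, l *\<^sub>C v0) \<in> op_graph D A"
      by (rule closed_sequentially[OF A(2)[unfolded closed_op_def] mem lim])
    then have "v0 \<in> D" "A v0 = l *\<^sub>C v0" by (auto simp: op_graph_def)
    then have "v0 = 0" using inj \<open>v0 \<in> M\<close> by blast
    then have l1: "(\<lambda>n. norm (v u z - v u (s n))) \<longlonglongrightarrow> norm (v u z - 0)"
      using v0 by (intro tendsto_intros) simp
    have l2: "(\<lambda>n. k * cmod (z - s n) * norm u) \<longlonglongrightarrow> k * cmod (z - l) * norm u"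
      by (intro tendsto_intros sl)
    have "norm (v u z - 0) \<le> k * cmod (z - l) * norm u"
      by (rule LIMSEQ_le[OF l1 l2]) (intro exI allI impI Lip[OF z s])
    then have "cmod (z - l) * norm (?R z u) \<le> cmod (z - l) * (k * norm u)"
      by (simp add: v_def norm_scaleC mult_ac)
    then show ?thesis using z by simp
  qed
  have "norm u \<le> 2 * k * norm (l *\<^sub>C u - A u)" if u: "u \<in> D" "u \<in> M" for u
  proof -
    have k: "k > 0" using q by (simp add: k_def)
    define t where "t = min (q / 4) (1 / (2 * k))"
    have t: "0 < t" "t < q / 2" "t * k \<le> 1 / 2"
      using q k by (auto simp: t_def min_def field_simps)
    let ?z = "l + complex_of_real t"
    have z: "?z \<in> ball l (q / 2) - {l}" using near_l t by blast
    have zres: "?z \<in> resolvent_set D A" using z q by (intro res) auto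
    have "?z *\<^sub>C u - A u \<in> M"
      using u M(1,4) complex_vector.subspace_diff complex_vector.subspace_scale by blast
    then have "norm u \<le> k * norm (?z *\<^sub>C u - A u)"
      using resolvent_le[OF _ z] resolvent_left[OF A(1) zres u(1)] by metis
    also have "?z *\<^sub>C u - A u = (l *\<^sub>C u - A u) + complex_of_real t *\<^sub>C u"
      by (simp add: scaleC_simps)
    also have "k * norm \<dots> \<le> k * (norm (l *\<^sub>C u - A u) + t * norm u)"
      using k t(1) norm_triangle_ineq[of "l *\<^sub>C u - A u" "complex_of_real t *\<^sub>C u"]
      by (intro mult_left_mono) (simp_all add: norm_scaleC)
    also have "\<dots> \<le> k * norm (l *\<^sub>C u - A u) + 1 / 2 * norm u"
      using mult_right_mono[OF t(3), of "norm u"] by (simp add: algebra_simps)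
    finally show ?thesis by simp
  qed
  then show ?thesis by blast
qed

section \<open>Polynomials of an unbounded operator and the rational filter\<close>

text \<open>Horner's scheme for \<open>p(A)\<close>; it is meaningful on vectors to which \<open>A\<close> can be applied \<open>degree p\<close>
  times.\<close>

definition poly_op :: "('a::chilbert_space \<Rightarrow> 'a) \<Rightarrow> complex poly \<Rightarrow> 'a \<Rightarrow> 'a"
  where "poly_op A p = fold_coeffs (\<lambda>a f y. a *\<^sub>C y + f (A y)) p (\<lambda>_. 0)"

lemma poly_op_0 [simp]: "poly_op A 0 y = 0"
  by (simp add: poly_op_def)

lemma poly_op_pCons [simp]: "poly_op A (pCons a p) y = a *\<^sub>C y + poly_op A p (A y)"
  by (cases "p = 0"; cases "a = 0") (simp_all add: poly_op_def)

lemma poly_op_add: "poly_op A (p + q) y = poly_op A p y + poly_op A q y"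
  by (induction p q arbitrary: y rule: poly_induct2) (simp_all add: scaleC_simps)

lemma poly_op_smult: "poly_op A (smult c p) y = c *\<^sub>C poly_op A p y"
  by (induction p arbitrary: y rule: pCons_induct) (simp_all add: scaleC_simps)

lemma poly_op_sum: "poly_op A (\<Sum>i\<in>I. p i) y = (\<Sum>i\<in>I. poly_op A (p i) y)"
  by (induction I rule: infinite_finite_induct) (simp_all add: poly_op_add)

lemma poly_op_linear_factor:
  "poly_op A ([:a, b:] * p) y = a *\<^sub>C poly_op A p y + b *\<^sub>C poly_op A p (A y)"
  by (simp add: poly_op_add poly_op_smult)

text \<open>The domain of the \<open>n\<close>-th power of \<open>A\<close>, with all iterates in \<open>M\<close>.\<close>

primrec power_domain :: "'a::chilbert_space set \<Rightarrow> ('a \<Rightarrow> 'a) \<Rightarrow> 'a set \<Rightarrow> nat \<Rightarrow> 'a set"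
  where "power_domain D A M 0 = M"
  | "power_domain D A M (Suc n) = {y \<in> D \<inter> M. A y \<in> power_domain D A M n}"

locale restricted_operator =
  fixes D :: "'a::chilbert_space set" and A :: "'a \<Rightarrow> 'a" and M :: "'a set"
  assumes A: "linear_op D A" and M: "csubspace M"
begin

lemma D_subspace: "csubspace D"
  by (rule linear_op_domain[OF A])

lemma power_domain_combine:
  "x \<in> power_domain D A M n \<Longrightarrow> y \<in> power_domain D A M n
    \<Longrightarrow> c *\<^sub>C x + d *\<^sub>C y \<in> power_domain D A M n"
proof (induction n arbitrary: x y)
  case 0
  then show ?case using M by (simp add: csubspace_iff)
next
  case (Suc n)
  then have xy: "x \<in> D" "y \<in> D" "x \<in> M" "y \<in> M"
    "A x \<in> power_domain D A M n" "A y \<in> power_domain D A M n" by auto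
  have sc: "c *\<^sub>C x \<in> D" "d *\<^sub>C y \<in> D" using xy D_subspace by (simp_all add: csubspace_iff)
  have "A (c *\<^sub>C x + d *\<^sub>C y) = c *\<^sub>C A x + d *\<^sub>C A y"
    using linear_op_add[OF A sc] linear_op_scaleC[OF A] xy by simp
  moreover have "c *\<^sub>C x + d *\<^sub>C y \<in> D \<inter> M"
    using xy D_subspace M by (simp add: csubspace_iff)
  ultimately show ?case using Suc.IH[OF xy(5,6)] by simp
qed

lemma power_domain_Suc_subset: "x \<in> power_domain D A M (Suc n) \<Longrightarrow> x \<in> power_domain D A M n"
  by (induction n arbitrary: x) auto

lemma poly_op_linear:
  "degree p \<le> n \<Longrightarrow> x \<in> power_domain D A M n \<Longrightarrow> y \<in> power_domain D A M n
    \<Longrightarrow> poly_op A p (c *\<^sub>C x + d *\<^sub>C y) = c *\<^sub>C poly_op A p x + d *\<^sub>C poly_op A p y"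
proof (induction p arbitrary: n x y rule: pCons_induct)
  case (pCons a p)
  show ?case
  proof (cases "p = 0")
    case True
    then show ?thesis by (simp add: scaleC_simps mult.commute)
  next
    case False
    then obtain n' where n: "n = Suc n'" "degree p \<le> n'"
      using pCons.prems(1) by (cases n) (auto simp: degree_pCons_eq)
    have xy: "x \<in> D" "y \<in> D" "A x \<in> power_domain D A M n'" "A y \<in> power_domain D A M n'"
      using pCons.prems n by auto
    have sc: "c *\<^sub>C x \<in> D" "d *\<^sub>C y \<in> D" using xy D_subspace by (simp_all add: csubspace_iff)
    have lin: "A (c *\<^sub>C x + d *\<^sub>C y) = c *\<^sub>C A x + d *\<^sub>C A y"
      using linear_op_add[OF A sc] linear_op_scaleC[OF A] xy by simp
    show ?thesis
      by (simp add: lin pCons.IH[OF n(2) xy(3,4)] scaleC_simps mult.commute)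
  qed
qed simp

lemma poly_op_in_domain:
  "degree p \<le> n \<Longrightarrow> y \<in> power_domain D A M (Suc n)
    \<Longrightarrow> poly_op A p y \<in> D \<inter> M \<and> A (poly_op A p y) = poly_op A p (A y)"
proof (induction p arbitrary: n y rule: pCons_induct)
  case 0
  have "0 \<in> D \<inter> M" using D_subspace M by (simp add: csubspace_iff)
  moreover have "A 0 = 0" using linear_op_scaleC[OF A, of 0 0] calculation by simp
  ultimately show ?case by simp
next
  case (pCons a p)
  have y: "y \<in> D" "y \<in> M" "a *\<^sub>C y \<in> D \<inter> M"
    using pCons.prems D_subspace M by (auto simp: csubspace_iff)
  show ?case
  proof (cases "p = 0")
    case True
    then show ?thesis using y linear_op_scaleC[OF A] by simp
  next
    case False
    then obtain n' where n: "n = Suc n'" "degree p \<le> n'"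
      using pCons.prems(1) by (cases n) (auto simp: degree_pCons_eq)
    have "A y \<in> power_domain D A M (Suc n')" using pCons.prems n by simp
    then have IH: "poly_op A p (A y) \<in> D \<inter> M" "A (poly_op A p (A y)) = poly_op A p (A (A y))"
      using pCons.IH[OF n(2)] by auto
    have "a *\<^sub>C y + poly_op A p (A y) \<in> D \<inter> M"
      using IH(1) y(3) D_subspace M by (simp add: csubspace_iff)
    moreover have "A (a *\<^sub>C y + poly_op A p (A y)) = a *\<^sub>C A y + poly_op A p (A (A y))"
      using linear_op_add[OF A, of "a *\<^sub>C y" "poly_op A p (A y)"] IH y linear_op_scaleC[OF A y(1)] by simp
    ultimately show ?thesis by simp
  qed
qed

lemma poly_op_factor:
  assumes "degree p \<le> n" "y \<in> power_domain D A M (Suc n)"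
  shows "poly_op A ([:a, b:] * p) y = a *\<^sub>C poly_op A p y + b *\<^sub>C A (poly_op A p y)"
  using poly_op_in_domain[OF assms] by (simp only: poly_op_linear_factor)

text \<open>If \<open>\<xi> - A\<close> is bounded below for every root \<open>\<xi>\<close> of \<open>p\<close>, then \<open>p(A)\<close> controls all polynomials of at
  most the same degree. Splitting off one root \<open>\<xi>\<close> from \<open>p\<close>, a multiple of \<open>p\<close> cancels the leading term
  of \<open>q\<close>, and the rest is controlled by \<open>p / (X - \<xi>)\<close>, which in turn is controlled by \<open>p\<close>.\<close>

lemma poly_op_dominated:
  assumes "p \<noteq> 0" "degree p = n"
    and "\<And>\<xi>. poly p \<xi> = 0 \<Longrightarrow> \<exists>c. \<forall>x\<in>D \<inter> M. norm x \<le> c * norm (\<xi> *\<^sub>C x - A x)"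
    and "degree q \<le> n"
  shows "\<exists>c\<ge>0. \<forall>y\<in>power_domain D A M n. norm (poly_op A q y) \<le> c * norm (poly_op A p y)"
  using assms
proof (induction n arbitrary: p q)
  case 0
  obtain a where a: "p = [:a:]" using degree_eq_zeroE[OF 0(2)] by blast
  have "degree q = 0" using 0(4) by simp
  then obtain b where b: "q = [:b:]" using degree_eq_zeroE by blast
  note ab = a b
  then have "a \<noteq> 0" using 0 by simp
  then show ?case
    by (intro exI[of _ "cmod b / cmod a"]) (simp add: ab norm_scaleC)
next
  case (Suc n)
  have "\<not> constant (poly p)" using Suc.prems(2) by (simp add: constant_degree)
  then obtain \<xi> where \<xi>: "poly p \<xi> = 0" using fundamental_theorem_of_algebra by blast
  then obtain p' where p': "p = [:- \<xi>, 1:] * p'" using poly_eq_0_iff_dvd by (metis dvdE)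
  have p'0: "p' \<noteq> 0" using p' Suc.prems(1) by auto
  have dp': "degree p' = n"
    using Suc.prems(2) degree_mult_eq[of "[:- \<xi>, 1:]" p'] p'0 p' by simp
  \<comment> \<open>cancels the leading term of \<open>q\<close>\<close>
  define t where "t = coeff q (Suc n) / coeff p (Suc n)"
  define q' where "q' = q - smult t p"
  have "degree q' \<le> n"
  proof (rule degree_le, intro allI impI)
    fix i assume "n < i"
    then consider "i = Suc n" | "Suc n < i" by linarith
    then show "coeff q' i = 0"
    proof cases
      case 1
      have "coeff p (Suc n) \<noteq> 0" using Suc.prems(1,2) by (metis leading_coeff_0_iff)
      then show ?thesis using 1 by (simp add: q'_def t_def)
    next
      case 2
      then show ?thesis using Suc.prems(2,4) by (simp add: q'_def coeff_eq_0)
    qed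
  qed
  moreover have "\<exists>c. \<forall>x\<in>D \<inter> M. norm x \<le> c * norm (\<xi>' *\<^sub>C x - A x)" if "poly p' \<xi>' = 0" for \<xi>'
    using Suc.prems(3)[of \<xi>'] that by (simp add: p')
  ultimately obtain c1 where c1: "c1 \<ge> 0"
    "\<And>y. y \<in> power_domain D A M n \<Longrightarrow> norm (poly_op A q' y) \<le> c1 * norm (poly_op A p' y)"
    using Suc.IH[OF p'0 dp'] by blast
  obtain c2 where c2: "\<And>x. x \<in> D \<inter> M \<Longrightarrow> norm x \<le> c2 * norm (\<xi> *\<^sub>C x - A x)"
    using Suc.prems(3)[OF \<xi>] by blast
  have "norm (poly_op A q y) \<le> (cmod t + c1 * \<bar>c2\<bar>) * norm (poly_op A p y)"
    if y: "y \<in> power_domain D A M (Suc n)" for y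
  proof -
    let ?x = "poly_op A p' y"
    have x: "?x \<in> D \<inter> M" using poly_op_in_domain[OF _ y, of p'] dp' by simp
    have "poly_op A p y = (- \<xi>) *\<^sub>C ?x + 1 *\<^sub>C A ?x"
      unfolding p' by (rule poly_op_factor[OF _ y]) (simp add: dp')
    then have "poly_op A p y = - (\<xi> *\<^sub>C ?x - A ?x)" by simp
    then have px: "norm (poly_op A p y) = norm (\<xi> *\<^sub>C ?x - A ?x)" by (simp only: norm_minus_cancel)
    have "norm ?x \<le> c2 * norm (poly_op A p y)" using c2[OF x] px by simp
    also have "\<dots> \<le> \<bar>c2\<bar> * norm (poly_op A p y)" by (intro mult_right_mono) auto
    finally have nx: "norm ?x \<le> \<bar>c2\<bar> * norm (poly_op A p y)" .
    have "poly_op A q y = t *\<^sub>C poly_op A p y + poly_op A q' y"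
      by (simp add: q'_def flip: poly_op_smult poly_op_add)
    then have "norm (poly_op A q y) \<le> cmod t * norm (poly_op A p y) + norm (poly_op A q' y)"
      using norm_triangle_ineq by (metis norm_scaleC)
    also have "norm (poly_op A q' y) \<le> c1 * norm ?x"
      by (rule c1(2)[OF power_domain_Suc_subset[OF y]])
    also have "c1 * norm ?x \<le> c1 * (\<bar>c2\<bar> * norm (poly_op A p y))"
      using nx c1(1) by (rule mult_left_mono)
    finally show ?thesis by (simp add: algebra_simps)
  qed
  moreover have "cmod t + c1 * \<bar>c2\<bar> \<ge> 0" using c1(1) by simp
  ultimately show ?case by blast
qed

lemma resolvent_power_domain:
  assumes z: "z \<in> resolvent_set D A" and RM: "\<And>u. u \<in> M \<Longrightarrow> resolvent D A z u \<in> M"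
  shows "u \<in> power_domain D A M n \<Longrightarrow> resolvent D A z u \<in> power_domain D A M (Suc n)"
proof (induction n)
  case 0
  let ?x = "resolvent D A z u"
  have "?x \<in> D \<inter> M" using RM 0 resolvent_in_domain[OF A z] by simp
  moreover have "A ?x = z *\<^sub>C ?x + (- 1) *\<^sub>C u"
    using resolvent_right[OF A z, of u] by (simp add: algebra_simps)
  moreover have "z *\<^sub>C ?x + (- 1) *\<^sub>C u \<in> power_domain D A M 0"
    using calculation(1) 0 by (intro power_domain_combine) simp_all
  ultimately show ?case by simp
next
  case (Suc n)
  let ?x = "resolvent D A z u"
  have x: "?x \<in> power_domain D A M (Suc n)"
    using Suc.IH power_domain_Suc_subset[OF Suc.prems] by blast
  have "A ?x = z *\<^sub>C ?x + (- 1) *\<^sub>C u"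
    using resolvent_right[OF A z, of u] by (simp add: algebra_simps)
  then have "A ?x \<in> power_domain D A M (Suc n)"
    using power_domain_combine[OF x Suc.prems] by metis
  moreover have "?x \<in> D \<inter> M" using x by simp
  ultimately show ?case by (simp only: power_domain.simps(2) mem_Collect_eq)
qed

lemma poly_op_node:
  assumes z: "z \<in> resolvent_set D A" and RM: "\<And>u. u \<in> M \<Longrightarrow> resolvent D A z u \<in> M"
    and u: "u \<in> power_domain D A M n" and q: "degree q \<le> n"
  shows "poly_op A ([:z, - 1:] * q) (resolvent D A z u) = poly_op A q u"
proof -
  let ?x = "resolvent D A z u"
  have x: "?x \<in> power_domain D A M (Suc n)" by (rule resolvent_power_domain[OF z RM u])
  have Ax: "A ?x \<in> power_domain D A M n" using x by simp
  have "poly_op A ([:z, - 1:] * q) ?x = z *\<^sub>C poly_op A q ?x + (- 1) *\<^sub>C poly_op A q (A ?x)"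
    by (rule poly_op_linear_factor)
  also have "\<dots> = poly_op A q (z *\<^sub>C ?x + (- 1) *\<^sub>C A ?x)"
    by (rule poly_op_linear[OF q power_domain_Suc_subset[OF x] Ax, symmetric])
  also have "z *\<^sub>C ?x + (- 1) *\<^sub>C A ?x = u"
    using resolvent_right[OF A z, of u] by simp
  finally show ?thesis .
qed

text \<open>Every \<open>x\<close> is \<open>\<Prod>k<N. (z\<^sub>k - A)\<close> applied to some \<open>y\<close>, namely to the product of the resolvents at
  the nodes applied to \<open>x\<close>. In terms of \<open>y\<close>, the operator \<open>r\<^sub>N(A) - \<mu>\<close> becomes a polynomial \<open>p\<close> in \<open>A\<close>.
  Its degree is exactly \<open>N\<close> because \<open>\<mu>\<close> differs from the value \<open>w\<^sub>N\<close> at infinity, so that \<open>p(A) y\<close>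
  controls \<open>x\<close>.\<close>

theorem filter_bounded_below:
  assumes res: "\<And>k. k < N \<Longrightarrow> zs k \<in> resolvent_set D A"
    and RM: "\<And>z u. z \<in> resolvent_set D A \<Longrightarrow> u \<in> M \<Longrightarrow> resolvent D A z u \<in> M"
    and \<mu>: "\<mu> \<noteq> w N"
    and good: "\<And>\<xi>. \<xi> \<in> spectrum D A \<Longrightarrow> rN N w zs \<xi> = \<mu> \<Longrightarrow>
      \<exists>c. \<forall>x\<in>D \<inter> M. norm x \<le> c * norm (\<xi> *\<^sub>C x - A x)"
  shows "\<exists>c\<ge>0. \<forall>x\<in>M. norm x \<le> c * norm (filter_op N w (\<lambda>k. resolvent D A (zs k)) x - \<mu> *\<^sub>C x)"
proof -
  define P where "P I = (\<Prod>k\<in>I. [:zs k, - 1:])" for I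
  have degP: "degree (P I) = card I" if "finite I" for I
    unfolding P_def by (subst degree_prod_sum_eq) (use that in auto)
  have P0: "P I \<noteq> 0" if "finite I" for I
    unfolding P_def using that by simp
  have Pk: "P {..<N} = [:zs k, - 1:] * P ({..<N} - {k})" if "k < N" for k
    unfolding P_def by (rule prod.remove) (use that in auto)
  define p where "p = smult (w N - \<mu>) (P {..<N}) + (\<Sum>k<N. smult (w k) (P ({..<N} - {k})))"
  have small: "coeff (P ({..<N} - {k})) i = 0" if "k < N" "N \<le> i" for k i
    by (rule coeff_eq_0) (use that degP[of "{..<N} - {k}"] in auto)
  have "degree p \<le> N"
    by (rule degree_le) (auto simp: p_def coeff_sum small degP coeff_eq_0)
  moreover have "coeff p N \<noteq> 0"
  proof -
    have "coeff p N = (w N - \<mu>) * coeff (P {..<N}) N"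
      by (simp add: p_def coeff_sum small)
    moreover have "coeff (P {..<N}) N \<noteq> 0"
      using P0[of "{..<N}"] degP[of "{..<N}"] by (metis card_lessThan finite_lessThan leading_coeff_0_iff)
    ultimately show ?thesis using \<mu> by simp
  qed
  ultimately have degp: "degree p = N" "p \<noteq> 0"
    using le_degree[of p N] by auto
  have roots: "\<exists>c. \<forall>x\<in>D \<inter> M. norm x \<le> c * norm (\<xi> *\<^sub>C x - A x)" if \<xi>: "poly p \<xi> = 0" for \<xi>
  proof (cases "\<xi> \<in> resolvent_set D A")
    case True
    obtain c where "\<And>y. norm (resolvent D A \<xi> y) \<le> c * norm y"
      using resolvent_bound[OF True] by blast
    then show ?thesis using resolvent_left[OF A True] by (metis IntD1)
  next
    case False
    have node: "zs k - \<xi> \<noteq> 0" if "k < N" for k using res[OF that] False by auto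
    have evalP: "poly (P I) \<xi> = (\<Prod>k\<in>I. zs k - \<xi>)" for I
      by (simp add: P_def poly_prod)
    have "poly p \<xi> = (\<Prod>k<N. zs k - \<xi>) * (rN N w zs \<xi> - \<mu>)"
    proof -
      have "w k * (\<Prod>j\<in>{..<N} - {k}. zs j - \<xi>) = (\<Prod>j<N. zs j - \<xi>) * (w k / (zs k - \<xi>))"
        if "k < N" for k
        using node[OF that] prod.remove[of "{..<N}" k "\<lambda>j. zs j - \<xi>"] that by simp
      then have "(\<Sum>k<N. w k * (\<Prod>j\<in>{..<N} - {k}. zs j - \<xi>))
          = (\<Prod>j<N. zs j - \<xi>) * (\<Sum>k<N. w k / (zs k - \<xi>))"
        by (simp add: sum_distrib_left)
      then show ?thesis
        by (simp add: p_def poly_sum evalP rN_def algebra_simps)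
    qed
    moreover have "(\<Prod>k<N. zs k - \<xi>) \<noteq> 0" using node by simp
    ultimately have "rN N w zs \<xi> = \<mu>" using \<xi> by simp
    then show ?thesis using good False by (simp add: spectrum_def)
  qed
  obtain c where c: "c \<ge> 0"
    "\<And>y. y \<in> power_domain D A M N \<Longrightarrow> norm (poly_op A (P {..<N}) y) \<le> c * norm (poly_op A p y)"
    using poly_op_dominated[OF degp(2,1) roots, of "P {..<N}"] degP[of "{..<N}"] by auto
  have "norm x \<le> c * norm (filter_op N w (\<lambda>k. resolvent D A (zs k)) x - \<mu> *\<^sub>C x)" if x: "x \<in> M" for x
  proof -
    define Y where "Y = rec_nat x (\<lambda>k. resolvent D A (zs k))"
    have Y: "Y 0 = x" "\<And>k. Y (Suc k) = resolvent D A (zs k) (Y k)" by (simp_all add: Y_def)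
    have Yn: "Y n \<in> power_domain D A M n \<and> poly_op A (P {..<n}) (Y n) = x" if "n \<le> N" for n
      using that
    proof (induction n)
      case 0
      have "poly_op A 1 x = x" unfolding one_pCons by simp
      then show ?case using x Y(1) by (simp add: P_def)
    next
      case (Suc n)
      have "P {..<Suc n} = [:zs n, - 1:] * P {..<n}" by (simp add: P_def lessThan_Suc)
      moreover have "degree (P {..<n}) \<le> n" using degP[of "{..<n}"] by simp
      moreover have n: "zs n \<in> resolvent_set D A" using res Suc.prems by simp
      moreover have IH: "Y n \<in> power_domain D A M n" "poly_op A (P {..<n}) (Y n) = x"
        using Suc.IH Suc.prems by simp_all
      ultimately show ?case
        using resolvent_power_domain[OF n RM[OF n] IH(1)] poly_op_node[OF n RM[OF n] IH(1)]
        by (simp only: Y(2))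
    qed
    let ?y = "Y N"
    have y: "?y \<in> power_domain D A M N" "poly_op A (P {..<N}) ?y = x" using Yn[of N] by auto
    have Rk: "resolvent D A (zs k) x = poly_op A (P ({..<N} - {k})) ?y" if k: "k < N" for k
    proof (rule resolvent_eqI[OF A res[OF k]])
      obtain N' where N': "N = Suc N'" using k by (cases N) auto
      have deg: "degree (P ({..<N} - {k})) \<le> N'" using degP[of "{..<N} - {k}"] k N' by simp
      have y': "?y \<in> power_domain D A M (Suc N')" using y(1) unfolding N' .
      show "poly_op A (P ({..<N} - {k})) ?y \<in> D"
        using poly_op_in_domain[OF deg y'] by blast
      have "x = zs k *\<^sub>C poly_op A (P ({..<N} - {k})) ?y + (- 1) *\<^sub>C A (poly_op A (P ({..<N} - {k})) ?y)"
        using poly_op_factor[OF deg y', of "zs k" "- 1"] y(2) Pk[OF k] by simp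
      then show "zs k *\<^sub>C poly_op A (P ({..<N} - {k})) ?y - A (poly_op A (P ({..<N} - {k})) ?y) = x"
        by simp
    qed
    have "filter_op N w (\<lambda>k. resolvent D A (zs k)) x - \<mu> *\<^sub>C x = poly_op A p ?y"
      by (simp add: filter_op_def p_def poly_op_add poly_op_smult poly_op_sum y(2) Rk
          complex_vector.scale_left_diff_distrib)
    then show ?thesis using c(2)[OF y(1)] y(2) by simp
  qed
  then show ?thesis using c(1) by blast
qed

end

section \<open>Spectral projections of finite rank perturbations of scalars\<close>

text \<open>The image of a basis, enlarged by a vector outside the image, would be an independent set
  of more elements than the basis.\<close>

lemma injective_surj_on_finite_span:
  fixes f :: "'a::chilbert_space \<Rightarrow> 'a"
  assumes f: "clinear f" and B: "finite B" "f ` cspan B \<subseteq> cspan B"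
    and inj: "\<And>x. x \<in> cspan B \<Longrightarrow> f x = 0 \<Longrightarrow> x = 0"
  shows "f ` cspan B = cspan B"
proof (rule ccontr)
  assume "f ` cspan B \<noteq> cspan B"
  then obtain y where y: "y \<in> cspan B" "y \<notin> f ` cspan B" using B(2) by blast
  obtain C where C: "C \<subseteq> B" "cindependent C" "B \<subseteq> cspan C"
    using complex_vector.maximal_independent_subset by blast
  have CB: "cspan C = cspan B"
    using C by (simp add: complex_vector.span_minimal complex_vector.span_mono subset_antisym)
  have fC: "finite C" using C(1) B(1) finite_subset by blast
  have im: "cindependent (f ` C)" "inj_on f C"
    using injective_independent_image[OF f C(2)] inj CB by auto
  have "y \<notin> cspan (f ` C)" using y(2) by (simp add: clinear_span_image[OF f] CB)
  then have "cindependent (insert y (f ` C))" using im(1) by (rule complex_vector.independent_insertI)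
  moreover have "insert y (f ` C) \<subseteq> cspan C"
    using y(1) B(2) C(2) CB complex_vector.span_superset[of C] by auto
  ultimately have "card (insert y (f ` C)) \<le> card C"
    using complex_vector.independent_span_bound[OF fC] by blast
  moreover have "y \<notin> f ` C" using \<open>y \<notin> cspan (f ` C)\<close> complex_vector.span_base[of y "f ` C"] by blast
  ultimately show False using fC im(2) by (simp add: card_image)
qed

lemma eigenvectors_independent:
  fixes T :: "'a::chilbert_space \<Rightarrow> 'a"
  assumes T: "clinear T" and Z: "finite Z" "\<And>z. z \<in> Z \<Longrightarrow> e z \<noteq> 0 \<and> T (e z) = z *\<^sub>C e z"
    and a: "(\<Sum>z\<in>Z. a z *\<^sub>C e z) = 0"
  shows "\<forall>z\<in>Z. a z = 0"
  using Z a
proof (induction Z arbitrary: a rule: finite_induct)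
  case (insert y Z)
  have e: "T (e z) = z *\<^sub>C e z" "e z \<noteq> 0" if "z \<in> insert y Z" for z
    using insert.prems(1)[OF that] by auto
  have s: "a y *\<^sub>C e y + (\<Sum>z\<in>Z. a z *\<^sub>C e z) = 0"
    using insert.prems(2) insert.hyps by simp
  have "T (a y *\<^sub>C e y + (\<Sum>z\<in>Z. a z *\<^sub>C e z)) = a y *\<^sub>C y *\<^sub>C e y + (\<Sum>z\<in>Z. a z *\<^sub>C z *\<^sub>C e z)"
    by (simp add: clinear_add[OF T] clinear_sum[OF T] clinear_scaleC[OF T] e del: complex_vector.scale_scale cong: sum.cong)
  then have t: "a y *\<^sub>C y *\<^sub>C e y + (\<Sum>z\<in>Z. a z *\<^sub>C z *\<^sub>C e z) = 0"
    using s clinear_zero[OF T] by simp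
  have "(\<Sum>z\<in>Z. (a z * (z - y)) *\<^sub>C e z)
      = (\<Sum>z\<in>Z. a z *\<^sub>C z *\<^sub>C e z) - y *\<^sub>C (\<Sum>z\<in>Z. a z *\<^sub>C e z)"
    by (simp add: complex_vector.scale_sum_right sum_subtractf[symmetric] scaleC_simps
        right_diff_distrib mult.commute)
  also have "\<dots> = - (a y *\<^sub>C y *\<^sub>C e y) - y *\<^sub>C (- (a y *\<^sub>C e y))"
    by (simp only: minus_unique[OF s] minus_unique[OF t] minus_minus)
  also have "\<dots> = 0" by (simp add: mult.commute)
  finally have sum0: "(\<Sum>z\<in>Z. (a z * (z - y)) *\<^sub>C e z) = 0" .
  have "\<forall>z\<in>Z. a z * (z - y) = 0"
    by (rule insert.IH[OF _ sum0]) (rule insert.prems(1), simp)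
  then have az: "\<forall>z\<in>Z. a z = 0" using insert.hyps by auto
  then have "a y *\<^sub>C e y = 0" using s by simp
  then show ?case using az e(2)[of y] by simp
qed simp

text \<open>Apart from \<open>w\<close>, every spectral point is an eigenvalue with an eigenvector in the finite
  dimensional space that contains the range of \<open>K\<close>.\<close>

lemma finite_rank_perturbation_spectrum:
  fixes T :: "'a::chilbert_space \<Rightarrow> 'a"
  assumes K: "clinear K" "\<And>x. norm (K x) \<le> b * norm x" "range K \<subseteq> cspan B" "finite B"
    and T: "T = (\<lambda>x. w *\<^sub>C x + K x)"
  shows "finite (spectrum UNIV T)"
proof -
  have linT: "clinear T" using K(1) by (simp add: T clinear_iff scaleC_simps mult.commute algebra_simps)
  define Z where "Z = {z. z \<noteq> w \<and> (\<exists>x. x \<noteq> 0 \<and> T x = z *\<^sub>C x)}"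
  have "\<forall>z\<in>Z. \<exists>x. x \<noteq> 0 \<and> T x = z *\<^sub>C x" unfolding Z_def by blast
  from bchoice[OF this] obtain e where e: "\<And>z. z \<in> Z \<Longrightarrow> e z \<noteq> 0 \<and> T (e z) = z *\<^sub>C e z"
    by blast
  have eB: "e z \<in> cspan B" if z: "z \<in> Z" for z
  proof -
    have "K (e z) = (z - w) *\<^sub>C e z"
      using e[OF z] by (simp add: T scaleC_simps algebra_simps)
    then have eq: "(1 / (z - w)) *\<^sub>C K (e z) = e z"
      using z by (simp add: Z_def)
    have "K (e z) \<in> cspan B" using K(3) by blast
    then have "(1 / (z - w)) *\<^sub>C K (e z) \<in> cspan B" by (rule complex_vector.span_scale)
    then show ?thesis unfolding eq .
  qed
  have "finite Z \<and> card Z \<le> card B"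
  proof (rule finite_if_finite_subsets_card_bdd)
    fix G assume G: "G \<subseteq> Z" "finite G"
    have eG: "e z \<noteq> 0 \<and> T (e z) = z *\<^sub>C e z" if "z \<in> G" for z
      by (rule e) (rule subsetD[OF G(1) that])
    have inj: "inj_on e G"
    proof (rule inj_onI)
      fix y z assume yz: "y \<in> G" "z \<in> G" "e y = e z"
      have ey: "T (e y) = y *\<^sub>C e y" "T (e z) = z *\<^sub>C e z" "e y \<noteq> 0"
        using eG[OF yz(1)] eG[OF yz(2)] by blast+
      have "y *\<^sub>C e y = z *\<^sub>C e y" using ey(1) ey(2)[folded yz(3)] by (rule trans[OF sym])
      then show "y = z" using ey(3) complex_vector.scale_right_imp_eq by blast
    qed
    have "cindependent (e ` G)"
      unfolding complex_vector.dependent_finite[OF finite_imageI[OF G(2)]]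
    proof (intro notI, elim exE conjE)
      fix u assume u: "\<exists>v\<in>e ` G. u v \<noteq> 0" "(\<Sum>v\<in>e ` G. u v *\<^sub>C v) = 0"
      then have "(\<Sum>z\<in>G. u (e z) *\<^sub>C e z) = 0" by (simp add: sum.reindex[OF inj])
      then have "\<forall>z\<in>G. u (e z) = 0"
        by (rule eigenvectors_independent[OF linT G(2), rotated]) (rule eG)
      then show False using u(1) by blast
    qed
    moreover have "e ` G \<subseteq> cspan B" using eB G by blast
    ultimately have "card (e ` G) \<le> card B"
      using complex_vector.independent_span_bound[OF K(4)] by blast
    then show "card G \<le> card B" using inj by (simp add: card_image)
  qed
  moreover have "spectrum UNIV T \<subseteq> insert w Z"
  proof
    fix z assume z: "z \<in> spectrum UNIV T"
    show "z \<in> insert w Z"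
    proof (rule ccontr)
      assume nz: "z \<notin> insert w Z"
      define f where "f x = z *\<^sub>C x - T x" for x
      have zw: "z - w \<noteq> 0" using nz by simp
      have fK: "f x = (z - w) *\<^sub>C x - K x" for x by (simp add: f_def T scaleC_simps)
      have f: "clinear f" using K(1)
        by (simp add: fK clinear_iff scaleC_simps mult.commute algebra_simps)
      have inj: "x = 0" if fx: "f x = 0" for x
      proof (rule ccontr)
        assume "x \<noteq> 0"
        moreover have "T x = z *\<^sub>C x" using fx by (simp only: f_def right_minus_eq)
        ultimately have "z \<in> Z" using zw unfolding Z_def by auto
        then show False using nz by blast
      qed
      have "\<exists>k\<ge>0. \<forall>x\<in>cspan B. norm x \<le> k * norm (f x)"
        by (rule injective_bounded_below[OF f K(4)]) (rule inj)
      then obtain k where k: "k \<ge> 0" "\<And>x. x \<in> cspan B \<Longrightarrow> norm x \<le> k * norm (f x)"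
        by blast
      have fsub: "f ` cspan B \<subseteq> cspan B"
        using K(3) by (auto simp: fK intro!: complex_vector.span_diff complex_vector.span_scale)
      have fB: "f ` cspan B = cspan B"
        by (rule injective_surj_on_finite_span[OF f K(4) fsub]) (rule inj)
      have surj: "\<exists>x\<in>UNIV. z *\<^sub>C x - T x = y" for y
      proof -
        have "K y \<in> f ` cspan B" using K(3) fB by auto
        then obtain u where u: "f u = K y" by auto
        have "f ((1 / (z - w)) *\<^sub>C (y + u)) = (1 / (z - w)) *\<^sub>C ((z - w) *\<^sub>C y - K y + f u)"
          by (simp only: clinear_scaleC[OF f] clinear_add[OF f] fK[of y])
        also have "\<dots> = y" using zw by (simp add: u)
        finally show ?thesis unfolding f_def by (rule bexI) (rule UNIV_I)
      qed
      have bound: "norm x \<le> (1 + k * \<bar>b\<bar>) / cmod (z - w) * norm (z *\<^sub>C x - T x)" for x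
      proof -
        have "f (K x) = K (f x)"
          by (simp add: fK clinear_diff[OF K(1)] clinear_scaleC[OF K(1)])
        then have "norm (K x) \<le> k * norm (K (f x))" using k(2)[of "K x"] K(3) by auto
        also have "\<dots> \<le> k * (\<bar>b\<bar> * norm (f x))"
        proof (rule mult_left_mono[OF _ k(1)])
          show "norm (K (f x)) \<le> \<bar>b\<bar> * norm (f x)"
            by (rule order_trans[OF K(2) mult_right_mono[OF abs_ge_self norm_ge_zero]])
        qed
        finally have Kx: "norm (K x) \<le> k * (\<bar>b\<bar> * norm (f x))" .
        have "cmod (z - w) * norm x = norm (f x + K x)" by (simp add: fK norm_scaleC)
        also have "\<dots> \<le> norm (f x) + norm (K x)" by (rule norm_triangle_ineq)
        finally have "cmod (z - w) * norm x \<le> (1 + k * \<bar>b\<bar>) * norm (f x)"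
          using Kx by (simp add: algebra_simps)
        then show ?thesis using zw by (simp add: f_def field_simps)
      qed
      have "z \<in> resolvent_set UNIV T"
        by (rule resolvent_setI(1)[OF linT[folded linear_op_UNIV] surj bound])
      then show False using z by (simp add: spectrum_def)
    qed
  qed
  ultimately show ?thesis using finite_subset by blast
qed

text \<open>The conditions on \<open>0\<close> make all negative powers of \<open>z\<close> integrate to zero along the contour.\<close>

locale spectral_contour =
  fixes T :: "'a::chilbert_space \<Rightarrow> 'a" and b :: real and g :: "real \<Rightarrow> complex"
  assumes T: "clinear T" "\<And>x. norm (T x) \<le> b * norm x" "0 \<le> b"
    and g: "rectifiable_path g" "pathfinish g = pathstart g"
      "path_image g \<subseteq> resolvent_set UNIV T" "0 \<notin> path_image g" "winding_number g 0 = 0"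
begin

abbreviation R :: "complex \<Rightarrow> 'a \<Rightarrow> 'a" where "R \<equiv> resolvent UNIV T"

abbreviation P :: "'a \<Rightarrow> 'a" where "P \<equiv> spectral_proj g T"

lemma linT: "linear_op UNIV T"
  using T(1) by (simp add: linear_op_UNIV)

lemma resolvent_step: "z \<in> resolvent_set UNIV T \<Longrightarrow> z *\<^sub>C R z x = x + R z (T x)"
  using resolvent_right[OF linT, of z x] resolvent_commute[OF T(1), of z x] by (simp add: diff_eq_eq)

definition represents :: "(real \<Rightarrow> complex) \<Rightarrow> bool"
  where "represents \<gamma> \<longleftrightarrow> (\<forall>F :: complex \<Rightarrow> 'a. continuous_on (resolvent_set UNIV T - {0}) F \<and>
      (\<forall>y. (\<lambda>z. cinner (F z) y) holomorphic_on resolvent_set UNIV T - {0}) \<longrightarrow>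
      has_path_integral F (path_integral g F) g \<and>
      (\<forall>y. cinner (path_integral g F) y = contour_integral \<gamma> (\<lambda>z. cinner (F z) y)))"

lemma contour:
  "\<exists>\<gamma>. valid_path \<gamma> \<and> pathfinish \<gamma> = pathstart \<gamma> \<and>
    path_image \<gamma> \<subseteq> resolvent_set UNIV T - {0} \<and>
    (\<forall>z. z \<notin> resolvent_set UNIV T - {0} \<longrightarrow> winding_number \<gamma> z = winding_number g z) \<and>
    represents \<gamma>"
proof -
  let ?U = "resolvent_set UNIV T - {0}"
  have U: "open ?U" using open_resolvent_set[OF linT] by (rule open_delete)
  have gU: "path_image g \<subseteq> ?U" using g(3,4) by blast
  show ?thesis
  proof (rule rectifiable_path_contour[OF U g(1) gU, where 'a = 'a])
    fix \<gamma> assume \<gamma>: "valid_path \<gamma>" "pathstart \<gamma> = pathstart g" "pathfinish \<gamma> = pathfinish g"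
      "path_image \<gamma> \<subseteq> ?U" "\<And>z. z \<notin> ?U \<Longrightarrow> winding_number \<gamma> z = winding_number g z"
      "\<And>F :: complex \<Rightarrow> 'a. continuous_on ?U F \<Longrightarrow>
      (\<And>y. (\<lambda>z. cinner (F z) y) holomorphic_on ?U) \<Longrightarrow>
      has_path_integral F (path_integral g F) g \<and>
      (\<forall>y. cinner (path_integral g F) y = contour_integral \<gamma> (\<lambda>z. cinner (F z) y))"
    have "represents \<gamma>"
      unfolding represents_def by (intro allI impI, elim conjE, rule \<gamma>(6)) blast+
    moreover have "pathfinish \<gamma> = pathstart \<gamma>" by (simp only: \<gamma>(2,3) g(2))
    ultimately show ?thesis using \<gamma>(1,4,5) by blast
  qed
qed

lemma resolvent_integrand:
  "continuous_on (resolvent_set UNIV T - {0}) (\<lambda>z. R z x)"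
  "(\<lambda>z. cinner (R z x) y) holomorphic_on resolvent_set UNIV T - {0}"
  using continuous_on_subset[OF continuous_on_resolvent[OF linT] Diff_subset]
    holomorphic_on_subset[OF holomorphic_on_resolvent[OF linT] Diff_subset] by blast+

lemma has_path_integral_resolvent:
  "has_path_integral (\<lambda>z. R z x) ((2 * complex_of_real pi * \<i>) *\<^sub>C P x) g"
proof -
  obtain \<gamma> where "represents \<gamma>" using contour by blast
  then have "has_path_integral (\<lambda>z. R z x) (path_integral g (\<lambda>z. R z x)) g"
    unfolding represents_def using resolvent_integrand by (elim allE[of _ "\<lambda>z. R z x"]) simp
  then show ?thesis by (simp add: spectral_proj_def)
qed

lemma path_agree:
  assumes "has_path_integral F i g" "has_path_integral G j g"
    and "\<And>z. z \<in> resolvent_set UNIV T \<Longrightarrow> F z = G z"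
  shows "i = j"
proof -
  obtain L where L: "\<And>p. p tagged_division_of {0..1} \<Longrightarrow> path_variation g p \<le> L"
    using path_variation_bounded[OF g(1)] by blast
  have "norm (i - j) \<le> L * 0"
  proof (rule has_path_integral_diff_le[OF L assms(1,2)])
    fix s :: real assume "s \<in> {0..1}"
    then have "g s \<in> resolvent_set UNIV T" using g(3) by (auto simp: path_image_def)
    then show "norm (F (g s) - G (g s)) \<le> 0" using assms(3) by simp
  qed
  then show ?thesis by simp
qed

lemma P_commute: "P (T x) = T (P x)"
proof -
  have "(2 * complex_of_real pi * \<i>) *\<^sub>C P (T x) = T ((2 * complex_of_real pi * \<i>) *\<^sub>C P x)"
    by (rule path_agree[OF has_path_integral_resolvent
          has_path_integral_linear[OF T(1,2) has_path_integral_resolvent]])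
      (rule resolvent_commute[OF T(1)])
  then have "(2 * complex_of_real pi * \<i>) *\<^sub>C P (T x) = (2 * complex_of_real pi * \<i>) *\<^sub>C T (P x)"
    by (simp only: clinear_scaleC[OF T(1)])
  then show ?thesis by simp
qed

lemma P_commute_power: "P ((T ^^ n) x) = (T ^^ n) (P x)"
  by (induction n) (simp_all add: P_commute)

lemma weak_P:
  assumes "represents \<gamma>"
  shows "2 * complex_of_real pi * \<i> * cinner (P x) y = contour_integral \<gamma> (\<lambda>z. cinner (R z x) y)"
proof -
  have "cinner (path_integral g (\<lambda>z. R z x)) y = contour_integral \<gamma> (\<lambda>z. cinner (R z x) y)"
    using assms resolvent_integrand unfolding represents_def
    by (elim allE[of _ "\<lambda>z. R z x"]) simp
  then show ?thesis by (simp add: spectral_proj_def cinner_scaleC_left)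
qed

lemma clinear_P: "clinear P"
proof -
  let ?U = "resolvent_set UNIV T - {0}"
  obtain \<gamma> where \<gamma>: "valid_path \<gamma>" "path_image \<gamma> \<subseteq> ?U" "represents \<gamma>"
    using contour by blast
  have U: "open ?U" using open_resolvent_set[OF linT] by (rule open_delete)
  have int: "(\<lambda>z. cinner (R z x) y) contour_integrable_on \<gamma>" for x y
    by (rule contour_integrable_holomorphic_simple[OF resolvent_integrand(2) U \<gamma>(1,2)])
  have w: "2 * complex_of_real pi * \<i> * cinner (P x) y = contour_integral \<gamma> (\<lambda>z. cinner (R z x) y)" for x y
    by (rule weak_P[OF \<gamma>(3)])
  have Rlin: "clinear (R z)" if "z \<in> path_image \<gamma>" for z
    using clinear_resolvent[OF linT] that \<gamma>(2) by blast
  show ?thesis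
    unfolding clinear_iff
  proof (intro conjI allI)
    fix x x' :: 'a and c :: complex
    show "P (x + x') = P x + P x'"
    proof (rule cinner_eqI)
      fix y
      have "2 * complex_of_real pi * \<i> * cinner (P (x + x')) y
          = contour_integral \<gamma> (\<lambda>z. cinner (R z x) y + cinner (R z x') y)"
        unfolding w by (rule contour_integral_cong)
          (simp_all add: clinear_add[OF Rlin] cinner_add_left)
      also have "\<dots> = 2 * complex_of_real pi * \<i> * cinner (P x + P x') y"
        by (simp add: contour_integral_add[OF int int] cinner_add_left distrib_left w)
      finally show "cinner (P (x + x')) y = cinner (P x + P x') y" by simp
    qed
    show "P (c *\<^sub>C x) = c *\<^sub>C P x"
    proof (rule cinner_eqI)
      fix y
      have "2 * complex_of_real pi * \<i> * cinner (P (c *\<^sub>C x)) y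
          = contour_integral \<gamma> (\<lambda>z. c * cinner (R z x) y)"
        unfolding w by (rule contour_integral_cong)
          (simp_all add: clinear_scaleC[OF Rlin] cinner_scaleC_left)
      also have "\<dots> = c * (2 * complex_of_real pi * \<i> * cinner (P x) y)"
        by (simp only: contour_integral_lmul[OF int] w)
      finally have "2 * complex_of_real pi * \<i> * cinner (P (c *\<^sub>C x)) y
        = 2 * complex_of_real pi * \<i> * cinner (c *\<^sub>C P x) y"
        by (simp only: cinner_scaleC_left mult.left_commute)
      then show "cinner (P (c *\<^sub>C x)) y = cinner (c *\<^sub>C P x) y" by simp
    qed
  qed
qed

text \<open>The integrals of \<open>F n z = z\<^sup>-\<^sup>n (z - T)\<^sup>-\<^sup>1 T\<^sup>n x\<close> coincide for all \<open>n\<close>, because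
  \<open>(z - T)\<^sup>-\<^sup>1 T u = z (z - T)\<^sup>-\<^sup>1 u - u\<close>. So the integral that defines \<open>P x\<close> can be estimated through
  \<open>T\<^sup>n x\<close>.\<close>

lemma P_norm_le:
  assumes L: "\<And>p. p tagged_division_of {0..1} \<Longrightarrow> path_variation g p \<le> L"
    and c: "\<And>z y. z \<in> path_image g \<Longrightarrow> norm (R z y) \<le> c * norm y"
    and r: "0 < r" "\<And>z. z \<in> path_image g \<Longrightarrow> r \<le> cmod z"
  shows "norm (P x) \<le> L * c / (2 * pi) * norm ((T ^^ n) x) / r ^ n"
proof -
  let ?U = "resolvent_set UNIV T - {0}"
  obtain \<gamma> where \<gamma>: "valid_path \<gamma>" "pathfinish \<gamma> = pathstart \<gamma>" "path_image \<gamma> \<subseteq> ?U"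
    "\<And>z. z \<notin> ?U \<Longrightarrow> winding_number \<gamma> z = winding_number g z" "represents \<gamma>"
    using contour by blast
  have U: "open ?U" using open_resolvent_set[OF linT] by (rule open_delete)
  define F where "F n z = (1 / z ^ n) *\<^sub>C R z ((T ^^ n) x)" for n z
  have holF: "(\<lambda>z. cinner (F n z) y) holomorphic_on ?U" for n y
    unfolding F_def cinner_scaleC_left
    by (intro holomorphic_intros resolvent_integrand(2)) auto
  have contF: "continuous_on ?U (F n)" for n
  proof -
    have eq: "norm (F n z - F n z0) \<le> cmod (1 / z ^ n) * norm (R z ((T ^^ n) x) - R z0 ((T ^^ n) x))
        + cmod (1 / z ^ n - 1 / z0 ^ n) * norm (R z0 ((T ^^ n) x))" for z z0
    proof -
      have "F n z - F n z0 = (1 / z ^ n) *\<^sub>C (R z ((T ^^ n) x) - R z0 ((T ^^ n) x))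
          + (1 / z ^ n - 1 / z0 ^ n) *\<^sub>C R z0 ((T ^^ n) x)"
        by (simp add: F_def scaleC_simps)
      then show ?thesis
        using norm_triangle_ineq[of "(1 / z ^ n) *\<^sub>C (R z ((T ^^ n) x) - R z0 ((T ^^ n) x))"
            "(1 / z ^ n - 1 / z0 ^ n) *\<^sub>C R z0 ((T ^^ n) x)"]
        by (simp only: norm_scaleC)
    qed
    have "(F n \<longlongrightarrow> F n z0) (at z0 within ?U)" if z0: "z0 \<in> ?U" for z0
    proof -
      have R0: "((\<lambda>z. R z ((T ^^ n) x)) \<longlongrightarrow> R z0 ((T ^^ n) x)) (at z0 within ?U)"
        using resolvent_integrand(1) z0 by (simp add: continuous_on_def)
      have "((\<lambda>z. cmod (1 / z ^ n) * norm (R z ((T ^^ n) x) - R z0 ((T ^^ n) x))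
          + cmod (1 / z ^ n - 1 / z0 ^ n) * norm (R z0 ((T ^^ n) x)))
        \<longlongrightarrow> cmod (1 / z0 ^ n) * norm (R z0 ((T ^^ n) x) - R z0 ((T ^^ n) x))
          + cmod (1 / z0 ^ n - 1 / z0 ^ n) * norm (R z0 ((T ^^ n) x))) (at z0 within ?U)"
        using z0 by (intro tendsto_intros R0) auto
      then have "((\<lambda>z. cmod (1 / z ^ n) * norm (R z ((T ^^ n) x) - R z0 ((T ^^ n) x))
          + cmod (1 / z ^ n - 1 / z0 ^ n) * norm (R z0 ((T ^^ n) x))) \<longlongrightarrow> 0) (at z0 within ?U)"
        by simp
      then have "((\<lambda>z. F n z - F n z0) \<longlongrightarrow> 0) (at z0 within ?U)"
        by (rule Lim_null_comparison[rotated]) (intro always_eventually allI eq)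
      then show ?thesis by (simp add: LIM_zero_iff)
    qed
    then show ?thesis by (simp add: continuous_on_def)
  qed
  have F: "has_path_integral (F n) (path_integral g (F n)) g"
    "cinner (path_integral g (F n)) y = contour_integral \<gamma> (\<lambda>z. cinner (F n z) y)" for n y
    using \<gamma>(5)[unfolded represents_def, rule_format, OF conjI[OF contF allI[OF holF]]] by blast+
  have inverse_power: "((\<lambda>z. 1 / z ^ Suc n) has_contour_integral 0) \<gamma>" for n
  proof (rule Cauchy_theorem_global[of "- {0}"])
    show "(\<lambda>z. 1 / z ^ Suc n) holomorphic_on - {0}" by (intro holomorphic_intros) auto
    show "winding_number \<gamma> z = 0" if "z \<notin> - {0}" for z
      using that \<gamma>(4)[of 0] g(5) by simp
  qed (use \<gamma> in auto)
  have shift: "path_integral g (F (Suc n)) = path_integral g (F n)" for n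
  proof (rule cinner_eqI)
    fix y
    let ?u = "(T ^^ n) x"
    have "contour_integral \<gamma> (\<lambda>z. cinner (F (Suc n) z) y)
        = contour_integral \<gamma> (\<lambda>z. cinner (F n z) y - 1 / z ^ Suc n * cinner ?u y)"
    proof (rule contour_integral_cong[OF refl])
      fix z assume "z \<in> path_image \<gamma>"
      then have z: "z \<in> resolvent_set UNIV T" "z \<noteq> 0" using \<gamma>(3) by auto
      have "cinner (R z (T ?u)) y = z * cinner (R z ?u) y - cinner ?u y"
        using arg_cong[OF resolvent_step[OF z(1), of ?u], of "\<lambda>v. cinner v y"]
        by (simp add: cinner_add_left cinner_scaleC_left)
      then show "cinner (F (Suc n) z) y = cinner (F n z) y - 1 / z ^ Suc n * cinner ?u y"
        using z(2) by (simp add: F_def cinner_scaleC_left field_simps)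
    qed
    also have "\<dots> = contour_integral \<gamma> (\<lambda>z. cinner (F n z) y) - 0 * cinner ?u y"
    proof (rule contour_integral_unique, rule has_contour_integral_diff)
      show "((\<lambda>z. cinner (F n z) y) has_contour_integral contour_integral \<gamma> (\<lambda>z. cinner (F n z) y)) \<gamma>"
        by (rule has_contour_integral_integral[OF contour_integrable_holomorphic_simple[OF holF U \<gamma>(1,3)]])
      show "((\<lambda>z. 1 / z ^ Suc n * cinner ?u y) has_contour_integral 0 * cinner ?u y) \<gamma>"
        by (rule has_contour_integral_rmul[OF inverse_power])
    qed
    finally show "cinner (path_integral g (F (Suc n))) y = cinner (path_integral g (F n)) y"
      by (simp add: F(2))
  qed
  have "path_integral g (F n) = path_integral g (F 0)"
    by (induction n) (simp_all add: shift)
  also have "path_integral g (F 0) = (2 * complex_of_real pi * \<i>) *\<^sub>C P x"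
    by (rule path_agree[OF F(1) has_path_integral_resolvent]) (simp add: F_def)
  finally have Pn: "path_integral g (F n) = (2 * complex_of_real pi * \<i>) *\<^sub>C P x" .
  have zero: "has_path_integral (\<lambda>_. 0 :: 'a) 0 g"
    by (auto simp: has_path_integral_iff riemann_sum_def intro!: exI[of _ 1])
  have "norm (path_integral g (F n) - 0) \<le> L * (c * norm ((T ^^ n) x) / r ^ n)"
  proof (rule has_path_integral_diff_le[OF L F(1) zero])
    fix s :: real assume "s \<in> {0..1}"
    then have gs: "g s \<in> path_image g" by (simp add: path_image_def)
    have "norm (F n (g s)) = norm (R (g s) ((T ^^ n) x)) / cmod (g s) ^ n"
      by (simp add: F_def norm_scaleC norm_divide norm_power)
    also have "\<dots> \<le> c * norm ((T ^^ n) x) / r ^ n"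
      using c[OF gs] r(1) r(2)[OF gs] norm_ge_zero
      by (intro frac_le power_mono) (auto intro: order_trans[OF norm_ge_zero c[OF gs]])
    finally show "norm (F n (g s) - 0) \<le> c * norm ((T ^^ n) x) / r ^ n" by simp
  qed
  then have "2 * pi * norm (P x) \<le> L * (c * norm ((T ^^ n) x) / r ^ n)"
    by (simp add: Pn norm_scaleC norm_mult)
  then show ?thesis using r(1) by (simp add: field_simps)
qed

end

lemma nonpos_by_decay:
  fixes d :: real
  assumes "\<And>t. b < t \<Longrightarrow> d \<le> C / (t - b)"
  shows "d \<le> 0"
proof (rule ccontr)
  assume "\<not> d \<le> 0"
  then have d: "d > 0" by simp
  then have "d \<le> C / ((b + (\<bar>C\<bar> + 1) / d) - b)"
    by (intro assms) simp
  also have "\<dots> = C / (\<bar>C\<bar> + 1) * d" by simp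
  also have "\<dots> < 1 * d"
    using d by (intro mult_strict_right_mono) auto
  finally show False by simp
qed

context spectral_contour
begin

text \<open>Factors of \<open>z\<close> turn into factors of \<open>T\<close>, because along a closed path the polynomial correction
  terms integrate to zero.\<close>

lemma loop_moment:
  assumes \<kappa>: "valid_path \<kappa>" "pathfinish \<kappa> = pathstart \<kappa>" "path_image \<kappa> \<subseteq> resolvent_set UNIV T"
  shows "contour_integral \<kappa> (\<lambda>z. z ^ n * cinner (R z x) y)
    = contour_integral \<kappa> (\<lambda>z. cinner (R z ((T ^^ n) x)) y)"
proof (induction n arbitrary: x)
  case (Suc n)
  have U: "open (resolvent_set UNIV T)" by (rule open_resolvent_set[OF linT])
  have "contour_integral \<kappa> (\<lambda>z. z ^ Suc n * cinner (R z x) y)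
      = contour_integral \<kappa> (\<lambda>z. z ^ n * cinner (R z (T x)) y + z ^ n * cinner x y)"
  proof (rule contour_integral_cong[OF refl])
    fix z assume "z \<in> path_image \<kappa>"
    then have z: "z \<in> resolvent_set UNIV T" using \<kappa>(3) by blast
    have "z * cinner (R z x) y = cinner x y + cinner (R z (T x)) y"
      using arg_cong[OF resolvent_step[OF z, of x], of "\<lambda>v. cinner v y"]
      by (simp add: cinner_add_left cinner_scaleC_left)
    then have "z ^ n * (z * cinner (R z x) y) = z ^ n * (cinner x y + cinner (R z (T x)) y)"
      by (simp only:)
    then show "z ^ Suc n * cinner (R z x) y = z ^ n * cinner (R z (T x)) y + z ^ n * cinner x y"
      by (simp add: distrib_left mult_ac)
  qed
  also have "\<dots> = contour_integral \<kappa> (\<lambda>z. z ^ n * cinner (R z (T x)) y) + 0"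
  proof (rule contour_integral_unique, rule has_contour_integral_add)
    have "(\<lambda>z. z ^ n * cinner (R z (T x)) y) holomorphic_on resolvent_set UNIV T"
      by (intro holomorphic_intros holomorphic_on_resolvent[OF linT])
    then show "((\<lambda>z. z ^ n * cinner (R z (T x)) y) has_contour_integral
        contour_integral \<kappa> (\<lambda>z. z ^ n * cinner (R z (T x)) y)) \<kappa>"
      by (intro has_contour_integral_integral contour_integrable_holomorphic_simple[OF _ U \<kappa>(1,3)])
    show "((\<lambda>z. z ^ n * cinner x y) has_contour_integral 0) \<kappa>"
      by (rule Cauchy_theorem_global[OF open_UNIV _ \<kappa>(1,2)]) (auto intro!: holomorphic_intros)
  qed
  also have "\<dots> = contour_integral \<kappa> (\<lambda>z. cinner (R z ((T ^^ n) (T x))) y)"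
    by (simp only: Suc.IH add_0_right)
  finally show ?case by (simp only: funpow_Suc_right comp_apply)
qed simp

text \<open>The full spectral projection is the identity. The residue theorem shows that the integral does
  not depend on the radius, and for large radii it is that of \<open>1 / z\<close> up to an error that tends to \<open>0\<close>.\<close>

lemma large_circle:
  assumes fin: "finite (spectrum UNIV T)" and s: "s > b"
  shows "contour_integral (circlepath 0 s) (\<lambda>z. cinner (R z x) y)
    = 2 * complex_of_real pi * \<i> * cinner x y"
proof -
  let ?f = "\<lambda>z. cinner (R z x) y"
  let ?I = "\<lambda>t. contour_integral (circlepath 0 t) ?f"
  have res: "z \<in> resolvent_set UNIV T" if "b < cmod z" for z
    by (rule resolvent_outside_norm_ball(1)[OF T that])
  have img: "path_image (circlepath 0 t) \<subseteq> resolvent_set UNIV T" if "b < t" for t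
    using that T(3) res by (auto simp: path_image_circlepath)
  have hol: "?f holomorphic_on UNIV - spectrum UNIV T"
    using holomorphic_on_resolvent[OF linT, of x y] by (simp add: spectrum_def Compl_eq_Diff_UNIV[symmetric])
  have I: "?I t = 2 * pi * \<i> * (\<Sum>p\<in>spectrum UNIV T. residue ?f p)" if t: "b < t" for t
  proof -
    have "?I t = 2 * pi * \<i> * (\<Sum>p\<in>spectrum UNIV T. winding_number (circlepath 0 t) p * residue ?f p)"
      by (rule Residue_theorem[OF open_UNIV connected_UNIV fin hol valid_path_circlepath])
        (use img[OF t] in \<open>auto simp: spectrum_def\<close>)
    also have "(\<Sum>p\<in>spectrum UNIV T. winding_number (circlepath 0 t) p * residue ?f p)
        = (\<Sum>p\<in>spectrum UNIV T. residue ?f p)"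
    proof (rule sum.cong[OF refl])
      fix p assume "p \<in> spectrum UNIV T"
      then have "\<not> b < cmod p" using res[of p] by (auto simp: spectrum_def)
      then have "winding_number (circlepath 0 t) p = 1"
        using t by (intro winding_number_circlepath) simp
      then show "winding_number (circlepath 0 t) p * residue ?f p = residue ?f p" by simp
    qed
    finally show ?thesis .
  qed
  define J where "J = 2 * pi * \<i> * (\<Sum>p\<in>spectrum UNIV T. residue ?f p)"
  define C where "C = 2 * pi * (b * norm x * norm y)"
  have le: "cmod (J - 2 * complex_of_real pi * \<i> * cinner x y) \<le> C / (t - b)" if t: "b < t" for t
  proof -
    have t0: "0 < t" using t T(3) by simp
    have c1: "(?f has_contour_integral J) (circlepath 0 t)"
      unfolding J_def I[OF t, symmetric]
      by (intro has_contour_integral_integral contour_integrable_holomorphic_simple[OF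
            holomorphic_on_resolvent[OF linT] open_resolvent_set[OF linT] valid_path_circlepath img[OF t]])
    have "((\<lambda>z. 1 / (z - 0)) has_contour_integral 2 * complex_of_real pi * \<i>) (circlepath 0 t)"
      using Cauchy_integral_circlepath_simple[of "\<lambda>_. 1" 0 t 0] t0 by simp
    from has_contour_integral_rmul[OF this, of "cinner x y"]
    have "((\<lambda>z. 1 / (z - 0) * cinner x y) has_contour_integral
        2 * complex_of_real pi * \<i> * cinner x y) (circlepath 0 t)" .
    from has_contour_integral_diff[OF c1 this]
    have "cmod (J - 2 * complex_of_real pi * \<i> * cinner x y)
        \<le> b * norm x * norm y / (t - b) / t * (2 * pi * t)"
    proof (rule has_contour_integral_bound_circlepath)
      show "0 \<le> b * norm x * norm y / (t - b) / t" using T(3) t t0 by simp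
      show "0 < t" by (rule t0)
      fix z :: complex assume "cmod (z - 0) = t"
      then have zt: "cmod z = t" by simp
      then have z: "z \<in> resolvent_set UNIV T" using res t by simp
      have z0: "z \<noteq> 0" using zt t0 by auto
      have "z * cinner (R z x) y = cinner x y + cinner (R z (T x)) y"
        using arg_cong[OF resolvent_step[OF z, of x], of "\<lambda>v. cinner v y"]
        by (simp add: cinner_add_left cinner_scaleC_left)
      then have "cinner (R z x) y - 1 / (z - 0) * cinner x y = cinner (R z (T x)) y / z"
        using z0 by (simp add: field_simps)
      then have "cmod (cinner (R z x) y - 1 / (z - 0) * cinner x y) = cmod (cinner (R z (T x)) y) / t"
        by (simp only: norm_divide zt)
      also have "\<dots> \<le> b * norm x * norm y / (t - b) / t"
      proof (rule divide_right_mono)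
        have "norm (R z (T x)) \<le> 1 / (t - b) * norm (T x)"
          using resolvent_outside_norm_ball(2)[OF T, of z "T x"] t zt by simp
        also have "\<dots> \<le> 1 / (t - b) * (b * norm x)"
          using T(2)[of x] t by (intro mult_left_mono) auto
        finally have "norm (R z (T x)) * norm y \<le> 1 / (t - b) * (b * norm x) * norm y"
          by (rule mult_right_mono) simp
        then show "cmod (cinner (R z (T x)) y) \<le> b * norm x * norm y / (t - b)"
          using order_trans[OF norm_cinner_le] by simp
      qed (use t0 in simp)
      finally show "cmod (cinner (R z x) y - 1 / (z - 0) * cinner x y)
          \<le> b * norm x * norm y / (t - b) / t" .
    qed
    also have "\<dots> = C / (t - b)" using t0 by (simp add: C_def)
    finally show ?thesis .
  qed
  have "cmod (J - 2 * complex_of_real pi * \<i> * cinner x y) \<le> 0"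
    by (rule nonpos_by_decay[OF le])
  then show ?thesis using I[OF s] by (simp add: J_def)
qed

text \<open>The large circle winds around each spectral point as often as the contour and the circle of
  radius \<open>\<rho>\<close> do together. By the residue theorem \<open>T\<^sup>n x - T\<^sup>n P x\<close> is, up to the factor \<open>2 \<pi> \<i>\<close>, the integral of
  \<open>z\<^sup>n (z - T)\<^sup>-\<^sup>1 x\<close> along the latter.\<close>

lemma power_complement_le:
  assumes fin: "finite (spectrum UNIV T)" and \<rho>: "0 < \<rho>"
    and sp: "\<And>p. p \<in> spectrum UNIV T \<Longrightarrow>
      (winding_number g p = 1 \<and> \<rho> < cmod p) \<or> (winding_number g p = 0 \<and> cmod p < \<rho>)"
  shows "\<exists>C\<ge>0. \<forall>n x. norm ((T ^^ n) (x - P x)) \<le> C * \<rho> ^ n * norm x"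
proof -
  have sphere: "sphere 0 \<rho> \<subseteq> resolvent_set UNIV T"
    using sp by (fastforce simp: spectrum_def)
  obtain c where c: "c > 0" "\<And>z y. z \<in> sphere 0 \<rho> \<Longrightarrow> norm (R z y) \<le> c * norm y"
    using resolvent_bounded_on_compact[OF linT compact_sphere sphere] by blast
  obtain \<gamma> where \<gamma>: "valid_path \<gamma>" "pathfinish \<gamma> = pathstart \<gamma>" "path_image \<gamma> \<subseteq> resolvent_set UNIV T - {0}"
    "\<And>z. z \<notin> resolvent_set UNIV T - {0} \<Longrightarrow> winding_number \<gamma> z = winding_number g z" "represents \<gamma>"
    using contour by blast
  have \<gamma>U: "path_image \<gamma> \<subseteq> resolvent_set UNIV T" using \<gamma>(3) by blast
  let ?small = "circlepath 0 \<rho>" and ?large = "circlepath 0 (b + 1)"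
  have simg: "path_image ?small \<subseteq> resolvent_set UNIV T"
    using sphere \<rho> by (simp add: path_image_circlepath)
  have res: "z \<in> resolvent_set UNIV T" if "b < cmod z" for z
    by (rule resolvent_outside_norm_ball(1)[OF T that])
  have limg: "path_image ?large \<subseteq> resolvent_set UNIV T"
    using T(3) res by (auto simp: path_image_circlepath)
  have wind: "winding_number ?large p = winding_number \<gamma> p + winding_number ?small p"
    if p: "p \<in> spectrum UNIV T" for p
  proof -
    have "\<not> b < cmod p" using res[of p] p by (auto simp: spectrum_def)
    then have l: "winding_number ?large p = 1" by (intro winding_number_circlepath) simp
    have "p \<notin> resolvent_set UNIV T - {0}" using p by (simp add: spectrum_def)
    then have g': "winding_number \<gamma> p = winding_number g p" by (rule \<gamma>(4))
    show ?thesis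
      using sp[OF p]
    proof
      assume a: "winding_number g p = 1 \<and> \<rho> < cmod p"
      have "winding_number ?small p = 0"
        by (rule winding_number_zero_outside[OF path_circlepath convex_cball[of 0 \<rho>]])
          (use a \<rho> in \<open>auto simp: path_image_circlepath\<close>)
      then show ?thesis using a l g' by simp
    next
      assume a: "winding_number g p = 0 \<and> cmod p < \<rho>"
      then have "winding_number ?small p = 1" by (intro winding_number_circlepath) simp
      then show ?thesis using a l g' by simp
    qed
  qed
  have bound: "cmod (cinner ((T ^^ n) (x - P x)) y) \<le> c * \<rho> * \<rho> ^ n * norm x * norm y" for n x y
  proof -
    define f where "f z = z ^ n * cinner (R z x) y" for z
    have fU: "f holomorphic_on resolvent_set UNIV T"
      unfolding f_def by (intro holomorphic_intros holomorphic_on_resolvent[OF linT])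
    then have hol: "f holomorphic_on UNIV - spectrum UNIV T"
      by (simp add: spectrum_def Compl_eq_Diff_UNIV[symmetric])
    have resid: "contour_integral \<kappa> f = 2 * pi * \<i> * (\<Sum>p\<in>spectrum UNIV T. winding_number \<kappa> p * residue f p)"
      if "valid_path \<kappa>" "pathfinish \<kappa> = pathstart \<kappa>" "path_image \<kappa> \<subseteq> resolvent_set UNIV T" for \<kappa>
      by (rule Residue_theorem[OF open_UNIV connected_UNIV fin hol that(1,2)])
        (use that(3) in \<open>auto simp: spectrum_def\<close>)
    have "contour_integral ?large f = contour_integral \<gamma> f + contour_integral ?small f"
      by (simp add: resid[OF \<gamma>(1,2) \<gamma>U] resid[OF valid_path_circlepath _ simg]
          resid[OF valid_path_circlepath _ limg] wind distrib_right sum.distrib distrib_left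
          cong: sum.cong)
    moreover have "contour_integral ?large f = 2 * complex_of_real pi * \<i> * cinner ((T ^^ n) x) y"
      unfolding f_def loop_moment[OF valid_path_circlepath pathfinish_circlepath[unfolded pathstart_circlepath[symmetric]] limg]
      by (rule large_circle[OF fin]) simp
    moreover have "contour_integral \<gamma> f = 2 * complex_of_real pi * \<i> * cinner ((T ^^ n) (P x)) y"
      unfolding f_def loop_moment[OF \<gamma>(1,2) \<gamma>U] P_commute_power[symmetric] weak_P[OF \<gamma>(5)] ..
    ultimately have eq: "contour_integral ?small f
        = 2 * complex_of_real pi * \<i> * cinner ((T ^^ n) (x - P x)) y"
      by (simp add: clinear_diff[OF clinear_funpow[OF T(1)]] cinner_diff_left right_diff_distrib)
    have "(f has_contour_integral contour_integral ?small f) ?small"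
      by (intro has_contour_integral_integral
          contour_integrable_holomorphic_simple[OF fU open_resolvent_set[OF linT] valid_path_circlepath simg])
    then have "cmod (contour_integral ?small f) \<le> \<rho> ^ n * (c * norm x * norm y) * (2 * pi * \<rho>)"
    proof (rule has_contour_integral_bound_circlepath)
      fix z :: complex assume "cmod (z - 0) = \<rho>"
      then have z: "cmod z = \<rho>" "z \<in> sphere 0 \<rho>" by simp_all
      have "cmod (cinner (R z x) y) \<le> norm (R z x) * norm y" by (rule norm_cinner_le)
      also have "\<dots> \<le> c * norm x * norm y" using c(2)[OF z(2)] by (rule mult_right_mono) simp
      finally have "\<rho> ^ n * cmod (cinner (R z x) y) \<le> \<rho> ^ n * (c * norm x * norm y)"
        by (rule mult_left_mono) (use \<rho> in simp)
      then show "cmod (f z) \<le> \<rho> ^ n * (c * norm x * norm y)"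
        by (simp only: f_def norm_mult norm_power z(1))
    qed (use \<rho> c(1) in simp_all)
    then have "2 * pi * cmod (cinner ((T ^^ n) (x - P x)) y) \<le> 2 * pi * (c * \<rho> * \<rho> ^ n * norm x * norm y)"
      by (simp add: eq norm_mult mult_ac)
    then show ?thesis by simp
  qed
  have "norm ((T ^^ n) (x - P x)) \<le> c * \<rho> * \<rho> ^ n * norm x" for n x
    by (rule norm_le_by_test) (use bound c(1) \<rho> in auto)
  then show ?thesis using c(1) \<rho> by (intro exI[of _ "c * \<rho>"]) auto
qed

lemma P_image_expands:
  assumes r: "0 < r" "\<And>z. z \<in> path_image g \<Longrightarrow> r \<le> cmod z"
  shows "\<exists>C>0. \<forall>n x. norm (P x) \<le> C * norm ((T ^^ n) x) / r ^ n"
proof -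
  obtain L where L: "L > 0" "\<And>p. p tagged_division_of {0..1} \<Longrightarrow> path_variation g p \<le> L"
    using path_variation_bounded[OF g(1)] by blast
  have "compact (path_image g)" using g(1) by (simp add: rectifiable_path_def compact_path_image)
  then obtain c where c: "c > 0" "\<And>z y. z \<in> path_image g \<Longrightarrow> norm (R z y) \<le> c * norm y"
    using resolvent_bounded_on_compact[OF linT _ g(3)] by blast
  have "norm (P x) \<le> L * c / (2 * pi) * norm ((T ^^ n) x) / r ^ n" for n x
    by (rule P_norm_le[OF L(2) c(2) r])
  moreover have "L * c / (2 * pi) > 0" using L(1) c(1) by simp
  ultimately show ?thesis by blast
qed

lemma ratio_powers_tendsto_0:
  assumes "0 < \<rho>" "\<rho> < r"
  shows "(\<lambda>n. C * (\<rho> ^ n / r ^ n)) \<longlonglongrightarrow> (0 :: real)"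
proof -
  have "(\<lambda>n. (\<rho> / r) ^ n) \<longlonglongrightarrow> 0" using assms by (intro LIMSEQ_power_zero) simp
  then have "(\<lambda>n. C * (\<rho> / r) ^ n) \<longlonglongrightarrow> 0" by (rule tendsto_mult_right_zero)
  then show ?thesis by (simp only: power_divide)
qed

text \<open>Powers of \<open>T\<close> act on \<open>x - P x\<close> like \<open>\<rho>\<^sup>n\<close> at most, but on a vector with nonzero projection like \<open>r\<^sup>n\<close>
  at least.\<close>

lemma P_idempotent:
  assumes fin: "finite (spectrum UNIV T)" and \<rho>: "0 < \<rho>" "\<rho> < r"
    and sp: "\<And>p. p \<in> spectrum UNIV T \<Longrightarrow>
      (winding_number g p = 1 \<and> \<rho> < cmod p) \<or> (winding_number g p = 0 \<and> cmod p < \<rho>)"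
    and r: "\<And>z. z \<in> path_image g \<Longrightarrow> r \<le> cmod z"
  shows "P (P x) = P x"
proof -
  have r0: "0 < r" using \<rho> by simp
  obtain C1 where C1: "C1 \<ge> 0" "\<And>n x. norm ((T ^^ n) (x - P x)) \<le> C1 * \<rho> ^ n * norm x"
    using power_complement_le[OF fin \<rho>(1) sp] by blast
  obtain C2 where C2: "C2 > 0" "\<And>n x. norm (P x) \<le> C2 * norm ((T ^^ n) x) / r ^ n"
    using P_image_expands[OF r0 r] by blast
  have le: "norm (P (x - P x)) \<le> C2 * C1 * norm x * (\<rho> ^ n / r ^ n)" for n
  proof -
    have "norm (P (x - P x)) \<le> C2 * norm ((T ^^ n) (x - P x)) / r ^ n" by (rule C2(2))
    also have "\<dots> \<le> C2 * (C1 * \<rho> ^ n * norm x) / r ^ n"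
      using C1(2)[of n x] C2(1) r0 by (intro divide_right_mono mult_left_mono) auto
    finally show ?thesis by (simp add: mult_ac)
  qed
  have "norm (P (x - P x)) \<le> 0"
    by (rule LIMSEQ_le_const[OF ratio_powers_tendsto_0[OF \<rho>]]) (use le in blast)
  then show ?thesis by (simp add: clinear_diff[OF clinear_P])
qed

text \<open>The resolvent may well be singular at the points of \<open>M\<close> in the norm of \<open>'a\<close>, but after applying \<open>J\<close>
  it is bounded there. So the singularities of the tested integrands are removable, the contour
  integral of \<open>J (z - T)\<^sup>-\<^sup>1 x\<close> is zero, and injectivity of \<open>J\<close> transfers this to \<open>P x\<close>.\<close>

lemma P_vanish:
  fixes J :: "'a \<Rightarrow> 'h::chilbert_space"
  assumes J: "clinear J" "\<And>u. norm (J u) \<le> c * norm u" "\<And>u. J u = 0 \<Longrightarrow> u = 0"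
    and M: "finite M" "\<And>z. z \<in> spectrum UNIV T \<Longrightarrow> z \<notin> M \<Longrightarrow> winding_number g z = 0"
    and bdd: "\<And>\<mu>. \<mu> \<in> M \<Longrightarrow> \<exists>e>0. \<exists>B. \<forall>z\<in>ball \<mu> e - {\<mu>}.
      z \<in> resolvent_set UNIV T \<and> norm (J (R z x)) \<le> B"
  shows "P x = 0"
proof -
  let ?\<rho> = "resolvent_set UNIV T" and ?F = "\<lambda>z. J (R z x)"
  define M' where "M' = M - ?\<rho>"
  have \<rho>: "open ?\<rho>" by (rule open_resolvent_set[OF linT])
  have hol: "(\<lambda>z. cinner (?F z) y) holomorphic_on ?\<rho>" for y
    by (rule holomorphic_on_resolvent_functional[OF linT J(1,2)])
  have contF: "continuous_on ?\<rho> ?F"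
    by (rule bounded_linear.continuous_on[OF clinear_bounded_linear[OF J(1,2)] continuous_on_resolvent[OF linT]])
  have Mb: "\<exists>e>0. \<exists>B. \<forall>z\<in>ball \<mu> e - {\<mu>}. z \<in> ?\<rho> \<and> norm (?F z) \<le> B" if "\<mu> \<in> M'" for \<mu>
    by (rule bdd) (use that in \<open>simp add: M'_def\<close>)
  have U1: "open (?\<rho> \<union> M')"
    unfolding open_contains_ball
  proof
    fix z assume "z \<in> ?\<rho> \<union> M'"
    then show "\<exists>e>0. ball z e \<subseteq> ?\<rho> \<union> M'"
    proof
      assume "z \<in> ?\<rho>"
      then show ?thesis using \<rho> unfolding open_contains_ball by blast
    next
      assume z: "z \<in> M'"
      then obtain e where "e > 0" "\<forall>w\<in>ball z e - {z}. w \<in> ?\<rho>" using Mb by blast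
      then have "ball z e \<subseteq> ?\<rho> \<union> M'" using z by blast
      then show ?thesis using \<open>e > 0\<close> by blast
    qed
  qed
  obtain \<gamma> where \<gamma>: "valid_path \<gamma>" "pathstart \<gamma> = pathstart g" "pathfinish \<gamma> = pathfinish g"
    "path_image \<gamma> \<subseteq> ?\<rho>" "\<And>z. z \<notin> ?\<rho> \<Longrightarrow> winding_number \<gamma> z = winding_number g z"
    and rep: "has_path_integral ?F (path_integral g ?F) g \<and>
      (\<forall>y. cinner (path_integral g ?F) y = contour_integral \<gamma> (\<lambda>z. cinner (?F z) y))"
  proof (rule rectifiable_path_contour[OF \<rho> g(1,3), where 'a = 'h])
    fix \<gamma> assume 1: "valid_path \<gamma>" "pathstart \<gamma> = pathstart g" "pathfinish \<gamma> = pathfinish g"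
      "path_image \<gamma> \<subseteq> ?\<rho>" "\<And>z. z \<notin> ?\<rho> \<Longrightarrow> winding_number \<gamma> z = winding_number g z"
      and 2: "\<And>F :: complex \<Rightarrow> 'h. continuous_on ?\<rho> F \<Longrightarrow>
      (\<And>y. (\<lambda>z. cinner (F z) y) holomorphic_on ?\<rho>) \<Longrightarrow>
      has_path_integral F (path_integral g F) g \<and>
      (\<forall>y. cinner (path_integral g F) y = contour_integral \<gamma> (\<lambda>z. cinner (F z) y))"
    show thesis by (rule that[OF 1 2[OF contF hol]])
  qed
  have "contour_integral \<gamma> (\<lambda>z. cinner (?F z) y) = 0" for y
  proof -
    let ?f = "\<lambda>z. cinner (?F z) y"
    have "\<exists>h. h holomorphic_on (?\<rho> \<union> M') \<and> (\<forall>z\<in>(?\<rho> \<union> M') - M'. h z = ?f z)"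
    proof (rule removable_singularities)
      show "finite M'" using M(1) by (simp add: M'_def)
      show "M' \<subseteq> interior (?\<rho> \<union> M')" using U1 by (simp add: interior_open)
      show "?f holomorphic_on (?\<rho> \<union> M' - M')" by (rule holomorphic_on_subset[OF hol]) blast
      fix \<mu> assume "\<mu> \<in> M'"
      then obtain e B where e: "e > 0" "\<forall>z\<in>ball \<mu> e - {\<mu>}. z \<in> ?\<rho> \<and> norm (?F z) \<le> B"
        using Mb by blast
      have "\<forall>\<^sub>F z in at \<mu>. norm (?f z) \<le> (B * norm y) * norm (1 :: complex)"
        unfolding eventually_at
      proof (intro exI[of _ e] conjI ballI impI)
        fix z assume "z \<noteq> \<mu> \<and> dist z \<mu> < e"
        then have "norm (?F z) \<le> B" using e(2) by (simp add: dist_commute)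
        then show "norm (?f z) \<le> (B * norm y) * norm (1 :: complex)"
          using order_trans[OF norm_cinner_le mult_right_mono[OF _ norm_ge_zero]] by simp
      qed (rule e(1))
      then show "?f \<in> O[at \<mu>](\<lambda>_. 1)" by (rule bigoI)
    qed
    then obtain h where h: "h holomorphic_on (?\<rho> \<union> M')" "\<And>z. z \<in> ?\<rho> \<Longrightarrow> h z = ?f z"
      unfolding M'_def by blast
    have "(h has_contour_integral 0) \<gamma>"
    proof (rule Cauchy_theorem_global[OF U1 h(1) \<gamma>(1)])
      show "pathfinish \<gamma> = pathstart \<gamma>" using \<gamma>(2,3) g(2) by simp
      show "path_image \<gamma> \<subseteq> ?\<rho> \<union> M'" using \<gamma>(4) by blast
      fix z assume "z \<notin> ?\<rho> \<union> M'"
      then have "z \<notin> ?\<rho>" "z \<in> spectrum UNIV T" "z \<notin> M" by (auto simp: M'_def spectrum_def)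
      then show "winding_number \<gamma> z = 0" using \<gamma>(5) M(2) by simp
    qed
    then have "contour_integral \<gamma> h = 0" by (rule contour_integral_unique)
    moreover have "contour_integral \<gamma> h = contour_integral \<gamma> ?f"
      by (rule contour_integral_cong[OF refl]) (use h(2) \<gamma>(4) in blast)
    ultimately show ?thesis by simp
  qed
  then have "path_integral g ?F = 0" by (intro cinner_eqI) (simp add: rep)
  then have "has_path_integral ?F 0 g" using rep by simp
  then have "J ((2 * complex_of_real pi * \<i>) *\<^sub>C P x) = 0"
    using has_path_integral_unique[OF g(1)
        has_path_integral_linear[OF J(1,2) has_path_integral_resolvent]] by blast
  then have "(2 * complex_of_real pi * \<i>) *\<^sub>C P x = 0" by (rule J(3))
  then show ?thesis by simp
qed

end

section \<open>Convergence of subspace iteration in the gap\<close>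

lemma clinear_image_subspace:
  fixes f :: "'a::chilbert_space \<Rightarrow> 'b::chilbert_space"
  assumes f: "clinear f" and W: "csubspace W"
  shows "csubspace (f ` W)"
  unfolding csubspace_iff
proof (intro conjI ballI allI)
  note W' = W[unfolded csubspace_iff]
  have "f 0 \<in> f ` W" using W' by blast
  then show "0 \<in> f ` W" by (simp add: clinear_zero[OF f])
  fix u assume "u \<in> f ` W"
  then obtain x where x: "x \<in> W" "u = f x" by blast
  show "u + v \<in> f ` W" if "v \<in> f ` W" for v
  proof -
    obtain y where y: "y \<in> W" "v = f y" using \<open>v \<in> f ` W\<close> by blast
    have "f (x + y) \<in> f ` W" using W' x(1) y(1) by blast
    then show ?thesis by (simp only: x(2) y(2) clinear_add[OF f])
  qed
  show "c *\<^sub>C u \<in> f ` W" for c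
  proof -
    have "f (c *\<^sub>C x) \<in> f ` W" using W' x(1) by blast
    then show ?thesis by (simp only: x(2) clinear_scaleC[OF f])
  qed
qed

lemma one_sided_gap_le:
  assumes "\<And>x. x \<in> M \<Longrightarrow> norm x = 1 \<Longrightarrow> infdist x L \<le> c" "0 \<le> c"
  shows "0 \<le> one_sided_gap M L" "one_sided_gap M L \<le> c"
proof -
  let ?X = "insert 0 ((\<lambda>x. infdist x L) ` {x \<in> M. norm x = 1})"
  have le: "t \<le> c" if "t \<in> ?X" for t using that assms by auto
  then have "bdd_above ?X" by (intro bdd_aboveI[of _ c])
  then show "0 \<le> one_sided_gap M L"
    unfolding one_sided_gap_def by (intro cSup_upper) simp_all
  show "one_sided_gap M L \<le> c"
    unfolding one_sided_gap_def by (rule cSup_least) (use le in blast)+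
qed

text \<open>The error is measured relative to the element of \<open>L\<close> on both sides; for \<open>e \<le> 1 / 2\<close> that element
  has norm at most \<open>2\<close> if its partner in \<open>M\<close> is a unit vector.\<close>

lemma gap_le:
  assumes e: "0 \<le> e" "e \<le> 1 / 2"
    and near_L: "\<And>x. x \<in> M \<Longrightarrow> \<exists>y\<in>L. norm (x - y) \<le> e * norm y"
    and near_M: "\<And>y. y \<in> L \<Longrightarrow> \<exists>x\<in>M. norm (x - y) \<le> e * norm y"
  shows "norm (gap M L) \<le> 2 * e"
proof -
  have "infdist x L \<le> 2 * e" if x: "x \<in> M" "norm x = 1" for x
  proof -
    obtain y where y: "y \<in> L" "norm (x - y) \<le> e * norm y" using near_L[OF x(1)] by blast
    have "norm y \<le> norm x + norm (x - y)"
      using norm_triangle_ineq4[of x "x - y"] by simp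
    also have "\<dots> \<le> 1 + 1 / 2 * norm y"
      using x(2) y(2) mult_right_mono[OF e(2), of "norm y"] by simp
    finally have "norm y \<le> 2" by simp
    have "infdist x L \<le> dist x y" by (rule infdist_le[OF y(1)])
    also have "\<dots> \<le> e * norm y" using y(2) by (simp add: dist_norm)
    also have "\<dots> \<le> e * 2" using \<open>norm y \<le> 2\<close> e(1) by (rule mult_left_mono)
    finally show ?thesis by simp
  qed
  from one_sided_gap_le[OF this] have 1: "0 \<le> one_sided_gap M L" "one_sided_gap M L \<le> 2 * e"
    using e(1) by simp_all
  have "infdist y M \<le> 2 * e" if y: "y \<in> L" "norm y = 1" for y
  proof -
    obtain x where x: "x \<in> M" "norm (x - y) \<le> e * norm y" using near_M[OF y(1)] by blast
    have "infdist y M \<le> dist y x" by (rule infdist_le[OF x(1)])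
    also have "\<dots> \<le> 2 * e" using x(2) y(2) e(1) by (simp add: dist_norm norm_minus_commute)
    finally show ?thesis .
  qed
  from one_sided_gap_le[OF this] have "0 \<le> one_sided_gap L M" "one_sided_gap L M \<le> 2 * e"
    using e(1) by simp_all
  then show ?thesis using 1 by (simp add: gap_def max_def)
qed

lemma funpow_image: "((`) f ^^ n) X = (f ^^ n) ` X" for f :: "'a \<Rightarrow> 'a"
  by (induction n) (simp_all add: image_comp)

context spectral_contour
begin

text \<open>The elements \<open>T\<^sup>n x\<close> and \<open>T\<^sup>n (P x)\<close> are paired. The first is the sum of the second and
  \<open>T\<^sup>n (x - P x)\<close>, which decays faster. By the dimension hypotheses the second elements exhaust the range
  of \<open>P\<close>.\<close>

lemma subspace_iteration_gap:
  assumes fin: "finite (spectrum UNIV T)" and \<rho>: "0 < \<rho>" "\<rho> < r"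
    and sp: "\<And>p. p \<in> spectrum UNIV T \<Longrightarrow>
      (winding_number g p = 1 \<and> \<rho> < cmod p) \<or> (winding_number g p = 0 \<and> cmod p < \<rho>)"
    and r: "\<And>z. z \<in> path_image g \<Longrightarrow> r \<le> cmod z"
    and E0: "csubspace E0" "cdim E0 = m" "cdim (P ` E0) = m" "1 \<le> m"
    and max: "\<And>W. csubspace W \<Longrightarrow> W \<subseteq> range P \<Longrightarrow> cdim W = m \<Longrightarrow> W = range P"
  shows "(\<lambda>n. gap (((`) T ^^ n) E0) (range P)) \<longlonglongrightarrow> 0"
proof -
  have r0: "0 < r" using \<rho> by simp
  obtain C1 where C1: "C1 \<ge> 0" "\<And>n x. norm ((T ^^ n) (x - P x)) \<le> C1 * \<rho> ^ n * norm x"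
    using power_complement_le[OF fin \<rho>(1) sp] by blast
  obtain C2 where C2: "C2 > 0" "\<And>n x. norm (P x) \<le> C2 * norm ((T ^^ n) x) / r ^ n"
    using P_image_expands[OF r0 r] by blast
  have idem: "P (P x) = P x" for x by (rule P_idempotent[OF fin \<rho> sp r])
  have PE0: "P ` E0 = range P"
    by (rule max[OF clinear_image_subspace[OF clinear_P E0(1)] _ E0(3)]) blast
  have inj: "x = 0" if "x \<in> E0" "P x = 0" for x
    by (rule injective_by_dim[OF clinear_P E0 that])
  obtain C where C: "finite C" "cspan C = E0" using cdim_basis[OF E0(1,2,4)] by metis
  have "\<exists>k\<ge>0. \<forall>x\<in>cspan C. norm x \<le> k * norm (P x)"
    by (rule injective_bounded_below[OF clinear_P C(1)]) (use inj C(2) in simp)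
  then obtain k where k: "k \<ge> 0" "\<And>x. x \<in> E0 \<Longrightarrow> norm x \<le> k * norm (P x)"
    unfolding C(2) by blast
  have Tn: "clinear (T ^^ n)" for n by (rule clinear_funpow[OF T(1)])
  have sF: "csubspace (range P)" "cdim (range P) = m"
    using clinear_image_subspace[OF clinear_P complex_vector.subspace_UNIV] E0(3) PE0 by simp_all
  have onto: "(T ^^ n) ` range P = range P" for n
  proof (rule max)
    show "csubspace ((T ^^ n) ` range P)" by (rule clinear_image_subspace[OF Tn sF(1)])
    show "(T ^^ n) ` range P \<subseteq> range P"
      by (auto simp flip: P_commute_power)
    obtain B where B: "finite B" "cindependent B" "cspan B = range P" "card B = m"
      using cdim_basis[OF sF E0(4)] by metis
    have "x = 0" if "x \<in> cspan B" "(T ^^ n) x = 0" for x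
    proof -
      have "P x = x" using that(1) idem B(3) by auto
      then show ?thesis using C2(2)[of x n] that(2) by simp
    qed
    note im = injective_independent_image[OF Tn B(2) this]
    have "cdim (cspan ((T ^^ n) ` B)) = card ((T ^^ n) ` B)"
      by (rule complex_vector.dim_span_eq_card_independent[OF im(1)])
    also have "\<dots> = m" by (rule trans[OF card_image[OF im(2)] B(4)])
    finally show "cdim ((T ^^ n) ` range P) = m"
      by (simp only: clinear_span_image[OF Tn] B(3))
  qed
  define c where "c = C1 * k * C2"
  have c0: "c \<ge> 0" using C1(1) k(1) C2(1) by (simp add: c_def)
  have key: "norm ((T ^^ n) x - (T ^^ n) (P x)) \<le> c * (\<rho> ^ n / r ^ n) * norm ((T ^^ n) (P x))"
    if x: "x \<in> E0" for x n
  proof -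
    have "norm ((T ^^ n) x - (T ^^ n) (P x)) \<le> C1 * \<rho> ^ n * norm x"
      using C1(2)[of n x] by (simp only: clinear_diff[OF Tn])
    also have "\<dots> \<le> C1 * \<rho> ^ n * (k * norm (P x))"
      using k(2)[OF x] C1(1) \<rho>(1) by (intro mult_left_mono) auto
    also have "\<dots> \<le> C1 * \<rho> ^ n * (k * (C2 * norm ((T ^^ n) (P x)) / r ^ n))"
      using C2(2)[of "P x" n] C1(1) \<rho>(1) k(1) by (intro mult_left_mono) (auto simp: idem)
    finally show ?thesis by (simp add: c_def mult_ac)
  qed
  let ?e = "\<lambda>n. c * (\<rho> ^ n / r ^ n)"
  have e0: "?e \<longlonglongrightarrow> 0" by (rule ratio_powers_tendsto_0[OF \<rho>])
  then have ev: "\<forall>\<^sub>F n in sequentially. ?e n < 1 / 2"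
    by (rule order_tendstoD) simp
  show ?thesis
  proof (rule Lim_null_comparison)
    show "(\<lambda>n. 2 * ?e n) \<longlonglongrightarrow> 0" using tendsto_mult_right_zero[OF e0] .
    show "\<forall>\<^sub>F n in sequentially. norm (gap (((`) T ^^ n) E0) (range P)) \<le> 2 * ?e n"
      using ev
    proof eventually_elim
      case (elim n)
      show ?case
      proof (rule gap_le)
        show "0 \<le> ?e n" using c0 \<rho>(1) r0 by simp
        show "?e n \<le> 1 / 2" using elim by simp
        fix u assume "u \<in> ((`) T ^^ n) E0"
        then obtain x where x: "x \<in> E0" "u = (T ^^ n) x" by (auto simp: funpow_image)
        have "(T ^^ n) (P x) \<in> range P" using onto[of n] by blast
        then show "\<exists>y\<in>range P. norm (u - y) \<le> ?e n * norm y"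
          using key[OF x(1), of n] x(2) by blast
      next
        fix y assume "y \<in> range P"
        then have "y \<in> (T ^^ n) ` P ` E0" by (simp only: onto PE0)
        then obtain x where x: "x \<in> E0" "y = (T ^^ n) (P x)" by blast
        have "(T ^^ n) x \<in> ((`) T ^^ n) E0" using x(1) by (simp add: funpow_image)
        then show "\<exists>u\<in>((`) T ^^ n) E0. norm (u - y) \<le> ?e n * norm y"
          using key[OF x(1), of n] x(2) by blast
      qed
    qed
  qed
qed

end

section \<open>The filter on the spectrum\<close>

lemma rN_tendsto_at_top: "((\<lambda>x. rN N w zs (complex_of_real x)) \<longlongrightarrow> w N) at_top"
proof -
  have "((\<lambda>x. w k / (zs k - complex_of_real x)) \<longlongrightarrow> 0) at_top" for k
  proof (rule tendsto_divide_0[OF tendsto_const])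
    have "filterlim (\<lambda>x. cmod (zs k - complex_of_real x)) at_top at_top"
    proof (rule filterlim_at_top_mono)
      show "filterlim (\<lambda>x. - cmod (zs k) + x) at_top (at_top :: real filter)"
        by (rule filterlim_tendsto_add_at_top[OF tendsto_const filterlim_ident])
      show "\<forall>\<^sub>F x in at_top. - cmod (zs k) + x \<le> cmod (zs k - complex_of_real x)"
      proof (intro always_eventually allI)
        fix x :: real
        show "- cmod (zs k) + x \<le> cmod (zs k - complex_of_real x)"
          using norm_triangle_ineq2[of "complex_of_real x" "zs k"]
          by (simp add: norm_minus_commute)
      qed
    qed
    then show "filterlim (\<lambda>x. zs k - complex_of_real x) at_infinity at_top"
      by (rule filterlim_norm_at_top_imp_at_infinity)
  qed
  then have "((\<lambda>x. w N + (\<Sum>k<N. w k / (zs k - complex_of_real x))) \<longlongrightarrow> w N + (\<Sum>k<N. 0)) at_top"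
    by (intro tendsto_add tendsto_sum tendsto_const)
  then show ?thesis by (simp add: rN_def)
qed

text \<open>The value \<open>w N\<close> is covered as well, because it is the limit of \<open>r\<^sub>N\<close> at infinity along the unbounded
  set of the supremum.\<close>

lemma assumption1_separation:
  assumes A1: "assumption1 D A \<Lambda> N w zs" and \<Lambda>: "\<Lambda> \<subseteq> spectrum D A" "\<Lambda> \<noteq> {}"
  obtains q where "\<And>\<xi>. \<xi> \<in> spectrum D A - \<Lambda> \<Longrightarrow> cmod (rN N w zs \<xi>) \<le> q" "cmod (w N) \<le> q"
    "\<And>l. l \<in> \<Lambda> \<Longrightarrow> q < cmod (rN N w zs l)"
proof -
  obtain y \<delta> \<gamma> where ydg: "\<delta> > 0" "\<gamma> > 0" "\<Lambda> \<subseteq> complex_of_real ` I_set y \<gamma>"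
    "spectrum D A - \<Lambda> \<subseteq> complex_of_real ` O_set y \<delta> \<gamma>"
    "inf_filter N w zs (I_set y \<gamma>) > 0" "kappa_hat N w zs y \<delta> \<gamma> < 1"
    and nodes: "\<forall>k<N. zs k \<notin> closure (spectrum D A)"
    using A1 unfolding assumption1_def by blast
  let ?s = "sup_filter N w zs (O_set y \<delta> \<gamma>)" and ?i = "inf_filter N w zs (I_set y \<gamma>)"
  let ?r = "rN N w zs"
  have node: "\<xi> \<notin> zs ` {..<N}" if "\<xi> \<in> spectrum D A" for \<xi>
    using nodes that closure_subset by blast
  have i_le: "?i \<le> ennreal (cmod (?r l))" if l: "l \<in> \<Lambda>" for l
  proof -
    obtain x where x: "x \<in> I_set y \<gamma>" "l = complex_of_real x" using ydg(3) l by blast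
    have "l \<notin> zs ` {..<N}" using node \<Lambda>(1) l by blast
    then show ?thesis
      unfolding inf_filter_def x(2) by (intro INF_lower) (use x(1) in simp)
  qed
  obtain l0 where l0: "l0 \<in> \<Lambda>" using \<Lambda>(2) by blast
  have i_fin: "?i \<noteq> top" using i_le[OF l0] by (auto simp: top_unique)
  have si: "?s < ?i"
  proof (rule ccontr)
    assume "\<not> ?s < ?i"
    then have "?i / ?i \<le> ?s / ?i" by (intro divide_right_mono_ennreal) simp
    moreover have "?i / ?i = 1" using ydg(5) i_fin by (intro ennreal_divide_self) (auto simp: less_top)
    ultimately show False using ydg(6) unfolding kappa_hat_def by simp
  qed
  define q where "q = enn2real ?s"
  have s_fin: "?s < top" using si by (rule order_less_le_trans) simp
  have q: "?s = ennreal q" "0 \<le> q" using s_fin by (simp_all add: q_def)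
  have O_le: "cmod (?r (complex_of_real x)) \<le> q"
    if "x \<in> O_set y \<delta> \<gamma>" "complex_of_real x \<notin> zs ` {..<N}" for x
  proof -
    have "ennreal (cmod (?r (complex_of_real x))) \<le> ?s"
      unfolding sup_filter_def by (rule SUP_upper) (use that in simp)
    then show ?thesis unfolding q(1) using q(2) by simp
  qed
  show thesis
  proof (rule that)
    fix \<xi> assume \<xi>: "\<xi> \<in> spectrum D A - \<Lambda>"
    then obtain x where x: "x \<in> O_set y \<delta> \<gamma>" "\<xi> = complex_of_real x" using ydg(4) by blast
    have "\<xi> \<notin> zs ` {..<N}" using node \<xi> by blast
    then show "cmod (?r \<xi>) \<le> q" using O_le[OF x(1)] unfolding x(2) by blast
  next
    have "\<forall>\<^sub>F x in at_top. \<forall>k\<in>{..<N}. Re (zs k) < x"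
      by (intro eventually_ball_finite ballI eventually_gt_at_top) simp
    then have "\<forall>\<^sub>F x in at_top. cmod (?r (complex_of_real x)) \<le> q"
      using eventually_ge_at_top[of "y + (1 + \<delta>) * \<gamma>"]
    proof eventually_elim
      case (elim x)
      have "x \<in> O_set y \<delta> \<gamma>" using elim(2) by (simp add: O_set_def)
      moreover have "complex_of_real x \<notin> zs ` {..<N}"
      proof
        assume "complex_of_real x \<in> zs ` {..<N}"
        then obtain k where "k < N" "complex_of_real x = zs k" by auto
        then show False using elim(1) by (metis Re_complex_of_real lessThan_iff order_less_irrefl)
      qed
      ultimately show ?case by (rule O_le)
    qed
    then show "cmod (w N) \<le> q"
      by (rule tendsto_upperbound[OF tendsto_norm[OF rN_tendsto_at_top]]) simp
  next
    fix l assume "l \<in> \<Lambda>"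
    then have "ennreal q < ennreal (cmod (?r l))" using si i_le[of l] q(1) by simp
    then show "q < cmod (?r l)" using q(2) by (simp add: ennreal_less_iff)
  qed
qed

lemma assumption1_isolated:
  assumes A1: "assumption1 D A \<Lambda> N w zs" and \<Lambda>: "finite \<Lambda>" "l \<in> \<Lambda>"
  shows "Im l = 0" "\<exists>r>0. ball l r - {l} \<subseteq> resolvent_set D A"
proof -
  obtain y \<delta> \<gamma> where ydg: "\<delta> > 0" "\<gamma> > 0" "\<Lambda> \<subseteq> complex_of_real ` I_set y \<gamma>"
    "spectrum D A - \<Lambda> \<subseteq> complex_of_real ` O_set y \<delta> \<gamma>"
    using A1 unfolding assumption1_def by blast
  obtain x where x: "x \<in> I_set y \<gamma>" "l = complex_of_real x" using ydg(3) \<Lambda>(2) by blast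
  show "Im l = 0" by (simp add: x(2))
  have "open (- (\<Lambda> - {l}))" by (intro open_Compl finite_imp_closed finite_Diff \<Lambda>(1))
  then obtain r1 where r1: "r1 > 0" "ball l r1 \<subseteq> - (\<Lambda> - {l})"
    unfolding open_contains_ball by blast
  have "z \<in> resolvent_set D A" if z: "z \<in> ball l (min r1 (\<delta> * \<gamma>)) - {l}" for z
  proof (rule ccontr)
    assume "z \<notin> resolvent_set D A"
    moreover have "z \<notin> \<Lambda>" using z r1(2) by auto
    ultimately obtain t where t: "t \<in> O_set y \<delta> \<gamma>" "z = complex_of_real t"
      using ydg(4) by (auto simp: spectrum_def)
    have "\<bar>t - x\<bar> < \<delta> * \<gamma>"
      using z by (simp add: x(2) t(2) dist_norm abs_minus_commute flip: of_real_diff)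
    then show False using t(1) x(1) by (simp add: O_set_def I_set_def algebra_simps)
  qed
  then have "ball l (min r1 (\<delta> * \<gamma>)) - {l} \<subseteq> resolvent_set D A" by blast
  moreover have "min r1 (\<delta> * \<gamma>) > 0" using r1(1) ydg(1,2) by simp
  ultimately show "\<exists>r>0. ball l r - {l} \<subseteq> resolvent_set D A" by blast
qed

section \<open>The filter operators\<close>

lemma clinear_filter_op: "(\<And>k. k < N \<Longrightarrow> clinear (R k)) \<Longrightarrow> clinear (filter_op N w R)"
  unfolding clinear_iff filter_op_def
  by (simp add: scaleC_simps sum.distrib complex_vector.scale_sum_right mult.commute)

lemma filter_op_norm_le:
  assumes "\<And>k. k < N \<Longrightarrow> norm (R k v) \<le> c k * norm v"
  shows "norm (filter_op N w R v) \<le> (cmod (w N) + (\<Sum>k<N. cmod (w k) * c k)) * norm v"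
proof -
  have "norm (filter_op N w R v) \<le> norm (w N *\<^sub>C v) + norm (\<Sum>k<N. w k *\<^sub>C R k v)"
    unfolding filter_op_def by (rule norm_triangle_ineq)
  also have "norm (\<Sum>k<N. w k *\<^sub>C R k v) \<le> (\<Sum>k<N. cmod (w k) * (c k * norm v))"
    by (rule sum_norm_le) (use assms in \<open>simp add: norm_scaleC mult_left_mono\<close>)
  finally show ?thesis by (simp add: norm_scaleC distrib_right sum_distrib_right mult.assoc)
qed

lemma filter_op_diff_norm_le:
  assumes "\<And>k. k < N \<Longrightarrow> norm (R k v - R' k v) \<le> e * norm v"
  shows "norm (filter_op N w R v - filter_op N w R' v) \<le> (\<Sum>k<N. cmod (w k)) * e * norm v"
proof -
  have "filter_op N w R v - filter_op N w R' v = (\<Sum>k<N. w k *\<^sub>C (R k v - R' k v))"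
    by (simp add: filter_op_def complex_vector.scale_right_diff_distrib sum_subtractf)
  also have "norm \<dots> \<le> (\<Sum>k<N. cmod (w k) * (e * norm v))"
    by (rule sum_norm_le) (use assms in \<open>simp add: norm_scaleC mult_left_mono\<close>)
  finally show ?thesis by (simp add: sum_distrib_right mult.assoc)
qed

text \<open>An eigenvector of \<open>A\<close> is one of the adjoint resolvent.\<close>

lemma resolvent_eigenvector:
  assumes A: "linear_op D A" "selfadjoint_op D A" and z: "z \<in> resolvent_set D A"
    and e: "e \<in> eigenspace D A l" "Im l = 0" "l \<in> spectrum D A"
  shows "cinner (resolvent D A z u) e = cinner u e / (z - l)"
proof -
  let ?x = "resolvent D A z u"
  have x: "?x \<in> D" "z *\<^sub>C ?x - A ?x = u"
    using resolvent_in_domain[OF A(1) z] resolvent_right[OF A(1) z] by auto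
  have e': "e \<in> D" "A e = l *\<^sub>C e" using e(1) by (auto simp: eigenspace_def)
  have "cinner (A ?x) e = l * cinner ?x e"
    using selfadjoint_symmetric[OF A(2) x(1) e'(1)] e(2)
    by (simp add: e'(2) cinner_scaleC_right complex_eq_iff[of "cnj l" l])
  then have "cinner u e = (z - l) * cinner ?x e"
    using arg_cong[OF x(2), of "\<lambda>v. cinner v e"]
    by (simp add: cinner_diff_left cinner_scaleC_left left_diff_distrib)
  moreover have "z - l \<noteq> 0" using z e(3) by (auto simp: spectrum_def)
  ultimately show ?thesis by simp
qed

lemma filter_op_eigenvector:
  assumes A: "linear_op D A" "selfadjoint_op D A"
    and res: "\<And>k. k < N \<Longrightarrow> zs k \<in> resolvent_set D A"
    and e: "e \<in> eigenspace D A l" "Im l = 0" "l \<in> spectrum D A"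
  shows "cinner (filter_op N w (\<lambda>k. resolvent D A (zs k)) u) e = rN N w zs l * cinner u e"
  by (simp add: filter_op_def rN_def cinner_add_left cinner_sum_left cinner_scaleC_left
      resolvent_eigenvector[OF A res e] distrib_right sum_distrib_right)

definition eigen_complement :: "'a::chilbert_space set \<Rightarrow> ('a \<Rightarrow> 'a) \<Rightarrow> complex set \<Rightarrow> 'a set"
  where "eigen_complement D A \<Lambda> = {u. \<forall>l\<in>\<Lambda>. \<forall>e\<in>eigenspace D A l. cinner u e = 0}"

lemma csubspace_eigen_complement: "csubspace (eigen_complement D A \<Lambda>)"
  by (simp add: csubspace_iff eigen_complement_def cinner_add_left cinner_scaleC_left)

lemma closed_eigen_complement: "closed (eigen_complement D A \<Lambda>)"
proof -
  have "closed {u. cinner u e = 0}" for e :: 'a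
    unfolding closed_sequential_limits
  proof (intro allI impI, elim conjE)
    fix x :: "nat \<Rightarrow> 'a" and u
    assume x: "\<forall>n. x n \<in> {u. cinner u e = 0}" "x \<longlonglongrightarrow> u"
    have "(\<lambda>n. cinner (x n) e) \<longlonglongrightarrow> cinner u e" by (rule tendsto_cinner_left[OF x(2)])
    then have "(\<lambda>n. 0) \<longlonglongrightarrow> cinner u e" using x(1) by simp
    then have "0 = cinner u e" by (rule LIMSEQ_unique[OF tendsto_const])
    then show "u \<in> {u. cinner u e = 0}" by simp
  qed
  then have "closed (\<Inter>l\<in>\<Lambda>. \<Inter>e\<in>eigenspace D A l. {u. cinner u e = 0})" by (intro closed_INT ballI)
  moreover have "eigen_complement D A \<Lambda> = (\<Inter>l\<in>\<Lambda>. \<Inter>e\<in>eigenspace D A l. {u. cinner u e = 0})"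
    by (auto simp: eigen_complement_def)
  ultimately show ?thesis by simp
qed

text \<open>A spectral point with the same filter value as \<open>l\<close> must belong to \<open>\<Lambda>\<close> by the separation of the
  values. There it is isolated, and its eigenvectors are orthogonal to the complement.\<close>

lemma filter_bounded_below_on_complement:
  assumes A: "linear_op D A" "closed_op D A" "selfadjoint_op D A"
    and \<Lambda>: "finite \<Lambda>" "\<Lambda> \<subseteq> spectrum D A" "l \<in> \<Lambda>"
    and A1: "assumption1 D A \<Lambda> N w zs"
    and res: "\<And>k. k < N \<Longrightarrow> zs k \<in> resolvent_set D A"
  shows "\<exists>c\<ge>0. \<forall>u\<in>eigen_complement D A \<Lambda>.
    norm u \<le> c * norm (filter_op N w (\<lambda>k. resolvent D A (zs k)) u - rN N w zs l *\<^sub>C u)"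
proof -
  let ?M = "eigen_complement D A \<Lambda>"
  note real = assumption1_isolated(1)[OF A1 \<Lambda>(1)]
  have R: "resolvent D A z u \<in> ?M" if z: "z \<in> resolvent_set D A" and u: "u \<in> ?M" for z u
    unfolding eigen_complement_def
  proof (intro CollectI ballI)
    fix l' e assume l': "l' \<in> \<Lambda>" and e: "e \<in> eigenspace D A l'"
    have "l' \<in> spectrum D A" using \<Lambda>(2) l' by blast
    then have "cinner (resolvent D A z u) e = cinner u e / (z - l')"
      by (rule resolvent_eigenvector[OF A(1,3) z e real[OF l']])
    then show "cinner (resolvent D A z u) e = 0"
      using u l' e by (simp add: eigen_complement_def)
  qed
  have AM: "A u \<in> ?M" if u: "u \<in> D" "u \<in> ?M" for u
    unfolding eigen_complement_def
  proof (intro CollectI ballI)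
    fix l' e assume l': "l' \<in> \<Lambda>" and e: "e \<in> eigenspace D A l'"
    have "cinner (A u) e = cinner u (A e)"
      using selfadjoint_symmetric[OF A(3) u(1)] e by (simp add: eigenspace_def)
    also have "\<dots> = cnj l' * cinner u e" using e by (simp add: eigenspace_def cinner_scaleC_right)
    also have "\<dots> = 0" using u(2) l' e by (simp add: eigen_complement_def)
    finally show "cinner (A u) e = 0" .
  qed
  note selfadjoint = A
  interpret restricted_operator D A ?M
    by unfold_locales (rule A(1), rule csubspace_eigen_complement)
  have ne: "\<Lambda> \<noteq> {}" using \<Lambda>(3) by blast
  obtain q where q: "\<And>\<xi>. \<xi> \<in> spectrum D A - \<Lambda> \<Longrightarrow> cmod (rN N w zs \<xi>) \<le> q" "cmod (w N) \<le> q"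
    "\<And>l. l \<in> \<Lambda> \<Longrightarrow> q < cmod (rN N w zs l)"
    using assumption1_separation[OF A1 \<Lambda>(2) ne] by blast
  show ?thesis
  proof (rule filter_bounded_below[OF res R])
    show "rN N w zs l \<noteq> w N" using q(2) q(3)[OF \<Lambda>(3)] by auto
    fix \<xi> assume \<xi>: "\<xi> \<in> spectrum D A" "rN N w zs \<xi> = rN N w zs l"
    have "\<xi> \<in> \<Lambda>"
    proof (rule ccontr)
      assume "\<xi> \<notin> \<Lambda>"
      then have "cmod (rN N w zs \<xi>) \<le> q" using q(1) \<xi>(1) by blast
      then show False using q(3)[OF \<Lambda>(3)] \<xi>(2) by simp
    qed
    then obtain r where r: "r > 0" "ball \<xi> r - {\<xi>} \<subseteq> resolvent_set D A"
      using assumption1_isolated(2)[OF A1 \<Lambda>(1)] by blast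
    show "\<exists>c. \<forall>x\<in>D \<inter> ?M. norm x \<le> c * norm (\<xi> *\<^sub>C x - A x)"
    proof (rule isolated_point_bounded_below[OF selfadjoint real[OF \<open>\<xi> \<in> \<Lambda>\<close>] r])
      show "csubspace ?M" by (rule csubspace_eigen_complement)
      show "closed ?M" by (rule closed_eigen_complement)
      show "resolvent D A z u \<in> ?M" if "z \<in> resolvent_set D A" "u \<in> ?M" for z u
        using that by (rule R)
      show "A u \<in> ?M" if "u \<in> D" "u \<in> ?M" for u using that by (rule AM)
      fix u assume u: "u \<in> D" "u \<in> ?M" "A u = \<xi> *\<^sub>C u"
      then have "u \<in> eigenspace D A \<xi>" by (simp add: eigenspace_def)
      then have "cinner u u = 0" using u(2) \<open>\<xi> \<in> \<Lambda>\<close> by (simp add: eigen_complement_def)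
      then show "u = 0" by (simp add: cinner_self)
    qed
  qed
qed

section \<open>Contours around part of a spectrum\<close>

text \<open>The number \<open>r\<close> is the least modulus on the contour. The ball of radius \<open>r\<close> around \<open>0\<close> is connected
  and misses the contour, so that with \<open>0\<close> all of it lies outside.\<close>

lemma admissible_contour_separates:
  fixes S :: "'v::chilbert_space \<Rightarrow> 'v"
  assumes S: "clinear S" "\<And>v. norm (S v) \<le> b * norm v" "0 \<le> b"
    and g: "admissible_contour g S M"
  obtains r where "r > 0" "closed ({z. r \<le> cmod z} - inside (path_image g))"
    "{z. r \<le> cmod z} - inside (path_image g) \<subseteq> resolvent_set UNIV S"
    "path_image g \<subseteq> {z. r \<le> cmod z} - inside (path_image g)"
    "\<And>p. p \<in> inside (path_image g) \<Longrightarrow> r \<le> cmod p"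
    "\<And>p. p \<notin> inside (path_image g) \<Longrightarrow> p \<notin> path_image g \<Longrightarrow> winding_number g p = 0"
proof -
  let ?G = "path_image g" and ?I = "inside (path_image g)"
  have g': "path g" "pathfinish g = pathstart g" "\<And>z. z \<in> ?G \<Longrightarrow> mu_star S M < cmod z"
    "?I \<inter> spectrum UNIV S \<subseteq> M" "M \<subseteq> ?I" "0 \<notin> ?I"
    using g by (auto simp: admissible_contour_def simple_path_imp_path)
  have spb: "cmod z \<le> b" if "z \<in> spectrum UNIV S" for z
    using resolvent_outside_norm_ball(1)[OF S, of z] that by (force simp: spectrum_def)
  let ?X = "insert 0 (cmod ` (spectrum UNIV S - M))"
  have bdd: "bdd_above ?X" using spb S(3) by (intro bdd_aboveI[of _ b]) auto
  have mu0: "0 \<le> mu_star S M" unfolding mu_star_def using bdd by (intro cSup_upper) simp_all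
  have mu: "cmod z \<le> mu_star S M" if "z \<in> spectrum UNIV S" "z \<notin> M" for z
    unfolding mu_star_def using bdd that by (intro cSup_upper) simp_all
  have cG: "compact ?G" "?G \<noteq> {}" using g'(1) by (simp_all add: compact_path_image)
  have "continuous_on ?G cmod" by (intro continuous_intros)
  then obtain x where x: "x \<in> ?G" "\<And>z. z \<in> ?G \<Longrightarrow> cmod x \<le> cmod z"
    using continuous_attains_inf[OF cG] by blast
  define r where "r = cmod x"
  have r: "mu_star S M < r" using g'(3)[OF x(1)] by (simp add: r_def)
  then have r0: "0 < r" using mu0 by simp
  have inside_r: "r \<le> cmod p" if p: "p \<in> ?I" for p
  proof (rule ccontr)
    assume "\<not> r \<le> cmod p"
    then have "p \<in> ball 0 r" "0 \<in> ball 0 r" using r0 by auto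
    moreover have "ball 0 r \<subseteq> - ?G" using x(2) by (force simp: r_def)
    ultimately have "connected_component (- ?G) p 0"
      unfolding connected_component_def using connected_ball by blast
    then show False using inside_same_component p g'(6) by blast
  qed
  have wn0: "winding_number g p = 0" if "p \<notin> ?I" "p \<notin> ?G" for p
  proof (rule winding_number_zero_in_outside[OF g'(1,2)])
    show "p \<in> outside ?G" using that inside_Un_outside[of ?G] by blast
  qed
  have closedK: "closed ({z. r \<le> cmod z} - ?I)"
    using cG(1) by (intro closed_Diff open_inside compact_imp_closed closed_Collect_le continuous_intros)
  have "{z. r \<le> cmod z} - ?I \<subseteq> resolvent_set UNIV S"
  proof
    fix z assume z: "z \<in> {z. r \<le> cmod z} - ?I"
    show "z \<in> resolvent_set UNIV S"
    proof (rule ccontr)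
      assume "z \<notin> resolvent_set UNIV S"
      then have zs: "z \<in> spectrum UNIV S" by (simp add: spectrum_def)
      have "z \<notin> M" using z g'(5) by blast
      then show False using mu[OF zs] r z by simp
    qed
  qed
  moreover have "?G \<subseteq> {z. r \<le> cmod z} - ?I"
  proof
    fix z assume z: "z \<in> ?G"
    then have "z \<notin> ?I" using inside_no_overlap[of ?G] by blast
    then show "z \<in> {z. r \<le> cmod z} - ?I" using x(2)[OF z] by (simp add: r_def)
  qed
  ultimately show thesis using that[OF r0 closedK] inside_r wn0 by blast
qed

lemma finite_radius_gap:
  fixes Z :: "complex set"
  assumes "finite Z" "0 < r"
  obtains \<rho> where "0 < \<rho>" "\<rho> < r" "\<And>p. p \<in> Z \<Longrightarrow> cmod p < r \<Longrightarrow> cmod p < \<rho>"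
proof -
  let ?X = "insert 0 (cmod ` {p \<in> Z. cmod p < r})"
  have fin: "finite ?X" using assms(1) by simp
  define s where "s = Max ?X"
  have s: "0 \<le> s" "\<And>p. p \<in> Z \<Longrightarrow> cmod p < r \<Longrightarrow> cmod p \<le> s"
    unfolding s_def using fin by (auto intro: Max_ge)
  have "s \<in> ?X" unfolding s_def by (rule Max_in[OF fin]) simp
  then have "s < r" using assms(2) by auto
  show thesis
    by (rule that[of "(s + r) / 2"]) (use s \<open>s < r\<close> assms(2) in fastforce)+
qed

text \<open>With \<open>u = (z - S)\<^sup>-\<^sup>1 v\<close>, the second resolvent identity reads
  \<open>(z - T)\<^sup>-\<^sup>1 v - u = (z - T)\<^sup>-\<^sup>1 (T u - S u)\<close>.\<close>

lemma spectral_proj_diff_le: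
  assumes S: "spectral_contour S b g" and T: "spectral_contour T b' g"
    and L: "\<And>p. p tagged_division_of {0..1} \<Longrightarrow> path_variation g p \<le> L"
    and c: "\<And>z y. z \<in> path_image g \<Longrightarrow> norm (resolvent UNIV S z y) \<le> c * norm y"
    and c': "\<And>z y. z \<in> path_image g \<Longrightarrow> norm (resolvent UNIV T z y) \<le> c' * norm y" "0 \<le> c'"
    and d: "\<And>y. norm (T y - S y) \<le> d * norm y" "0 \<le> d"
  shows "2 * pi * norm (spectral_proj g T v - spectral_proj g S v) \<le> L * (c' * (d * (c * norm v)))"
proof -
  interpret S: spectral_contour S b g by (rule S)
  interpret T: spectral_contour T b' g by (rule T)
  let ?a = "2 * complex_of_real pi * \<i>"
  have "norm (?a *\<^sub>C T.P v - ?a *\<^sub>C S.P v) \<le> L * (c' * (d * (c * norm v)))"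
  proof (rule has_path_integral_diff_le[OF L T.has_path_integral_resolvent S.has_path_integral_resolvent])
    fix s :: real assume "s \<in> {0..1}"
    then have z: "g s \<in> path_image g" by (simp add: path_image_def)
    let ?z = "g s"
    have zT: "?z \<in> resolvent_set UNIV T" and zS: "?z \<in> resolvent_set UNIV S"
      using z S.g(3) T.g(3) by blast+
    let ?u = "S.R ?z v"
    have "?z *\<^sub>C ?u - T ?u = v - (T ?u - S ?u)"
      using resolvent_right[OF S.linT zS, of v] by (simp add: algebra_simps)
    then have "?u = T.R ?z (v - (T ?u - S ?u))"
      using resolvent_eqI[OF T.linT zT UNIV_I] by metis
    then have "T.R ?z v - ?u = T.R ?z (T ?u - S ?u)"
      using clinear_diff[OF clinear_resolvent[OF T.linT zT]] by (metis add_diff_cancel_left' diff_add_cancel)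
    then have "norm (T.R ?z v - ?u) \<le> c' * norm (T ?u - S ?u)" using c'(1)[OF z] by simp
    also have "\<dots> \<le> c' * (d * norm ?u)" using d(1) c'(2) by (rule mult_left_mono)
    also have "\<dots> \<le> c' * (d * (c * norm v))"
      using c[OF z] d(2) c'(2) by (intro mult_left_mono) auto
    finally show "norm (T.R ?z v - ?u) \<le> c' * (d * (c * norm v))" .
  qed
  moreover have "norm (?a *\<^sub>C T.P v - ?a *\<^sub>C S.P v) = 2 * pi * norm (T.P v - S.P v)"
    by (simp add: norm_scaleC norm_mult flip: complex_vector.scale_right_diff_distrib)
  ultimately show ?thesis by simp
qed

section \<open>Subspace iteration with the discretized filter\<close>

theorem theorem3p3:
  fixes D :: "'h::chilbert_space set" and A :: "'h \<Rightarrow> 'h"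
    and \<Lambda> :: "complex set" and m N :: nat
    and w zs :: "nat \<Rightarrow> complex"
    and \<iota> :: "'v::chilbert_space \<Rightarrow> 'h"
    and Vh :: "real \<Rightarrow> 'v set"
    and Rh :: "real \<Rightarrow> complex \<Rightarrow> 'h \<Rightarrow> 'v"
    and g :: "real \<Rightarrow> complex"
  assumes A: "linear_op D A" "closed_op D A" "selfadjoint_op D A"
    and \<Lambda>: "finite \<Lambda>" "\<Lambda> \<subseteq> spectrum D A"
      "\<And>l. l \<in> \<Lambda> \<Longrightarrow> eigenvalue D A l \<and> cfinite_dim (eigenspace D A l)"
    and m: "cfinite_dim (total_eigenspace D A \<Lambda>)" "m = cdim (total_eigenspace D A \<Lambda>)" "1 \<le> m"
    and A1: "assumption1 D A \<Lambda> N w zs"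
    and A2: "assumption2 D A \<Lambda> \<iota>"
    and discr: "discretization N zs Vh Rh"
    and A3: "assumption3 D A N zs \<iota> Rh"
    and \<Theta>: "admissible_contour g (SN D A N w zs \<iota>) (rN N w zs ` \<Lambda>)"
  shows "\<exists>h0>0. \<forall>h. 0 < h \<and> h < h0 \<longrightarrow>
    (\<forall>E0. csubspace E0 \<and> E0 \<subseteq> Vh h \<and> cdim E0 = m \<and>
        cdim (spectral_proj g (SNh N w zs \<iota> Rh h) ` E0) = m \<longrightarrow>
      (\<lambda>l. gap (((`) (SNh N w zs \<iota> Rh h) ^^ l) E0) (range (spectral_proj g (SNh N w zs \<iota> Rh h))))
        \<longlonglongrightarrow> 0)"
proof -
  let ?S = "SN D A N w zs \<iota>" and ?M = "eigen_complement D A \<Lambda>" and ?r = "rN N w zs"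
  let ?R = "\<lambda>k. resolvent D A (zs k)"
  let ?I = "inside (path_image g)"
  define Rk where "Rk k = restrict_op \<iota> (?R k)" for k
  have ne: "\<Lambda> \<noteq> {}"
  proof
    assume L: "\<Lambda> = {}"
    have "m = card ({} :: 'h set)"
      unfolding m(2) total_eigenspace_def L UN_empty
      by (rule complex_vector.dim_span_eq_card_independent[OF complex_vector.independent_empty])
    then show False using m(3) by simp
  qed
  have res: "zs k \<in> resolvent_set D A" if k: "k < N" for k
  proof (rule ccontr)
    assume "zs k \<notin> resolvent_set D A"
    then have "zs k \<in> spectrum D A" by (simp add: spectrum_def)
    then have "zs k \<in> closure (spectrum D A)" using closure_subset by blast
    moreover have "zs k \<notin> closure (spectrum D A)" using A1 k unfolding assumption1_def by blast
    ultimately show False by blast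
  qed
  have \<iota>: "clinear \<iota>" "inj \<iota>"
    and inv: "\<And>z. z \<in> resolvent_set D A \<Longrightarrow> resolvent D A z ` range \<iota> \<subseteq> range \<iota>"
    using A2 unfolding assumption2_def by blast+
  obtain ci where ci: "ci > 0" "\<And>u. norm (\<iota> u) \<le> ci * norm u"
    using A2 unfolding assumption2_def by blast
  have \<iota>0: "u = 0" if "\<iota> u = 0" for u
    using injD[OF \<iota>(2), of u 0] that clinear_zero[OF \<iota>(1)] by simp
  have \<iota>R: "\<iota> (Rk k v) = ?R k (\<iota> v)" if k: "k < N" for k v
  proof -
    have "?R k (\<iota> v) \<in> range \<iota>" using inv[OF res[OF k]] by blast
    then show ?thesis unfolding Rk_def restrict_op_def by (rule f_inv_into_f)
  qed
  have linRk: "clinear (Rk k)" if k: "k < N" for k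
    unfolding clinear_iff
  proof (intro conjI allI)
    note lin = clinear_resolvent[OF A(1) res[OF k]]
    show "Rk k (x + y) = Rk k x + Rk k y" for x y
      by (rule injD[OF \<iota>(2)]) (simp only: \<iota>R[OF k] clinear_add[OF \<iota>(1)] clinear_add[OF lin])
    show "Rk k (c *\<^sub>C x) = c *\<^sub>C Rk k x" for c x
      by (rule injD[OF \<iota>(2)]) (simp only: \<iota>R[OF k] clinear_scaleC[OF \<iota>(1)] clinear_scaleC[OF lin])
  qed
  have blRk: "bounded_linear (Rk k)" if "k < N" for k
    using A3 that unfolding assumption3_def Rk_def by blast
  have "\<exists>c. \<forall>v. norm (Rk k v) \<le> c * norm v" if k: "k < N" for k
  proof -
    obtain c where "\<And>v. norm (Rk k v) \<le> norm v * c"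
      using bounded_linear.bounded[OF blRk[OF k]] by blast
    then show ?thesis by (intro exI[of _ c]) (simp add: mult.commute)
  qed
  then obtain cR where cR: "\<And>k v. k < N \<Longrightarrow> norm (Rk k v) \<le> cR k * norm v" by metis
  have S_eq: "?S = filter_op N w Rk" by (simp add: SN_def Rk_def[abs_def])
  have linS: "clinear ?S" unfolding S_eq by (rule clinear_filter_op) (rule linRk)
  define b where "b = \<bar>cmod (w N) + (\<Sum>k<N. cmod (w k) * cR k)\<bar>"
  have b0: "0 \<le> b" by (simp add: b_def)
  have Sb: "norm (?S v) \<le> b * norm v" for v
  proof -
    have "norm (?S v) \<le> (cmod (w N) + (\<Sum>k<N. cmod (w k) * cR k)) * norm v"
      unfolding S_eq by (rule filter_op_norm_le) (rule cR)
    also have "\<dots> \<le> b * norm v" unfolding b_def by (rule mult_right_mono[OF abs_ge_self norm_ge_zero])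
    finally show ?thesis .
  qed
  have \<iota>S: "\<iota> (?S v) = filter_op N w ?R (\<iota> v)" for v
    by (simp add: S_eq filter_op_def clinear_add[OF \<iota>(1)] clinear_sum[OF \<iota>(1)]
        clinear_scaleC[OF \<iota>(1)] \<iota>R)
  have g: "rectifiable_path g" "pathfinish g = pathstart g" "0 \<notin> ?I" "?r ` \<Lambda> \<subseteq> ?I"
    "?I \<inter> spectrum UNIV ?S \<subseteq> ?r ` \<Lambda>" "\<And>z. z \<in> ?I \<Longrightarrow> winding_number g z = 1"
    using \<Theta> unfolding admissible_contour_def by blast+
  have openI: "open ?I"
    using g(1) by (simp add: rectifiable_path_def open_inside compact_imp_closed compact_path_image)
  show ?thesis
  proof (rule admissible_contour_separates[OF linS Sb b0 \<Theta>])
    fix r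
    let ?K = "{z. r \<le> cmod z} - ?I"
    assume r: "r > 0" and K: "closed ?K" "?K \<subseteq> resolvent_set UNIV ?S" "path_image g \<subseteq> ?K"
      and inside_r: "\<And>p. p \<in> ?I \<Longrightarrow> r \<le> cmod p"
      and outside: "\<And>p. p \<notin> ?I \<Longrightarrow> p \<notin> path_image g \<Longrightarrow> winding_number g p = 0"
    have path_r: "r \<le> cmod z" if "z \<in> path_image g" for z using K(3) that by blast
    have zero: "0 \<notin> path_image g" "winding_number g 0 = 0"
      using path_r[of 0] r outside[OF g(3)] by auto
    have scS: "spectral_contour ?S b g"
      by (rule spectral_contour.intro[OF linS Sb b0 g(1,2) order_trans[OF K(3,2)] zero])

    \<comment> \<open>the exact spectral projection annihilates the complement of the eigenvectors\<close>
    have vanish: "spectral_proj g ?S v = 0" if v: "\<iota> v \<in> ?M" for v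
    proof (rule spectral_contour.P_vanish[OF scS \<iota>(1) ci(2) \<iota>0, of "?r ` \<Lambda>"])
      show "finite (?r ` \<Lambda>)" using \<Lambda>(1) by simp
      show "winding_number g z = 0" if "z \<in> spectrum UNIV ?S" "z \<notin> ?r ` \<Lambda>" for z
      proof (rule outside)
        show "z \<notin> ?I" using that g(5) by blast
        show "z \<notin> path_image g" using that(1) K(2,3) by (auto simp: spectrum_def)
      qed
      fix \<mu> assume "\<mu> \<in> ?r ` \<Lambda>"
      then obtain l where l: "l \<in> \<Lambda>" "\<mu> = ?r l" by blast
      obtain c1 where c1: "c1 \<ge> 0" "\<And>u. u \<in> ?M \<Longrightarrow>
          norm u \<le> c1 * norm (filter_op N w ?R u - \<mu> *\<^sub>C u)"
        using filter_bounded_below_on_complement[OF A \<Lambda>(1,2) l(1) A1 res] unfolding l(2) by blast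
      have "open (?I - (?r ` \<Lambda> - {\<mu>}))"
        by (intro open_Diff openI finite_imp_closed finite_Diff finite_imageI \<Lambda>(1))
      moreover have "\<mu> \<in> ?I - (?r ` \<Lambda> - {\<mu>})" using g(4) l by blast
      ultimately obtain e1 where e1: "e1 > 0" "ball \<mu> e1 \<subseteq> ?I - (?r ` \<Lambda> - {\<mu>})"
        unfolding open_contains_ball by blast
      \<comment> \<open>small enough for the lower bound at \<open>\<mu>\<close> to persist, with constant \<open>2 * c1\<close>\<close>
      define e where "e = min e1 (1 / (2 * (c1 + 1)))"
      have e: "e > 0" using e1(1) c1(1) by (simp add: e_def)
      have "z \<in> resolvent_set UNIV ?S \<and> norm (\<iota> (resolvent UNIV ?S z v)) \<le> 2 * c1 * norm (\<iota> v)"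
        if z: "z \<in> ball \<mu> e - {\<mu>}" for z
      proof -
        have zI: "z \<in> ?I" "z \<notin> ?r ` \<Lambda>" using z e1(2) by (auto simp: e_def)
        then have zres: "z \<in> resolvent_set UNIV ?S" using g(5) by (auto simp: spectrum_def)
        let ?u = "resolvent UNIV ?S z v"
        have "z *\<^sub>C ?u - ?S ?u = v"
          by (rule resolvent_right[OF linS[folded linear_op_UNIV] zres])
        from arg_cong[OF this, of \<iota>]
        have eq: "z *\<^sub>C \<iota> ?u - filter_op N w ?R (\<iota> ?u) = \<iota> v"
          by (simp only: clinear_diff[OF \<iota>(1)] clinear_scaleC[OF \<iota>(1)] \<iota>S)
        have uM: "\<iota> ?u \<in> ?M"
          unfolding eigen_complement_def
        proof (intro CollectI ballI)
          fix l' x assume l': "l' \<in> \<Lambda>" and x: "x \<in> eigenspace D A l'"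
          have ls: "l' \<in> spectrum D A" using \<Lambda>(2) l' by blast
          have fx: "cinner (filter_op N w ?R (\<iota> ?u)) x = ?r l' * cinner (\<iota> ?u) x"
            by (rule filter_op_eigenvector[OF A(1,3) _ x assumption1_isolated(1)[OF A1 \<Lambda>(1) l'] ls])
              (rule res)
          have "cinner (\<iota> v) x = 0" using v l' x by (simp add: eigen_complement_def)
          then have "(z - ?r l') * cinner (\<iota> ?u) x = 0"
            using arg_cong[OF eq, of "\<lambda>y. cinner y x"] fx
            by (simp add: cinner_diff_left cinner_scaleC_left left_diff_distrib)
          moreover have "z - ?r l' \<noteq> 0" using zI(2) l' by auto
          ultimately show "cinner (\<iota> ?u) x = 0" by simp
        qed
        have "filter_op N w ?R (\<iota> ?u) = z *\<^sub>C \<iota> ?u - \<iota> v" using eq by (simp add: algebra_simps)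
        then have "filter_op N w ?R (\<iota> ?u) - \<mu> *\<^sub>C \<iota> ?u = (z - \<mu>) *\<^sub>C \<iota> ?u - \<iota> v"
          by (simp add: complex_vector.scale_left_diff_distrib)
        then have "norm (\<iota> ?u) \<le> c1 * norm ((z - \<mu>) *\<^sub>C \<iota> ?u - \<iota> v)" using c1(2)[OF uM] by simp
        also have "\<dots> \<le> c1 * (cmod (z - \<mu>) * norm (\<iota> ?u) + norm (\<iota> v))"
          using c1(1) norm_triangle_ineq4[of "(z - \<mu>) *\<^sub>C \<iota> ?u" "\<iota> v"]
          by (intro mult_left_mono) (simp_all add: norm_scaleC)
        finally have le: "norm (\<iota> ?u) \<le> c1 * cmod (z - \<mu>) * norm (\<iota> ?u) + c1 * norm (\<iota> v)"
          by (simp add: distrib_left mult.assoc)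
        have "cmod (z - \<mu>) \<le> 1 / (2 * (c1 + 1))"
          using z by (simp add: e_def dist_norm norm_minus_commute)
        then have "c1 * cmod (z - \<mu>) \<le> c1 * (1 / (2 * (c1 + 1)))" using c1(1) by (rule mult_left_mono)
        also have "\<dots> \<le> 1 / 2" using c1(1) by (simp add: field_simps)
        finally have "c1 * cmod (z - \<mu>) * norm (\<iota> ?u) \<le> 1 / 2 * norm (\<iota> ?u)"
          by (rule mult_right_mono) simp
        then show ?thesis using le zres by simp
      qed
      then show "\<exists>e>0. \<exists>B. \<forall>z\<in>ball \<mu> e - {\<mu>}.
          z \<in> resolvent_set UNIV ?S \<and> norm (\<iota> (resolvent UNIV ?S z v)) \<le> B"
        using e by blast
    qed

    obtain c where c: "c > 0" "\<And>z y. z \<in> ?K \<Longrightarrow> norm (resolvent UNIV ?S z y) \<le> c * norm y"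
      using resolvent_bounded_on_closed[OF linS Sb b0 K(1,2)] by blast
    obtain L where L: "L > 0" "\<And>p. p tagged_division_of {0..1} \<Longrightarrow> path_variation g p \<le> L"
      using path_variation_bounded[OF g(1)] by blast
    \<comment> \<open>the first bound keeps \<open>K\<close> in the resolvent set, the second makes the spectral projections
      differ by at most one half in norm\<close>
    define \<epsilon> where "\<epsilon> = min (1 / (2 * c)) (pi / (2 * L * c\<^sup>2))"
    have \<epsilon>: "\<epsilon> > 0" using c(1) L(1) by (simp add: \<epsilon>_def)
    have "\<epsilon> * c \<le> 1 / (2 * c) * c" using c(1) by (intro mult_right_mono) (simp_all add: \<epsilon>_def)
    then have \<epsilon>c: "\<epsilon> * c \<le> 1 / 2" using c(1) by simp
    have "\<epsilon> * (2 * L * c\<^sup>2) \<le> pi / (2 * L * c\<^sup>2) * (2 * L * c\<^sup>2)"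
      using c(1) L(1) by (intro mult_right_mono) (simp_all add: \<epsilon>_def)
    then have \<epsilon>L: "\<epsilon> * (2 * L * c\<^sup>2) \<le> pi" using c(1) L(1) by simp

    define W where "W = (\<Sum>k<N. cmod (w k))"
    have W0: "0 \<le> W" by (simp add: W_def sum_nonneg)
    define e where "e = \<epsilon> / (W + 1)"
    have e: "e > 0" using \<epsilon> W0 by (simp add: e_def)
    have "\<forall>\<^sub>F h in at_right 0. onorm (\<lambda>v. Rh h (zs k) (\<iota> v) - Rk k v) < e" if "k \<in> {..<N}" for k
    proof -
      have "((\<lambda>h. onorm (\<lambda>v. Rh h (zs k) (\<iota> v) - Rk k v)) \<longlongrightarrow> 0) (at_right 0)"
        using A3 that unfolding assumption3_def Rk_def by blast
      then show ?thesis by (rule order_tendstoD(2)[OF _ e])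
    qed
    then have "\<forall>\<^sub>F h in at_right 0. \<forall>k\<in>{..<N}. onorm (\<lambda>v. Rh h (zs k) (\<iota> v) - Rk k v) < e"
      by (intro eventually_ball_finite ballI) simp_all
    then obtain h0 where h0: "h0 > 0"
      "\<And>h k. 0 < h \<Longrightarrow> h < h0 \<Longrightarrow> k < N \<Longrightarrow> onorm (\<lambda>v. Rh h (zs k) (\<iota> v) - Rk k v) < e"
      unfolding eventually_at_right_field by auto

    have "(\<lambda>l. gap (((`) (SNh N w zs \<iota> Rh h) ^^ l) E0) (range (spectral_proj g (SNh N w zs \<iota> Rh h))))
        \<longlonglongrightarrow> 0"
      if h: "0 < h" "h < h0" and E0: "csubspace E0" "cdim E0 = m"
        "cdim (spectral_proj g (SNh N w zs \<iota> Rh h) ` E0) = m" for h E0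
    proof -
      let ?T = "SNh N w zs \<iota> Rh h"
      define Q where "Q k = Rh h (zs k) \<circ> \<iota>" for k
      have Vh: "csubspace (Vh h)" "cfinite_dim (Vh h)"
        "\<And>k. k < N \<Longrightarrow> clinear (Rh h (zs k)) \<and> range (Rh h (zs k)) \<subseteq> Vh h"
        using discr h(1) unfolding discretization_def by blast+
      have linQ: "clinear (Q k)" if "k < N" for k
        unfolding Q_def comp_def using Vh(3)[OF that] \<iota>(1) clinear_compose by blast
      have T_eq: "?T = filter_op N w Q" by (simp add: SNh_def Q_def[abs_def])
      have linT: "clinear ?T" unfolding T_eq by (rule clinear_filter_op) (rule linQ)
      have diff: "norm (?T v - ?S v) \<le> \<epsilon> * norm v" for v
      proof -
        have Qd: "norm (Q k v - Rk k v) \<le> e * norm v" if k: "k < N" for k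
        proof -
          have "bounded_linear (Rh h (zs k) \<circ> \<iota>)"
            using A3 k h(1) unfolding assumption3_def by blast
          then have "bounded_linear (\<lambda>v. Rh h (zs k) (\<iota> v) - Rk k v)"
            using bounded_linear_sub[OF _ blRk[OF k]] unfolding comp_def by blast
          from onorm[OF this, of v]
          have "norm (Q k v - Rk k v) \<le> onorm (\<lambda>v. Rh h (zs k) (\<iota> v) - Rk k v) * norm v"
            by (simp add: Q_def)
          also have "\<dots> \<le> e * norm v"
            using h0(2)[OF h k] by (intro mult_right_mono) auto
          finally show ?thesis .
        qed
        have "norm (?T v - ?S v) \<le> W * e * norm v"
          unfolding T_eq S_eq W_def by (rule filter_op_diff_norm_le) (rule Qd)
        also have "W * e \<le> \<epsilon>" using W0 \<epsilon> by (simp add: e_def field_simps)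
        finally show ?thesis by (simp add: mult_right_mono)
      qed
      have Tb: "norm (?T v) \<le> (b + \<epsilon>) * norm v" for v
        using norm_triangle_ineq[of "?S v" "?T v - ?S v"] Sb[of v] diff[of v]
        by (simp add: distrib_right)
      have linB: "clinear (\<lambda>v. ?T v - ?S v)"
        using linT linS by (simp add: clinear_iff scaleC_simps)
      have pert: "z \<in> resolvent_set UNIV ?T \<and> norm (resolvent UNIV ?T z y) \<le> 2 * c * norm y"
        if z: "z \<in> ?K" for z y
      proof -
        have T_sum: "(\<lambda>v. ?S v + (?T v - ?S v)) = ?T" by simp
        have zS: "z \<in> resolvent_set UNIV ?S" using K(2) z by blast
        have "\<epsilon> * c < 1" using \<epsilon>c by simp
        note P = resolvent_perturb[OF linS[folded linear_op_UNIV] zS c(2)[OF z]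
            less_imp_le[OF c(1)] linB diff less_imp_le[OF \<epsilon>] this, unfolded T_sum]
        have "c / (1 - \<epsilon> * c) \<le> c / (1 / 2)"
          using \<epsilon>c c(1) by (intro divide_left_mono) auto
        then have "c / (1 - \<epsilon> * c) * norm y \<le> 2 * c * norm y"
          by (intro mult_right_mono) auto
        then show ?thesis using P(1) P(2)[of y] by linarith
      qed
      have fin: "finite (spectrum UNIV ?T)"
      proof -
        obtain B where B: "finite B" "Vh h \<subseteq> cspan B" using Vh(2) unfolding cfinite_dim_def by blast
        define Kv where "Kv v = (\<Sum>k<N. w k *\<^sub>C Q k v)" for v
        have T_Kv: "?T = (\<lambda>v. w N *\<^sub>C v + Kv v)" unfolding T_eq filter_op_def Kv_def by (rule refl)
        show ?thesis
        proof (rule finite_rank_perturbation_spectrum[OF _ _ _ B(1) T_Kv])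
          show "clinear Kv"
            unfolding clinear_iff Kv_def using linQ
            by (simp add: clinear_iff scaleC_simps sum.distrib complex_vector.scale_sum_right mult.commute)
          show "norm (Kv v) \<le> (b + \<epsilon> + cmod (w N)) * norm v" for v
            using norm_triangle_ineq4[of "?T v" "w N *\<^sub>C v"] Tb[of v]
            by (simp add: T_Kv norm_scaleC distrib_right)
          have "Q k v \<in> cspan B" if "k < N" for k v
            using Vh(3)[OF that] B(2) by (auto simp: Q_def)
          then show "range Kv \<subseteq> cspan B"
            by (auto simp: Kv_def intro!: complex_vector.span_sum complex_vector.span_scale)
        qed
      qed
      have scT: "spectral_contour ?T (b + \<epsilon>) g"
      proof (rule spectral_contour.intro[OF linT Tb _ g(1,2) _ zero])
        show "path_image g \<subseteq> resolvent_set UNIV ?T" using K(3) pert by blast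
        show "0 \<le> b + \<epsilon>" using b0 \<epsilon> by simp
      qed
      obtain \<rho> where \<rho>: "0 < \<rho>" "\<rho> < r"
        "\<And>p. p \<in> spectrum UNIV ?T \<Longrightarrow> cmod p < r \<Longrightarrow> cmod p < \<rho>"
        using finite_radius_gap[OF fin r] by blast
      have sp: "(winding_number g p = 1 \<and> \<rho> < cmod p) \<or> (winding_number g p = 0 \<and> cmod p < \<rho>)"
        if p: "p \<in> spectrum UNIV ?T" for p
      proof (cases "p \<in> ?I")
        case True
        then show ?thesis using g(6) inside_r[OF True] \<rho>(2) by simp
      next
        case False
        have nK: "p \<notin> ?K" using p pert[of p] by (auto simp: spectrum_def)
        then have "cmod p < r" using False by auto
        moreover have "p \<notin> path_image g" using nK K(3) by blast
        ultimately show ?thesis using \<rho>(3)[OF p] outside[OF False] by simp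
      qed
      note linP = spectral_contour.clinear_P[OF scT]

      \<comment> \<open>\<open>v\<close> equals the difference of its two spectral projections, which is too small unless \<open>v = 0\<close>\<close>
      have trivial: "v = 0" if v: "v \<in> range (spectral_proj g ?T)" "\<iota> v \<in> ?M" for v
      proof -
        obtain u where u: "v = spectral_proj g ?T u" using v(1) by blast
        have Pv: "spectral_proj g ?T v = v"
          unfolding u by (rule spectral_contour.P_idempotent[OF scT fin \<rho>(1,2) sp path_r])
        have "2 * pi * norm (spectral_proj g ?T v - spectral_proj g ?S v)
            \<le> L * (2 * c * (\<epsilon> * (c * norm v)))"
        proof (rule spectral_proj_diff_le[OF scS scT L(2)])
          show "norm (resolvent UNIV ?S z y) \<le> c * norm y" if "z \<in> path_image g" for z y
            using c(2) K(3) that by blast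
          show "norm (resolvent UNIV ?T z y) \<le> 2 * c * norm y" if "z \<in> path_image g" for z y
            using pert K(3) that by blast
        qed (use c(1) diff \<epsilon> in simp_all)
        also have "\<dots> = \<epsilon> * (2 * L * c\<^sup>2) * norm v" by (simp add: power2_eq_square mult_ac)
        also have "\<dots> \<le> pi * norm v" by (rule mult_right_mono[OF \<epsilon>L norm_ge_zero])
        finally have "2 * pi * norm v \<le> pi * norm v" by (simp add: Pv vanish[OF v(2)])
        then show ?thesis by simp
      qed

      obtain B where B: "finite B" "cindependent B" "cspan B = total_eigenspace D A \<Lambda>" "card B = m"
        using cdim_basis[of "total_eigenspace D A \<Lambda>" m] m(2,3)
        unfolding total_eigenspace_def by (metis complex_vector.subspace_span)
      \<comment> \<open>the \<open>m\<close> coefficients that determine an element of the range\<close>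
      define G where "G v = (\<Sum>x\<in>B. cinner (\<iota> v) x *\<^sub>C x)" for v
      have linG: "clinear G"
        unfolding clinear_iff G_def
        by (simp add: clinear_add[OF \<iota>(1)] clinear_scaleC[OF \<iota>(1)] cinner_add_left cinner_scaleC_left
            scaleC_simps sum.distrib complex_vector.scale_sum_right)
      have GM: "\<iota> v \<in> ?M" if Gv: "G v = 0" for v
      proof -
        have "\<forall>x\<in>B. cinner (\<iota> v) x = 0"
          using B(2) Gv unfolding G_def complex_vector.dependent_finite[OF B(1)] by blast
        then have "B \<subseteq> {x. cinner x (\<iota> v) = 0}"
          using cinner_commute[of _ "\<iota> v"] by auto
        then have "cspan B \<subseteq> {x. cinner x (\<iota> v) = 0}"
          by (intro complex_vector.span_minimal csubspace_orthogonal)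
        then have orth: "cinner x (\<iota> v) = 0" if "x \<in> total_eigenspace D A \<Lambda>" for x
          using B(3) that by blast
        have "cinner (\<iota> v) x = 0" if "l \<in> \<Lambda>" "x \<in> eigenspace D A l" for l x
        proof -
          have "x \<in> total_eigenspace D A \<Lambda>"
            unfolding total_eigenspace_def using that by (intro complex_vector.span_base) blast
          then show ?thesis using orth cinner_commute[of "\<iota> v" x] by simp
        qed
        then show ?thesis by (simp add: eigen_complement_def)
      qed
      have "W = range (spectral_proj g ?T)"
        if "csubspace W" "W \<subseteq> range (spectral_proj g ?T)" "cdim W = m" for W
      proof (rule subspace_eq_by_dim[OF linG _ _ B(1) _ _ that m(3)])
        show "csubspace (range (spectral_proj g ?T))"
          by (rule clinear_image_subspace[OF linP complex_vector.subspace_UNIV])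
        show "x = 0" if "x \<in> range (spectral_proj g ?T)" "G x = 0" for x
          by (rule trivial[OF that(1) GM[OF that(2)]])
        show "G ` range (spectral_proj g ?T) \<subseteq> cspan B"
          by (auto simp: G_def intro!: complex_vector.span_sum complex_vector.span_scale
              intro: complex_vector.span_base)
      qed (simp add: B(4))
      then show ?thesis
        using spectral_contour.subspace_iteration_gap[OF scT fin \<rho>(1,2) sp path_r E0 m(3)] by blast
    qed
    then show ?thesis using h0(1) by (intro exI[of _ h0]) blast
  qed
qed

end
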